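(* Let $\xi_i=\ker\alpha_i$, $i=1,2$, be two positive contact structures, with contact forms $\alpha_i$, defined near $S^1=S^1\times\{0\}\subset S^1\times\mathbb{R}^2$. Suppose there is a smooth function $\mu\colon S^1\to\mathbb{R}^+$ such that $\alpha_1(\partial_\theta)|_{S^1}=\mu\,\alpha_2(\partial_\theta)|_{S^1}$. Then there is a neighbourhood $U$ of $S^1$ and a contactomorphism $f\colon (U,\xi_1)\to (f(U),\xi_2)$ that is equal to the identity on $S^1$.
   Context: Coordinates on $S^1\times\mathbb{R}^2$ are denoted $\theta,x,y$, and $S^1$ is shorthand for $S^1\times\{0\}\subset S^1\times\mathbb{R}^2$. $\mathbb{R}^+$ denotes the positive real numbers. A contact structure $\ker\alpha$ is positive if $\alpha\wedge d\alpha$ is a positive multiple of the orientation form $d\theta\wedge dx\wedge dy$. A contactomorphism $(U,\xi_1)\to(f(U),\xi_2)$ is a diffeomorphism $f$ from $U$ onto the open set $f(U)$ whose differential maps $\xi_1$ to $\xi_2$. No assumption is made that $S^1$ is Legendrian or transverse to the contact structures. *)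

theory Defs
  imports "HOL-Analysis.Analysis"
begin

section \<open>Smooth maps on open subsets of Euclidean spaces\<close>

text \<open>Intended for open \<open>S\<close> and finite-dimensional domains, where existence and continuity of all
  iterated directional derivatives of order at most \<open>k\<close> is the usual notion of class $C^k$.\<close>

primrec Ck_on ::
    "nat \<Rightarrow> 'a::real_normed_vector set \<Rightarrow> ('a \<Rightarrow> 'b::real_normed_vector) \<Rightarrow> bool" where
  "Ck_on 0 S f \<longleftrightarrow> continuous_on S f"
| "Ck_on (Suc k) S f \<longleftrightarrow>
     (\<forall>x\<in>S. f differentiable (at x)) \<and> (\<forall>v. Ck_on k S (\<lambda>x. frechet_derivative f (at x) v))"

definition smooth_on :: "'a::real_normed_vector set \<Rightarrow> ('a \<Rightarrow> 'b::real_normed_vector) \<Rightarrow> bool" where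
  "smooth_on S f \<longleftrightarrow> (\<forall>k. Ck_on k S f)"


section \<open>The manifold \<open>S\<^sup>1 \<times> \<real>\<^sup>2\<close>\<close>

text \<open>The manifold is realised as the submanifold \<open>sphere 0 1 \<times> UNIV\<close> of \<open>\<complex> \<times> \<real> \<times> \<real>\<close>. The
  local diffeomorphism \<open>cyl\<close> supplies the coordinates \<open>\<theta>, x, y\<close>, the first one being an angle
  modulo \<open>2\<pi>\<close>; calculus on the manifold is done after composition with \<open>cyl\<close>.\<close>

type_synonym point = "complex \<times> real \<times> real"
type_synonym coords = "real \<times> real \<times> real"

definition S1R2 :: "point set" where
  "S1R2 = sphere 0 1 \<times> UNIV"

definition core_circle :: "point set" where
  "core_circle = sphere 0 1 \<times> {(0, 0)}"

definition cyl :: "coords \<Rightarrow> point" where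
  "cyl = (\<lambda>(\<theta>, x, y). (cis \<theta>, x, y))"

text \<open>\<open>frame p (a, b, c)\<close> is the tangent vector \<open>a \<partial>\<^sub>\<theta> + b \<partial>\<^sub>x + c \<partial>\<^sub>y\<close> at \<open>p\<close>, as a
  vector of the ambient space.\<close>

definition frame :: "point \<Rightarrow> coords \<Rightarrow> point" where
  "frame p = (\<lambda>(a, b, c). (a *\<^sub>R (\<i> * fst p), b, c))"

lemma cyl_has_derivative: "(cyl has_derivative frame (cyl q)) (at q)"
proof -
  have "(cis has_derivative (\<lambda>t. t *\<^sub>R (\<i> * cis (fst q)))) (at (fst q))"
    by (rule has_derivative_eq_rhs[OF has_derivative_cis[OF has_derivative_ident]])
      (simp add: cis_conv_exp)
  from has_derivative_compose[OF bounded_linear.has_derivative[OF bounded_linear_fst has_derivative_ident] this]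
  have "((\<lambda>q::coords. cis (fst q)) has_derivative (\<lambda>v. fst v *\<^sub>R (\<i> * cis (fst q)))) (at q)" .
  then have "((\<lambda>q::coords. (cis (fst q), snd q)) has_derivative
      (\<lambda>v. (fst v *\<^sub>R (\<i> * cis (fst q)), snd v))) (at q)"
    by (intro has_derivative_Pair bounded_linear.has_derivative[OF bounded_linear_snd] has_derivative_ident)
  moreover have "cyl = (\<lambda>q. (cis (fst q), snd q))"
    by (auto simp: cyl_def fun_eq_iff)
  moreover have "frame (cyl q) = (\<lambda>v. (fst v *\<^sub>R (\<i> * cis (fst q)), snd v))"
    by (auto simp: frame_def cyl_def fun_eq_iff split: prod.splits)
  ultimately show ?thesis by simp
qed

abbreviation d_theta :: "point \<Rightarrow> point" where
  "d_theta p \<equiv> frame p (1, 0, 0)"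

definition tangent :: "point \<Rightarrow> point set" where
  "tangent p = range (frame p)"


section \<open>One-forms and contact structures\<close>

text \<open>A one-form \<open>\<alpha>\<close> assigns to a point \<open>p\<close> a functional \<open>\<alpha> p\<close> on tangent vectors; its values on
  ambient vectors outside \<open>tangent p\<close> are irrelevant.\<close>

type_synonym one_form = "point \<Rightarrow> point \<Rightarrow> real"

definition pullback_cyl :: "one_form \<Rightarrow> coords \<Rightarrow> coords \<Rightarrow> real" where
  "pullback_cyl \<alpha> q v = \<alpha> (cyl q) (frame (cyl q) v)"

definition one_form_on :: "point set \<Rightarrow> one_form \<Rightarrow> bool" where
  "one_form_on V \<alpha> \<longleftrightarrow>
     (\<forall>p\<in>V. linear (\<lambda>v. \<alpha> p (frame p v))) \<and>
     (\<forall>v. smooth_on (cyl -` V) (\<lambda>q. pullback_cyl \<alpha> q v))"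

text \<open>Exterior derivative and exterior product in coordinates, normalised by
  \<open>d\<beta>(X, Y) = X \<beta>(Y) - Y \<beta>(X)\<close> for constant vector fields and
  \<open>(d\<theta> \<and> dx \<and> dy)(\<partial>\<^sub>\<theta>, \<partial>\<^sub>x, \<partial>\<^sub>y) = 1\<close>.\<close>

definition ext_deriv :: "(coords \<Rightarrow> coords \<Rightarrow> real) \<Rightarrow> coords \<Rightarrow> coords \<Rightarrow> coords \<Rightarrow> real" where
  "ext_deriv \<beta> q u v =
     frechet_derivative (\<lambda>r. \<beta> r v) (at q) u - frechet_derivative (\<lambda>r. \<beta> r u) (at q) v"

definition wedge_1_2 ::
    "(coords \<Rightarrow> real) \<Rightarrow> (coords \<Rightarrow> coords \<Rightarrow> real) \<Rightarrow> coords \<Rightarrow> coords \<Rightarrow> coords \<Rightarrow> real" where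
  "wedge_1_2 \<beta> \<omega> u v w = \<beta> u * \<omega> v w + \<beta> v * \<omega> w u + \<beta> w * \<omega> u v"

definition positive_contact_form_on :: "point set \<Rightarrow> one_form \<Rightarrow> bool" where
  "positive_contact_form_on V \<alpha> \<longleftrightarrow>
     one_form_on V \<alpha> \<and>
     (\<forall>q\<in>cyl -` V.
        wedge_1_2 (pullback_cyl \<alpha> q) (ext_deriv (pullback_cyl \<alpha>) q) (1, 0, 0) (0, 1, 0) (0, 0, 1) > 0)"

definition ker_form :: "one_form \<Rightarrow> point \<Rightarrow> point set" where
  "ker_form \<alpha> p = {w \<in> tangent p. \<alpha> p w = 0}"


section \<open>Contactomorphisms\<close>

text \<open>Since the target is an embedded submanifold, smoothness may be tested in the ambient space.\<close>

definition smooth_map_on :: "point set \<Rightarrow> (point \<Rightarrow> point) \<Rightarrow> bool" where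
  "smooth_map_on U f \<longleftrightarrow> f ` U \<subseteq> S1R2 \<and> smooth_on (cyl -` U) (f \<circ> cyl)"

definition diffeo_onto_image :: "point set \<Rightarrow> (point \<Rightarrow> point) \<Rightarrow> bool" where
  "diffeo_onto_image U f \<longleftrightarrow>
     openin (top_of_set S1R2) U \<and> openin (top_of_set S1R2) (f ` U) \<and> inj_on f U \<and>
     smooth_map_on U f \<and> smooth_map_on (f ` U) (inv_into U f)"

text \<open>By the chain rule, the differential of \<open>f\<close> at \<open>cyl q\<close> sends \<open>frame (cyl q) v\<close> to
  \<open>frechet_derivative (f \<circ> cyl) (at q) v\<close>.\<close>

definition contactomorphism ::
    "point set \<Rightarrow> (point \<Rightarrow> point set) \<Rightarrow> (point \<Rightarrow> point set) \<Rightarrow> (point \<Rightarrow> point) \<Rightarrow> bool" where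
  "contactomorphism U \<xi>1 \<xi>2 f \<longleftrightarrow>
     diffeo_onto_image U f \<and>
     (\<forall>q\<in>cyl -` U.
        frechet_derivative (f \<circ> cyl) (at q) ` {v. frame (cyl q) v \<in> \<xi>1 (cyl q)} = \<xi>2 (f (cyl q)))"

end

theory Submission
  imports Defs
begin

text \<open>Every positive contact structure near the circle is brought into the normal form
  \<open>ker ((a - x) d\<theta> + dy)\<close> by a diffeomorphism fixing the circle, where \<open>a(\<theta>) = \<alpha>(\<partial>\<^sub>\<theta>)\<close> on the
  circle; replacing \<open>\<alpha>\<^sub>2\<close> by \<open>\<mu> \<alpha>\<^sub>2\<close> makes the two normal forms equal. Write \<open>\<alpha> = a d\<theta> + b dx + c dy\<close>.
  A linear change of coordinates depending on \<open>\<theta>\<close> achieves \<open>b = 0\<close> and \<open>c = 1\<close> on the circle. Dividing by \<open>c\<close>,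
  the curves with \<open>\<theta>\<close> constant and \<open>dy/dx = - b\<close> are Legendrian. If \<open>u\<close> denotes the value
  at \<open>x = 0\<close> of the curve through a point, then the form is, up to a positive factor, \<open>P d\<theta> + du\<close> in the
  coordinates \<open>\<theta>, x, u\<close>. Now the contact condition says \<open>\<partial>P/\<partial>x < 0\<close>, so \<open>a - P\<close> can be
  taken as a new coordinate instead of \<open>x\<close>. This replaces Gray stability: the only flow needed is that of a
  scalar ODE with a parameter.\<close>


section \<open>Calculus of maps of class $C^k$\<close>

text \<open>The circle may be Legendrian at some points and transverse at others. Where
  \<open>b\<close> and \<open>c\<close> both vanish, no change of \<open>x\<close> and
  \<open>y\<close> alone can produce \<open>c = 1\<close>. The linear change therefore also moves
  \<theta> by a linear function of \<open>x\<close> and \<open>y\<close>, which adds multiples of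
  \<open>a\<close> to \<open>b\<close> and \<open>c\<close>; these never vanish together with
  \<open>a\<close>, and constant multiples can be chosen for all \<theta> at once. The function
  \<open>a\<close> must survive every step, since it determines the model: diffeomorphisms fixing
  the circle preserve it, and the later divisions are by functions equal to 1 there. The sign of
  \<alpha> \<and> d\<alpha> must survive too: rescaling multiplies it by a square and pullback by a
  determinant, so orientation-preserving steps keep \<partial>P/\<partial>x negative and lead both
  forms to the same model, not to its mirror image. On the universal cover the angle is a real
  coordinate and no charts are needed. The price is a non-compact axis, so uniform bounds have to
  come from periodicity.\<close>

lemma Ck_on_subset: "Ck_on k T f \<Longrightarrow> S \<subseteq> T \<Longrightarrow> Ck_on k S f"
  by (induction k arbitrary: f) (auto intro: continuous_on_subset)

text \<open>A derivative at a point sees a whole neighbourhood, so agreement on \<open>S\<close>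
  passes to all iterated derivatives only because \<open>S\<close> is open.\<close>

lemma Ck_on_cong_imp:
  assumes "open S" "\<And>x. x \<in> S \<Longrightarrow> f x = g x" "Ck_on k S f"
  shows "Ck_on k S g"
  using assms(2,3)
proof (induction k arbitrary: f g)
  case 0
  then show ?case using continuous_on_cong[of S S f g] by simp
next
  case (Suc k)
  have d: "(g has_derivative frechet_derivative f (at x)) (at x)" if "x \<in> S" for x
  proof (rule has_derivative_transform_within_open[OF _ assms(1) that Suc.prems(1)])
    show "(f has_derivative frechet_derivative f (at x)) (at x)"
      using Suc.prems(2) that by (simp add: frechet_derivative_works[symmetric])
  qed
  have e: "frechet_derivative g (at x) = frechet_derivative f (at x)" if "x \<in> S" for x
    using frechet_derivative_at[OF d[OF that]] by simp
  have "Ck_on k S (\<lambda>x. frechet_derivative g (at x) v)" for v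
  proof (rule Suc.IH)
    show "Ck_on k S (\<lambda>x. frechet_derivative f (at x) v)" using Suc.prems(2) by simp
    show "frechet_derivative f (at x) v = frechet_derivative g (at x) v" if "x \<in> S" for x
      using e[OF that] by simp
  qed
  moreover have "g differentiable (at x)" if "x \<in> S" for x
    using d[OF that] by (auto simp: differentiable_def)
  ultimately show ?case by simp
qed

text \<open>Admits any explicit formula for the derivative in place of
  \<open>frechet_derivative\<close>; each closure property then reduces to its differentiation rule
  and an induction on the order.\<close>

lemma Ck_on_SucI:
  assumes "open S" "\<And>x. x \<in> S \<Longrightarrow> (f has_derivative F x) (at x)" "\<And>v. Ck_on k S (\<lambda>x. F x v)"
  shows "Ck_on (Suc k) S f"
proof -
  have e: "frechet_derivative f (at x) = F x" if "x \<in> S" for x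
    using frechet_derivative_at[OF assms(2)[OF that]] by simp
  have "Ck_on k S (\<lambda>x. frechet_derivative f (at x) v)" for v
    by (rule Ck_on_cong_imp[OF assms(1) _ assms(3)[of v]]) (simp add: e)
  then show ?thesis using assms(2) by (auto simp: differentiable_def)
qed

lemma Ck_on_Suc_imp: "Ck_on (Suc k) S f \<Longrightarrow> Ck_on k S f"
proof (induction k arbitrary: f)
  case 0
  then show ?case by (auto intro!: differentiable_imp_continuous_on differentiable_at_imp_differentiable_on)
next
  case (Suc k)
  have "Ck_on k S (\<lambda>x. frechet_derivative f (at x) v)" for v
    by (rule Suc.IH) (use Suc.prems in simp)
  with Suc.prems show ?case by simp
qed

lemma Ck_on_SucD: "Ck_on (Suc k) S f \<Longrightarrow> Ck_on k S (\<lambda>x. frechet_derivative f (at x) v)"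
  by simp

lemma Ck_on_Suc_has_derivative:
  "Ck_on (Suc k) S f \<Longrightarrow> x \<in> S \<Longrightarrow> (f has_derivative frechet_derivative f (at x)) (at x)"
  by (simp add: frechet_derivative_works[symmetric])

lemma Ck_on_imp_continuous_on: "Ck_on k S f \<Longrightarrow> continuous_on S f"
  by (induction k) (auto dest: Ck_on_Suc_imp simp del: Ck_on.simps(2))

section \<open>Closure properties of the classes \<open>C^k\<close>\<close>

named_theorems Ck_intros

lemma Ck_on_const [Ck_intros]: "Ck_on k S (\<lambda>x. c)"
proof (induction k arbitrary: c)
  case (Suc k)
  then show ?case by simp
qed simp

lemma Ck_on_bounded_linear:
  assumes "bounded_linear f" shows "Ck_on k S f"
proof (cases k)
  case 0
  then show ?thesis using assms by (simp add: linear_continuous_on)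
next
  case (Suc j)
  have "frechet_derivative f (at x) = f" for x
    using frechet_derivative_at[OF bounded_linear_imp_has_derivative[OF assms]] by simp
  then show ?thesis using Suc assms Ck_on_const
    by (auto simp: bounded_linear_imp_differentiable)
qed

lemma Ck_on_ident [Ck_intros]: "Ck_on k S (\<lambda>x. x)"
  using Ck_on_bounded_linear[OF bounded_linear_ident] .

lemma Ck_on_linear_compose:
  assumes "bounded_linear L" "open S" "Ck_on k S f"
  shows "Ck_on k S (\<lambda>x. L (f x))"
  using assms(3)
proof (induction k arbitrary: f)
  case 0
  then show ?case using bounded_linear.continuous_on[OF assms(1)] by auto
next
  case (Suc k)
  show ?case
  proof (rule Ck_on_SucI[OF assms(2)])
    show "((\<lambda>x. L (f x)) has_derivative (\<lambda>v. L (frechet_derivative f (at x) v))) (at x)" if "x \<in> S" for x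
      by (rule bounded_linear.has_derivative[OF assms(1) Ck_on_Suc_has_derivative[OF Suc.prems that]])
    show "Ck_on k S (\<lambda>x. L (frechet_derivative f (at x) v))" for v
      using Suc by simp
  qed
qed

lemmas Ck_on_fst [Ck_intros] = Ck_on_linear_compose[OF bounded_linear_fst]
  and Ck_on_snd [Ck_intros] = Ck_on_linear_compose[OF bounded_linear_snd]
  and Ck_on_minus [Ck_intros] = Ck_on_linear_compose[OF bounded_linear_minus[OF bounded_linear_ident]]

lemma Ck_on_add [Ck_intros]:
  assumes "open S" "Ck_on k S f" "Ck_on k S g"
  shows "Ck_on k S (\<lambda>x. f x + g x)"
  using assms(2,3)
proof (induction k arbitrary: f g)
  case 0
  then show ?case by (auto intro: continuous_on_add)
next
  case (Suc k)
  show ?case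
  proof (rule Ck_on_SucI[OF assms(1)])
    show "((\<lambda>x. f x + g x) has_derivative
        (\<lambda>v. frechet_derivative f (at x) v + frechet_derivative g (at x) v)) (at x)" if "x \<in> S" for x
      by (intro has_derivative_add Ck_on_Suc_has_derivative[OF Suc.prems(1) that]
          Ck_on_Suc_has_derivative[OF Suc.prems(2) that])
    show "Ck_on k S (\<lambda>x. frechet_derivative f (at x) v + frechet_derivative g (at x) v)" for v
      using Suc by simp
  qed
qed

lemma Ck_on_diff [Ck_intros]:
  assumes "open S" "Ck_on k S f" "Ck_on k S g"
  shows "Ck_on k S (\<lambda>x. f x - g x)"
  using Ck_on_add[OF assms(1,2) Ck_on_minus[OF assms(1,3)]] by simp

lemma Ck_on_sum [Ck_intros]:
  assumes "open S" "\<And>i. i \<in> I \<Longrightarrow> Ck_on k S (f i)"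
  shows "Ck_on k S (\<lambda>x. \<Sum>i\<in>I. f i x)"
  using assms(2) by (induction I rule: infinite_finite_induct) (auto intro: Ck_intros assms(1))

lemma Ck_on_bounded_bilinear:
  assumes B: "bounded_bilinear B" and "open S" "Ck_on k S f" "Ck_on k S g"
  shows "Ck_on k S (\<lambda>x. B (f x) (g x))"
  using assms(3,4)
proof (induction k arbitrary: f g)
  case 0
  then show ?case by (auto intro: bounded_bilinear.continuous_on[OF B])
next
  case (Suc k)
  show ?case
  proof (rule Ck_on_SucI[OF assms(2)])
    show "((\<lambda>x. B (f x) (g x)) has_derivative
        (\<lambda>v. B (f x) (frechet_derivative g (at x) v) + B (frechet_derivative f (at x) v) (g x))) (at x)"
      if "x \<in> S" for x
      by (intro bounded_bilinear.FDERIV[OF B] Ck_on_Suc_has_derivative[OF Suc.prems(1) that]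
          Ck_on_Suc_has_derivative[OF Suc.prems(2) that])
    show "Ck_on k S (\<lambda>x. B (f x) (frechet_derivative g (at x) v) + B (frechet_derivative f (at x) v) (g x))" for v
      by (intro Ck_on_add[OF assms(2)] Suc.IH Ck_on_Suc_imp[OF Suc.prems(1)] Ck_on_Suc_imp[OF Suc.prems(2)]
          Ck_on_SucD Suc.prems)
  qed
qed

lemmas Ck_on_scaleR [Ck_intros] = Ck_on_bounded_bilinear[OF bounded_bilinear_scaleR]
  and Ck_on_mult [Ck_intros] = Ck_on_bounded_bilinear[OF bounded_bilinear_mult]
  and Ck_on_inner [Ck_intros] = Ck_on_bounded_bilinear[OF bounded_bilinear_inner]

lemma Ck_on_Pair [Ck_intros]:
  assumes "open S" "Ck_on k S f" "Ck_on k S g"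
  shows "Ck_on k S (\<lambda>x. (f x, g x))"
proof -
  have 1: "bounded_linear (\<lambda>x. (x, 0))" "bounded_linear (\<lambda>x. (0, x))"
    by (auto intro!: bounded_linear_Pair bounded_linear_ident bounded_linear_zero)
  have "Ck_on k S (\<lambda>x. (f x, 0) + (0, g x))"
    using Ck_on_linear_compose[OF 1(1) assms(1,2)] Ck_on_linear_compose[OF 1(2) assms(1,3)]
    by (rule Ck_on_add[OF assms(1)])
  then show ?thesis by simp
qed

lemma linear_eq_sum_Basis:
  fixes L :: "'a::euclidean_space \<Rightarrow> 'b::real_vector"
  assumes "linear L" shows "L v = (\<Sum>i\<in>Basis. (v \<bullet> i) *\<^sub>R L i)"
proof -
  have "L v = L (\<Sum>i\<in>Basis. (v \<bullet> i) *\<^sub>R i)" by (simp add: euclidean_representation)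
  also have "\<dots> = (\<Sum>i\<in>Basis. (v \<bullet> i) *\<^sub>R L i)"
    by (simp add: linear_sum[OF assms] linear_scale[OF assms])
  finally show ?thesis .
qed

text \<open>The direction in which the chain rule differentiates \<open>f\<close> varies with the
  point, while the classes speak of fixed directions. Expanding it in a basis leaves products of
  coordinates with derivatives of \<open>f\<close> in fixed directions, and to these the induction
  hypothesis applies.\<close>

lemma Ck_on_compose:
  fixes g :: "'a::real_normed_vector \<Rightarrow> 'b::euclidean_space" and f :: "'b \<Rightarrow> 'c::real_normed_vector"
  assumes "Ck_on k T f" "open S" "Ck_on k S g" "\<And>x. x \<in> S \<Longrightarrow> g x \<in> T"
  shows "Ck_on k S (\<lambda>x. f (g x))"
  using assms(1,3)
proof (induction k arbitrary: f)
  case 0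
  then show ?case using assms(4) by (auto intro: continuous_on_compose2)
next
  case (Suc k)
  let ?f' = "\<lambda>x. frechet_derivative f (at x)" and ?g' = "\<lambda>x. frechet_derivative g (at x)"
  show ?case
  proof (rule Ck_on_SucI[OF assms(2)])
    fix x assume x: "x \<in> S"
    have f: "(f has_derivative ?f' (g x)) (at (g x))"
      by (rule Ck_on_Suc_has_derivative[OF Suc.prems(1) assms(4)[OF x]])
    have "((\<lambda>x. f (g x)) has_derivative (\<lambda>v. ?f' (g x) (?g' x v))) (at x)"
      by (rule has_derivative_compose[OF Ck_on_Suc_has_derivative[OF Suc.prems(2) x] f])
    then show "((\<lambda>x. f (g x)) has_derivative (\<lambda>v. \<Sum>i\<in>Basis. (?g' x v \<bullet> i) *\<^sub>R ?f' (g x) i)) (at x)"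
      by (rule has_derivative_eq_rhs) (rule ext, rule linear_eq_sum_Basis[OF has_derivative_linear[OF f]])
  next
    fix v
    show "Ck_on k S (\<lambda>x. \<Sum>i\<in>Basis. (?g' x v \<bullet> i) *\<^sub>R ?f' (g x) i)"
    proof (intro Ck_on_sum Ck_on_scaleR Ck_on_inner Ck_on_const assms(2))
      fix i
      show "Ck_on k S (\<lambda>x. ?g' x v)" using Suc.prems by simp
      show "Ck_on k S (\<lambda>x. ?f' (g x) i)"
        by (rule Suc.IH[of "\<lambda>x. ?f' x i"]) (use Ck_on_SucD[OF Suc.prems(1)] Ck_on_Suc_imp[OF Suc.prems(2)] in auto)
    qed
  qed
qed

text \<open>The derivative is a product in which the function itself reappears, so the induction
  hypothesis of the previous order closes the step; \<open>inverse\<close> and \<open>cis\<close>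
  behave alike.\<close>

lemma Ck_on_exp [Ck_intros]:
  fixes f :: "'a::real_normed_vector \<Rightarrow> real"
  assumes "open S" "Ck_on k S f"
  shows "Ck_on k S (\<lambda>x. exp (f x))"
  using assms(2)
proof (induction k)
  case 0
  then show ?case by (auto intro: continuous_on_exp)
next
  case (Suc k)
  show ?case
  proof (rule Ck_on_SucI[OF assms(1)])
    show "((\<lambda>x. exp (f x)) has_derivative (\<lambda>v. frechet_derivative f (at x) v * exp (f x))) (at x)"
      if "x \<in> S" for x
      using has_derivative_exp[OF Ck_on_Suc_has_derivative[OF Suc.prems that]] by simp
    show "Ck_on k S (\<lambda>x. frechet_derivative f (at x) v * exp (f x))" for v
      by (intro Ck_on_mult Ck_on_SucD Suc assms(1) Ck_on_Suc_imp[OF Suc.prems])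
  qed
qed

lemma Ck_on_inverse [Ck_intros]:
  fixes f :: "'a::real_normed_vector \<Rightarrow> real"
  assumes "open S" "Ck_on k S f" "\<And>x. x \<in> S \<Longrightarrow> f x \<noteq> 0"
  shows "Ck_on k S (\<lambda>x. inverse (f x))"
  using assms(2)
proof (induction k)
  case 0
  then show ?case using assms(3) by (auto intro: continuous_on_inverse)
next
  case (Suc k)
  show ?case
  proof (rule Ck_on_SucI[OF assms(1)])
    show "((\<lambda>x. inverse (f x)) has_derivative
        (\<lambda>v. - (inverse (f x) * frechet_derivative f (at x) v * inverse (f x)))) (at x)"
      if "x \<in> S" for x
      using Deriv.has_derivative_inverse[OF assms(3)[OF that] Ck_on_Suc_has_derivative[OF Suc.prems that]] by simp
    show "Ck_on k S (\<lambda>x. - (inverse (f x) * frechet_derivative f (at x) v * inverse (f x)))" for v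
      by (intro Ck_on_minus Ck_on_mult Ck_on_SucD Suc assms(1) Ck_on_Suc_imp[OF Suc.prems])
  qed
qed

lemma Ck_on_divide [Ck_intros]:
  fixes f g :: "'a::real_normed_vector \<Rightarrow> real"
  assumes "open S" "Ck_on k S f" "Ck_on k S g" "\<And>x. x \<in> S \<Longrightarrow> g x \<noteq> 0"
  shows "Ck_on k S (\<lambda>x. f x / g x)"
  using Ck_on_mult[OF assms(1,2) Ck_on_inverse[OF assms(1,3,4)]] by (simp add: divide_inverse)

lemma Ck_on_cis [Ck_intros]:
  fixes f :: "'a::real_normed_vector \<Rightarrow> real"
  assumes "open S" "Ck_on k S f"
  shows "Ck_on k S (\<lambda>x. cis (f x))"
  using assms(2)
proof (induction k)
  case 0
  then show ?case by (auto intro!: continuous_intros)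
next
  case (Suc k)
  show ?case
  proof (rule Ck_on_SucI[OF assms(1)])
    show "((\<lambda>x. cis (f x)) has_derivative
        (\<lambda>v. frechet_derivative f (at x) v *\<^sub>R (\<i> * cis (f x)))) (at x)"
      if "x \<in> S" for x
      by (rule has_derivative_cis[OF Ck_on_Suc_has_derivative[OF Suc.prems that]])
    show "Ck_on k S (\<lambda>x. frechet_derivative f (at x) v *\<^sub>R (\<i> * cis (f x)))" for v
      by (intro Ck_on_scaleR Ck_on_mult Ck_on_const Ck_on_SucD Suc assms(1) Ck_on_Suc_imp[OF Suc.prems])
  qed
qed

section \<open>Smooth maps and smoothness of inverses\<close>

lemma smooth_on_subset: "smooth_on T f \<Longrightarrow> S \<subseteq> T \<Longrightarrow> smooth_on S f"
  unfolding smooth_on_def by (blast intro: Ck_on_subset)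

lemma smooth_on_Ck: "smooth_on S f \<Longrightarrow> Ck_on k S f"
  by (simp add: smooth_on_def)

lemma smooth_on_cong_imp:
  "open S \<Longrightarrow> (\<And>x. x \<in> S \<Longrightarrow> f x = g x) \<Longrightarrow> smooth_on S f \<Longrightarrow> smooth_on S g"
  unfolding smooth_on_def by (blast intro: Ck_on_cong_imp)

lemma smooth_on_has_derivative:
  "smooth_on S f \<Longrightarrow> x \<in> S \<Longrightarrow> (f has_derivative frechet_derivative f (at x)) (at x)"
  using Ck_on_Suc_has_derivative smooth_on_def by blast

lemma smooth_on_frechet_derivative: "smooth_on S f \<Longrightarrow> smooth_on S (\<lambda>x. frechet_derivative f (at x) v)"
  unfolding smooth_on_def
proof
  fix k assume "\<forall>k. Ck_on k S f"
  then have "Ck_on (Suc k) S f" by blast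
  then show "Ck_on k S (\<lambda>x. frechet_derivative f (at x) v)" by simp
qed

lemma smooth_on_imp_continuous_on: "smooth_on S f \<Longrightarrow> continuous_on S f"
  using Ck_on_imp_continuous_on smooth_on_def by blast

lemma smooth_on_compose:
  fixes g :: "'a::real_normed_vector \<Rightarrow> 'b::euclidean_space"
  assumes "smooth_on T f" "open S" "smooth_on S g" "\<And>x. x \<in> S \<Longrightarrow> g x \<in> T"
  shows "smooth_on S (\<lambda>x. f (g x))"
  using assms Ck_on_compose unfolding smooth_on_def by blast

text \<open>Since \<open>DH(y) = J (H y)\<close>, each order of smoothness of \<open>H\<close> gives the next one.\<close>

lemma smooth_on_inverse_map:
  fixes G H :: "'a::euclidean_space \<Rightarrow> 'a"
  assumes "open S" "open T" "smooth_on S G"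
    and GH: "\<And>x. x \<in> S \<Longrightarrow> G x \<in> T \<and> H (G x) = x" "\<And>y. y \<in> T \<Longrightarrow> H y \<in> S \<and> G (H y) = y"
    and J: "\<And>x v. x \<in> S \<Longrightarrow> frechet_derivative G (at x) (J x v) = v" "\<And>v. smooth_on S (\<lambda>x. J x v)"
  shows "smooth_on T H"
proof -
  have d: "(H has_derivative J (H y)) (at y)" if "y \<in> T" for y
  \<comment> \<open>Nothing is assumed about the regularity of \<open>H\<close>: its
    differentiability follows from that of \<open>G\<close> and a right inverse of the
    derivative.\<close>
  proof (rule has_derivative_inverse_strong_x[where f=G and S=S])
    show "(G has_derivative frechet_derivative G (at (H y))) (at (H y))"
      using assms(3) smooth_on_has_derivative GH(2)[OF that] by blast
    show "frechet_derivative G (at (H y)) \<circ> J (H y) = id"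
      using J(1) GH(2)[OF that] by (auto simp: fun_eq_iff)
  qed (use assms that GH in \<open>auto intro: smooth_on_imp_continuous_on\<close>)
  have "Ck_on k T H" for k
  proof (induction k)
    case 0
    show ?case using d by (auto intro!: has_derivative_continuous_on intro: has_derivative_at_withinI)
  next
    case (Suc k)
    show ?case
    proof (rule Ck_on_SucI[OF assms(2) d])
      show "Ck_on k T (\<lambda>y. J (H y) v)" for v
        by (rule Ck_on_compose[where f="\<lambda>x. J x v", OF smooth_on_Ck[OF J(2)] assms(2) Suc]) (use GH(2) in auto)
    qed
  qed
  then show ?thesis by (simp add: smooth_on_def)
qed

section \<open>Integrals with parameters and symmetry of second derivatives\<close>

lemma has_derivative_integral01:
  fixes g :: "'a::euclidean_space \<times> real \<Rightarrow> real"
  assumes O: "open Z" and W: "open W" "W \<times> {0..1} \<subseteq> Z" and g: "Ck_on (Suc 0) Z g" and q: "q \<in> W"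
  shows "((\<lambda>q. integral {0..1} (\<lambda>s. g (q, s))) has_derivative
      (\<lambda>v. integral {0..1} (\<lambda>s. frechet_derivative g (at (q, s)) (v, 0)))) (at q)"
proof -
  obtain e where e: "e > 0" "ball q e \<subseteq> W" using W(1) q openE by blast
  let ?g' = "\<lambda>q s v. frechet_derivative g (at (q, s)) (v, 0)"
  have dg: "(g has_derivative frechet_derivative g (at p)) (at p)" if "p \<in> Z" for p
    using Ck_on_Suc_has_derivative[OF g that] .
  have d: "((\<lambda>x. g (x, t)) has_derivative ?g' x t) (at x)" if "x \<in> W" "t \<in> {0..1}" for x t
  proof -
    have "(g has_derivative frechet_derivative g (at (x, t))) (at (x, t))"
      using dg that W by blast
    moreover have "((\<lambda>x. (x, t)) has_derivative (\<lambda>v. (v, 0))) (at x)"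
      by (auto intro!: derivative_eq_intros)
    ultimately show ?thesis
      using has_derivative_compose[where f="\<lambda>x. (x, t)"] by blast
  qed
  \<comment> \<open>Leibniz's rule needs the derivative to depend continuously on the point as a
    bounded linear map. The class \<open>C^1\<close> gives continuity direction by direction, which
    is enough in finite dimension.\<close>
  define F where "F = (\<lambda>x t. Blinfun (?g' x t))"
  have F: "blinfun_apply (F x t) = ?g' x t" if "x \<in> W" "t \<in> {0..1}" for x t
    unfolding F_def using d[OF that] by (simp add: bounded_linear_Blinfun_apply has_derivative_bounded_linear)
  have cF: "continuous_on (ball q e \<times> cbox 0 1) (\<lambda>(x, t). F x t)"
  proof (rule continuous_on_blinfun_componentwise)
    fix i :: 'a
    have "continuous_on Z (\<lambda>p. frechet_derivative g (at p) (i, 0))" using g by simp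
    then have "continuous_on (ball q e \<times> cbox 0 1) (\<lambda>p. frechet_derivative g (at p) (i, 0))"
      by (rule continuous_on_subset) (use W e in auto)
    then show "continuous_on (ball q e \<times> cbox 0 1) (\<lambda>p. blinfun_apply (case p of (x, t) \<Rightarrow> F x t) i)"
      by (rule continuous_on_eq) (use F e in auto)
  qed
  have "((\<lambda>q. integral (cbox 0 1) (\<lambda>s. g (q, s))) has_derivative integral (cbox 0 1) (F q)) (at q within ball q e)"
  proof (rule leibniz_rule[OF _ _ cF])
    show "((\<lambda>x. g (x, t)) has_derivative blinfun_apply (F x t)) (at x within ball q e)"
      if "x \<in> ball q e" "t \<in> cbox 0 1" for x t
    proof -
      have "x \<in> W" "t \<in> {0..1}" using that e by (auto simp: cbox_interval)
      with d[OF this] F[OF this] show ?thesis by (simp add: has_derivative_at_withinI)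
    qed
    show "(\<lambda>s. g (x, s)) integrable_on cbox 0 1" if "x \<in> ball q e" for x
    proof (rule integrable_continuous)
      have "continuous_on Z g" using Ck_on_imp_continuous_on[OF g] .
      then show "continuous_on (cbox 0 1) (\<lambda>s. g (x, s))"
        by (rule continuous_on_compose2) (use that e W in \<open>auto intro!: continuous_intros\<close>)
    qed
  qed (use e in auto)
  then have "((\<lambda>q. integral {0..1} (\<lambda>s. g (q, s))) has_derivative integral (cbox 0 1) (F q)) (at q)"
    using e at_within_open[of q "ball q e"] by (simp add: cbox_interval)
  moreover have "blinfun_apply (integral (cbox 0 1) (F q)) = (\<lambda>v. integral {0..1} (\<lambda>s. ?g' q s v))"
  proof
    fix v
    have "continuous_on (cbox 0 1) (\<lambda>t. F q t)"
    proof -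
      have "continuous_on (cbox 0 1) (\<lambda>t. case (q, t) of (x, t) \<Rightarrow> F x t)"
        by (rule continuous_on_compose2[OF cF])
          (use e in \<open>auto intro!: continuous_intros simp: cbox_interval\<close>)
      then show ?thesis by simp
    qed
    then have "F q integrable_on cbox 0 1" by (rule integrable_continuous)
    then have "integral (cbox 0 1) (F q) v = integral (cbox 0 1) (\<lambda>s. F q s v)"
      by (rule blinfun_apply_integral)
    also have "\<dots> = integral {0..1} (\<lambda>s. ?g' q s v)"
      unfolding cbox_interval using F[OF q] by (intro integral_cong) auto
    finally show "integral (cbox 0 1) (F q) v = integral {0..1} (\<lambda>s. ?g' q s v)" .
  qed
  ultimately show ?thesis by simp
qed

lemma continuous_on_integral01:
  fixes g :: "'a::topological_space \<times> real \<Rightarrow> real"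
  assumes "continuous_on (W \<times> {0..1}) g"
  shows "continuous_on W (\<lambda>q. integral {0..1} (\<lambda>s. g (q, s)))"
  using integral_continuous_on_param[of W 0 1 "\<lambda>q s. g (q, s)"] assms by (simp add: cbox_interval)

text \<open>Differentiating under the integral gives an integral of the same kind, so induction
  applies. The integrand lives on an open \<open>Z\<close> because two-sided derivatives are taken
  also at the endpoints of the interval.\<close>

lemma Ck_on_integral01:
  fixes g :: "'a::euclidean_space \<times> real \<Rightarrow> real"
  assumes O: "open Z" and W: "open W" "W \<times> {0..1} \<subseteq> Z" and "Ck_on k Z g"
  shows "Ck_on k W (\<lambda>q. integral {0..1} (\<lambda>s. g (q, s)))"
  using assms(4)
proof (induction k arbitrary: g)
  case 0
  then show ?case using W(2)
    by (auto intro!: continuous_on_integral01 intro: continuous_on_subset)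
next
  case (Suc k)
  show ?case
  proof (rule Ck_on_SucI[OF W(1)])
    have "Ck_on (Suc 0) Z g" using Suc.prems by (auto dest: Ck_on_imp_continuous_on)
    then show "((\<lambda>q. integral {0..1} (\<lambda>s. g (q, s))) has_derivative
      (\<lambda>v. integral {0..1} (\<lambda>s. frechet_derivative g (at (q, s)) (v, 0)))) (at q)" if "q \<in> W" for q
      using has_derivative_integral01[OF O W _ that] by blast
    show "Ck_on k W (\<lambda>q. integral {0..1} (\<lambda>s. frechet_derivative g (at (q, s)) (v, 0)))" for v
      by (rule Suc.IH[OF Ck_on_SucD[OF Suc.prems]])
  qed
qed

text \<open>The fundamental theorem of calculus along the segment from \<open>y\<close> to
  \<open>y + w\<close>; for the gauge integral, differentiability without continuity of the
  derivative is enough.\<close>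

lemma hadamard:
  fixes f :: "'a::euclidean_space \<Rightarrow> real"
  assumes "\<And>s. s \<in> {0..1} \<Longrightarrow> (f has_derivative f' (y + s *\<^sub>R w)) (at (y + s *\<^sub>R w))"
  shows "((\<lambda>s. f' (y + s *\<^sub>R w) w) has_integral f (y + w) - f y) {0..1}"
proof -
  have "((\<lambda>s. f' (y + s *\<^sub>R w) w) has_integral f (y + 1 *\<^sub>R w) - f (y + 0 *\<^sub>R w)) {0..1}"
  proof (rule fundamental_theorem_of_calculus)
    fix s :: real assume s: "s \<in> {0..1}"
    interpret linear "f' (y + s *\<^sub>R w)" using assms[OF s] by (rule has_derivative_linear)
    have "((\<lambda>s. y + s *\<^sub>R w) has_derivative (\<lambda>t. t *\<^sub>R w)) (at s within {0..1})"
      by (auto intro!: derivative_eq_intros)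
    from has_derivative_compose[OF this assms[OF s]]
    show "((\<lambda>s. f (y + s *\<^sub>R w)) has_vector_derivative f' (y + s *\<^sub>R w) w) (at s within {0..1})"
      by (simp add: has_vector_derivative_def scale)
  qed auto
  then show ?thesis by simp
qed

lemma has_real_derivative_mult_left_at_0:
  fixes K :: "real \<Rightarrow> real"
  assumes "isCont K 0" shows "((\<lambda>h. h * K h) has_real_derivative K 0) (at 0)"
  using assms by (auto simp: CARAT_DERIV intro!: exI[of _ K])

text \<open>Write \<open>f (y + h u) - f y\<close> as \<open>h\<close> times the mean of the
  \<open>u\<close>-derivative over the segment, and differentiate in direction \<open>v\<close>
  under the integral. The \<open>v\<close>-derivative of \<open>f\<close> thus grows along
  \<open>u\<close> by \<open>h * K h\<close>, where \<open>K\<close> is a continuous mean of the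
  mixed derivative taken in the other order; comparing derivatives at \<open>h = 0\<close> gives the
  symmetry.\<close>

lemma frechet_derivative_commute:
  fixes f :: "'a::euclidean_space \<Rightarrow> real"
  assumes S: "open S" "x \<in> S" and f: "Ck_on (Suc (Suc 0)) S f"
  shows "frechet_derivative (\<lambda>y. frechet_derivative f (at y) v) (at x) u =
    frechet_derivative (\<lambda>y. frechet_derivative f (at y) u) (at x) v"
proof -
  define D where "D = (\<lambda>v y. frechet_derivative f (at y) v)"
  define DD where "DD = (\<lambda>u v y. frechet_derivative (D v) (at y) u)"
  have fD: "(f has_derivative (\<lambda>v. D v y)) (at y)" if "y \<in> S" for y
    using Ck_on_Suc_has_derivative[OF f that] by (simp add: D_def)
  have D1: "Ck_on (Suc 0) S (D v)" for v
    unfolding D_def by (rule Ck_on_SucD[OF f])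
  have DDd: "(D v has_derivative (\<lambda>u. DD u v y)) (at y)" if "y \<in> S" for y v
    unfolding DD_def by (rule Ck_on_Suc_has_derivative[OF D1 that])
  have DDc: "continuous_on S (DD u v)" for u v
    using Ck_on_SucD[OF D1[of v], of u] by (simp add: DD_def)
  obtain e where e: "e > 0" "ball x e \<subseteq> S" using S openE by blast
  \<comment> \<open>Translating by \<open>h u\<close> with \<open>\<bar>h\<bar> < r\<close> moves a
    point by less than \<open>e / 2\<close>; the summand 1 covers \<open>u = 0\<close>.\<close>
  define r where "r = e / (2 * (norm u + 1))"
  have r0: "r > 0" using e by (simp add: r_def add_nonneg_pos)
  have ru: "r * norm u < e / 2"
  proof -
    have "norm u < norm u + 1" by simp
    then have "e * norm u < e * (norm u + 1)" using e by (intro mult_strict_left_mono)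
    moreover have "norm u + 1 > 0" by (simp add: add_nonneg_pos)
    ultimately show ?thesis by (simp add: r_def field_simps)
  qed
  have inS: "y + (s * h) *\<^sub>R u \<in> S" if "dist x y < e / 2" "s \<in> {0..1}" "\<bar>h\<bar> < r" for y s h
  proof -
    have "norm ((s * h) *\<^sub>R u) \<le> \<bar>h\<bar> * norm u"
      using that(2) by (simp add: abs_mult mult_right_mono mult_le_cancel_right2)
    also have "\<dots> \<le> r * norm u" using that(3) by (intro mult_right_mono) auto
    finally have "norm ((s * h) *\<^sub>R u) < e / 2" using ru by simp
    then have "dist x (y + (s * h) *\<^sub>R u) < e"
      using that(1) dist_triangle_half_r[of y x e "y + (s * h) *\<^sub>R u"]
      by (simp add: dist_norm norm_minus_commute)
    then show ?thesis using e by auto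
  qed
  define K where "K = (\<lambda>h. integral {0..1} (\<lambda>s. DD v u (x + (s * h) *\<^sub>R u)))"
  have main: "D v (x + h *\<^sub>R u) - D v x = h * K h" if h: "\<bar>h\<bar> < r" for h
  proof -
    define Z where "Z = (\<lambda>p::'a \<times> real. fst p + (snd p * h) *\<^sub>R u) -` S"
    have Z: "open Z" unfolding Z_def by (rule open_vimage[OF S(1)]) (auto intro!: continuous_intros)
    have W: "ball x (e / 2) \<times> {0..1} \<subseteq> Z"
      using inS h by (auto simp: Z_def)
    let ?g = "\<lambda>p::'a \<times> real. D u (fst p + (snd p * h) *\<^sub>R u)"
    have g: "Ck_on (Suc 0) Z ?g"
    proof (rule Ck_on_compose[OF D1 Z])
      show "Ck_on (Suc 0) Z (\<lambda>p. fst p + (snd p * h) *\<^sub>R u)" by (intro Ck_intros Z)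
    qed (simp add: Z_def)
    have dg: "frechet_derivative ?g (at (y, s)) (v, 0) = DD v u (y + (s * h) *\<^sub>R u)"
      if "(y, s) \<in> Z" for y s
    proof -
      have "((\<lambda>p::'a \<times> real. fst p + (snd p * h) *\<^sub>R u) has_derivative (\<lambda>p. fst p + (snd p * h) *\<^sub>R u)) (at (y, s))"
        by (auto intro!: derivative_eq_intros)
      from has_derivative_compose[OF this DDd] that
      have "(?g has_derivative (\<lambda>p. DD (fst p + (snd p * h) *\<^sub>R u) u (y + (s * h) *\<^sub>R u))) (at (y, s))"
        by (simp add: Z_def)
      from frechet_derivative_at[OF this, symmetric] show ?thesis by simp
    qed
    have "((\<lambda>q. integral {0..1} (\<lambda>s. ?g (q, s))) has_derivative
        (\<lambda>v. integral {0..1} (\<lambda>s. frechet_derivative ?g (at (x, s)) (v, 0)))) (at x)"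
      by (rule has_derivative_integral01[OF Z _ W g]) (use e in auto)
    from has_derivative_mult_right[OF this, of h]
    have 1: "((\<lambda>q. h * integral {0..1} (\<lambda>s. ?g (q, s))) has_derivative
        (\<lambda>v. h * integral {0..1} (\<lambda>s. frechet_derivative ?g (at (x, s)) (v, 0)))) (at x)" .
    have eq: "h * integral {0..1} (\<lambda>s. ?g (y, s)) = f (y + h *\<^sub>R u) - f y" if y: "y \<in> ball x (e / 2)" for y
    proof -
      have I: "((\<lambda>s. D (h *\<^sub>R u) (y + s *\<^sub>R (h *\<^sub>R u))) has_integral f (y + h *\<^sub>R u) - f y) {0..1}"
        by (rule hadamard[where f'="\<lambda>y v. D v y"], rule fD) (use inS[of y _ h] y h in auto)
      have "D (h *\<^sub>R u) (y + s *\<^sub>R (h *\<^sub>R u)) = h * ?g (y, s)" if "s \<in> {0..1}" for s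
      proof -
        have "y + (s * h) *\<^sub>R u \<in> S" using inS[of y s h] y h that by auto
        from linear_scale[OF has_derivative_linear[OF fD[OF this]], of h u]
        show ?thesis by simp
      qed
      from this I have "((\<lambda>s. h * ?g (y, s)) has_integral f (y + h *\<^sub>R u) - f y) {0..1}"
        by (rule has_integral_eq)
      from integral_unique[OF this] show ?thesis by (simp only: integral_mult_right)
    qed
    have d1: "((\<lambda>y. f (y + h *\<^sub>R u) - f y) has_derivative
        (\<lambda>v. h * integral {0..1} (\<lambda>s. frechet_derivative ?g (at (x, s)) (v, 0)))) (at x)"
      by (rule has_derivative_transform_within_open[OF 1, of "ball x (e / 2)"]) (use e eq in auto)
    have d2: "((\<lambda>y. f (y + h *\<^sub>R u) - f y) has_derivative (\<lambda>v. D v (x + h *\<^sub>R u) - D v x)) (at x)"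
    proof -
      have "((\<lambda>y. y + h *\<^sub>R u) has_derivative (\<lambda>v. v)) (at x)"
        by (auto intro!: derivative_eq_intros)
      moreover have "x + h *\<^sub>R u \<in> S" using inS[of x 1 h] e h by simp
      ultimately show ?thesis
        using has_derivative_compose[of "\<lambda>y. y + h *\<^sub>R u", OF _ fD] fD[OF S(2)]
        by (intro has_derivative_diff) auto
    qed
    have "D v (x + h *\<^sub>R u) - D v x = h * integral {0..1} (\<lambda>s. frechet_derivative ?g (at (x, s)) (v, 0))"
      by (rule fun_cong[OF has_derivative_unique[OF d2 d1]])
    also have "integral {0..1} (\<lambda>s. frechet_derivative ?g (at (x, s)) (v, 0)) = K h"
      unfolding K_def
    proof (rule integral_cong)
      fix s :: real assume "s \<in> {0..1}"
      then have "(x, s) \<in> Z" using W e by auto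
      then show "frechet_derivative ?g (at (x, s)) (v, 0) = DD v u (x + (s * h) *\<^sub>R u)" by (rule dg)
    qed
    finally show ?thesis .
  qed
  have "continuous_on (ball 0 r) K"
    unfolding K_def
  proof (rule continuous_on_integral01[where g="\<lambda>(h, s). DD v u (x + (s * h) *\<^sub>R u)", simplified])
    show "continuous_on (ball 0 r \<times> {0..1}) (\<lambda>(h, s). DD v u (x + (s * h) *\<^sub>R u))"
      unfolding split_beta
      by (rule continuous_on_compose2[OF DDc])
        (use inS[of x] e in \<open>auto intro!: continuous_intros\<close>)
  qed
  then have "isCont K 0" using r0 by (simp add: continuous_on_eq_continuous_at)
  then have "((\<lambda>h. h * K h) has_real_derivative K 0) (at 0)"
    by (rule has_real_derivative_mult_left_at_0)
  moreover have "((\<lambda>h. h * K h) has_real_derivative DD u v x) (at 0)"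
  proof -
    have "((\<lambda>h. x + h *\<^sub>R u) has_derivative (\<lambda>h. h *\<^sub>R u)) (at 0)"
      by (auto intro!: derivative_eq_intros)
    moreover have "(D v has_derivative (\<lambda>u. DD u v x)) (at (x + 0 *\<^sub>R u))"
      using DDd[OF S(2)] by simp
    ultimately have "((\<lambda>h. D v (x + h *\<^sub>R u)) has_derivative (\<lambda>h. DD (h *\<^sub>R u) v x)) (at 0)"
      by (rule has_derivative_compose)
    then have "((\<lambda>h. D v (x + h *\<^sub>R u) - D v x) has_derivative (\<lambda>h. DD (h *\<^sub>R u) v x - 0)) (at 0)"
      by (intro has_derivative_diff) auto
    moreover have "DD (h *\<^sub>R u) v x = h * DD u v x" for h
      using linear_scale[OF has_derivative_linear[OF DDd[OF S(2)]], of h u] by simp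
    ultimately have "((\<lambda>h. D v (x + h *\<^sub>R u) - D v x) has_derivative (\<lambda>h. DD u v x * h)) (at 0)"
      by (simp add: mult.commute)
    then have "((\<lambda>h. h * K h) has_derivative (\<lambda>h. DD u v x * h)) (at 0)"
      by (rule has_derivative_transform_within_open[of _ _ _ _ "ball 0 r"]) (use main r0 in auto)
    then show ?thesis by (simp add: has_field_derivative_def)
  qed
  ultimately have "K 0 = DD u v x" by (rule DERIV_unique)
  then show ?thesis by (simp add: K_def DD_def D_def)
qed

text \<open>Caratheodory's criterion: it avoids a joint estimate of the remainder in several variables.\<close>

lemma has_derivative_slopeI:
  fixes f :: "'a::real_inner \<Rightarrow> real"
  assumes T: "open T" "x \<in> T" and f: "\<And>y. y \<in> T \<Longrightarrow> f y - f x = s y \<bullet> (y - x)" and s: "isCont s x"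
  shows "(f has_derivative (\<lambda>v. s x \<bullet> v)) (at x)"
proof -
  obtain e where e: "e > 0" "ball x e \<subseteq> T" using T openE by blast
  show ?thesis
  proof (rule has_derivativeI_sandwich[OF e(1)])
    show "bounded_linear (\<lambda>v. s x \<bullet> v)" by (rule bounded_linear_inner_right)
    show "norm (f y - f x - s x \<bullet> (y - x)) / norm (y - x) \<le> norm (s y - s x)"
      if "y \<noteq> x" "dist y x < e" for y
    proof -
      have "f y - f x - s x \<bullet> (y - x) = (s y - s x) \<bullet> (y - x)"
        using f[of y] that e by (auto simp: inner_diff_left dist_commute)
      then have "norm (f y - f x - s x \<bullet> (y - x)) \<le> norm (s y - s x) * norm (y - x)"
        using Cauchy_Schwarz_ineq2 by simp
      then show ?thesis using that by (simp add: divide_le_eq)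
    qed
    show "((\<lambda>y. norm (s y - s x)) \<longlongrightarrow> 0) (at x)"
      using s by (auto simp: isCont_def LIM_zero tendsto_norm_zero_iff)
  qed
qed

section \<open>Tubes around the axis and primitives in \<open>x\<close>\<close>

text \<open>Two radii, because the ODE limits the range of \<open>x\<close> and that of the initial
  value by different constants.\<close>

definition tube :: "real \<Rightarrow> real \<Rightarrow> coords set" where
  "tube d r = {(\<theta>, x, u). \<bar>x\<bar> < d \<and> \<bar>u\<bar> < r}"

lemma mem_tube [simp]: "(\<theta>, x, u) \<in> tube d r \<longleftrightarrow> \<bar>x\<bar> < d \<and> \<bar>u\<bar> < r"
  by (simp add: tube_def)

lemma tube_eq: "tube d r = UNIV \<times> {-d<..<d} \<times> {-r<..<r}"
  by (auto simp: tube_def)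

lemma open_tube: "open (tube d r)"
  unfolding tube_eq by (intro open_Times open_UNIV open_greaterThanLessThan)

lemma convex_tube: "convex (tube d r)"
  unfolding tube_eq by (intro convex_Times convex_UNIV convex_real_interval)

lemma abs_mult_unit_less:
  fixes x s :: real assumes "\<bar>x\<bar> < d" "0 \<le> s" "s \<le> 1" shows "\<bar>x * s\<bar> < d"
proof -
  have "\<bar>x * s\<bar> \<le> \<bar>x\<bar> * 1" unfolding abs_mult using assms by (intro mult_left_mono) auto
  then show ?thesis using assms by simp
qed

text \<open>The primitive of \<open>h\<close> in the second variable vanishing at \<open>x = 0\<close>, rescaled to the fixed interval $[0, 1]$ so that
  smoothness in \<open>x\<close> is covered by differentiation under the integral sign.\<close>

definition x_primitive :: "(coords \<Rightarrow> real) \<Rightarrow> coords \<Rightarrow> real" where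
  "x_primitive h = (\<lambda>(\<theta>, x, u). x * integral {0..1} (\<lambda>s. h (\<theta>, x * s, u)))"

lemma x_primitive_0 [simp]: "x_primitive h (\<theta>, 0, u) = 0"
  by (simp add: x_primitive_def)

text \<open>The value depends only on the segment from \<open>(\<theta>, 0, u)\<close> to
  \<open>(\<theta>, x, u)\<close>, so functions may be compared along a single curve.\<close>

lemma x_primitive_cong:
  assumes "\<And>s. 0 \<le> s \<Longrightarrow> s \<le> 1 \<Longrightarrow> h (\<theta>, x * s, u) = h' (\<theta>, x * s, u)"
  shows "x_primitive h (\<theta>, x, u) = x_primitive h' (\<theta>, x, u)"
  unfolding x_primitive_def prod.case by (intro arg_cong2[where f="(*)"] integral_cong refl assms) auto

lemma Ck_on_x_primitive [Ck_intros]: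
  assumes "Ck_on k (tube d r) h"
  shows "Ck_on k (tube d r) (x_primitive h)"
proof -
  let ?m = "\<lambda>p::coords \<times> real. (fst (fst p), fst (snd (fst p)) * snd p, snd (snd (fst p)))"
  define Z where "Z = ?m -` tube d r"
  have Z: "open Z" unfolding Z_def by (rule open_vimage[OF open_tube]) (auto intro!: continuous_intros)
  have "Ck_on k Z (\<lambda>p. h (?m p))"
  proof (rule Ck_on_compose[OF assms Z])
    show "Ck_on k Z ?m" by (intro Ck_intros Z)
  qed (simp add: Z_def)
  moreover have "tube d r \<times> {0..1} \<subseteq> Z"
    using abs_mult_unit_less by (auto simp: Z_def)
  ultimately have "Ck_on k (tube d r) (\<lambda>q. integral {0..1} (\<lambda>s. h (?m (q, s))))"
    by (intro Ck_on_integral01[OF Z open_tube])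
  then have "Ck_on k (tube d r) (\<lambda>q. fst (snd q) * integral {0..1} (\<lambda>s. h (?m (q, s))))"
    by (intro Ck_intros open_tube)
  moreover have "x_primitive h = (\<lambda>q. fst (snd q) * integral {0..1} (\<lambda>s. h (?m (q, s))))"
    by (auto simp: x_primitive_def)
  ultimately show ?thesis by simp
qed

lemma continuous_on_x_primitive:
  "continuous_on (tube d r) h \<Longrightarrow> continuous_on (tube d r) (x_primitive h)"
  using Ck_on_x_primitive[of 0] by simp

lemma x_primitive_has_derivative:
  assumes h: "continuous_on (tube d r) h" and x: "\<bar>x\<bar> < d" and u: "\<bar>u\<bar> < r"
  shows "((\<lambda>x. x_primitive h (\<theta>, x, u)) has_real_derivative h (\<theta>, x, u)) (at x)"
proof -
  obtain c where c: "\<bar>x\<bar> < c" "c < d" using dense x by blast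
  let ?g = "\<lambda>x. h (\<theta>, x, u)"
  have g: "continuous_on {-c..c} ?g"
    by (rule continuous_on_compose2[OF h]) (use c u in \<open>auto intro!: continuous_intros\<close>)
  define G where "G = (\<lambda>t. integral {-c..t} ?g)"
  have G: "(G has_real_derivative ?g t) (at t within {-c..c})" if "t \<in> {-c..c}" for t
    unfolding G_def by (rule integral_has_real_derivative[OF g that])
  have eq: "G t - G 0 = x_primitive h (\<theta>, t, u)" if t: "\<bar>t\<bar> < c" for t
  proof -
    have ts: "t * s \<in> {-c..c}" if "s \<in> {0..1}" for s
      using abs_mult_unit_less[OF t, of s] that by auto
    have I: "((\<lambda>s. ?g (t * s) * t) has_integral G (t * 1) - G (t * 0)) {0..1}"
    proof (rule fundamental_theorem_of_calculus)
      fix s :: real assume s: "s \<in> {0..1}"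
      have "((\<lambda>s. t * s) has_real_derivative t) (at s within {0..1})"
        by (auto intro!: derivative_eq_intros)
      moreover have "(G has_real_derivative ?g (t * s)) (at (t * s) within (\<lambda>s. t * s) ` {0..1})"
        by (rule DERIV_subset[OF G[OF ts[OF s]]]) (use ts in auto)
      ultimately have "((\<lambda>s. G (t * s)) has_real_derivative ?g (t * s) * t) (at s within {0..1})"
        by (rule DERIV_image_chain[unfolded o_def, rotated])
      then show "((\<lambda>s. G (t * s)) has_vector_derivative ?g (t * s) * t) (at s within {0..1})"
        by (simp add: has_real_derivative_iff_has_vector_derivative)
    qed auto
    show ?thesis
    proof -
      have "G t - G 0 = integral {0..1} (\<lambda>s. ?g (t * s) * t)"
        using integral_unique[OF I] by simp
      also have "\<dots> = integral {0..1} (\<lambda>s. ?g (t * s)) * t"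
        by (rule integral_mult_left)
      finally show ?thesis by (simp add: x_primitive_def)
    qed
  qed
  have "(G has_real_derivative ?g x) (at x)"
  proof -
    have "x \<in> interior {-c..c}" using c by auto
    then have "at x within {-c..c} = at x" by (rule at_within_interior)
    moreover have "x \<in> {-c..c}" using c by auto
    ultimately show ?thesis using G[of x] by simp
  qed
  then have "((\<lambda>t. G t - G 0) has_real_derivative ?g x) (at x)"
    by (auto intro!: derivative_eq_intros)
  then show ?thesis
    by (rule DERIV_cong_ev[THEN iffD1, rotated -1])
      (use c eq in \<open>auto intro!: eventually_nhds_in_open[of "{-c<..<c}", THEN eventually_mono]\<close>)
qed


section \<open>A scalar ODE depending on a parameter\<close>

text \<open>When \<open>Y\<close> solves the ODE with initial value \<open>u\<close>, this is the
  change of coordinates from \<open>(\<theta>, x, u)\<close> to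
  \<open>(\<theta>, x, y)\<close>.\<close>

definition slice_graph :: "(coords \<Rightarrow> real) \<Rightarrow> coords \<Rightarrow> coords" where
  "slice_graph Y = (\<lambda>(\<theta>, x, u). (\<theta>, x, Y (\<theta>, x, u)))"

lemma slice_graph_simp [simp]: "slice_graph Y (\<theta>, x, u) = (\<theta>, x, Y (\<theta>, x, u))"
  by (simp add: slice_graph_def)

lemma slice_graph_alt: "slice_graph Y = (\<lambda>q. (fst q, fst (snd q), Y q))"
  by (auto simp: slice_graph_def)

lemma Ck_on_slice_graph: "open S \<Longrightarrow> Ck_on k S Y \<Longrightarrow> Ck_on k S (slice_graph Y)"
  unfolding slice_graph_alt by (intro Ck_intros)

lemma linear_coords:
  fixes L :: "coords \<Rightarrow> real"
  assumes "linear L" shows "L (a, b, c) = a * L (1, 0, 0) + b * L (0, 1, 0) + c * L (0, 0, 1)"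
proof -
  have "(a, b, c) = a *\<^sub>R (1, 0, 0) + b *\<^sub>R (0, 1, 0) + c *\<^sub>R (0, 0, 1)" by simp
  then have "L (a, b, c) = L (a *\<^sub>R (1, 0, 0) + b *\<^sub>R (0, 1, 0) + c *\<^sub>R (0, 0, 1))" by (rule arg_cong)
  also have "\<dots> = a * L (1, 0, 0) + b * L (0, 1, 0) + c * L (0, 0, 1)"
    by (simp only: linear_add[OF assms] linear_scale[OF assms] real_scaleR_def)
  finally show ?thesis .
qed

text \<open>The initial value problem \<open>\<partial>Y/\<partial>x = - b (\<theta>, x, Y)\<close>, \<open>Y (\<theta>, 0, u) = u\<close>. The difference of two solutions obeys a
  linear scalar equation, which is solved by an integrating factor; the resulting formulas express \<open>DY\<close> by integrals
  of functions of \<open>Y\<close>, so that smoothness follows by bootstrapping from continuity.\<close>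

context
  fixes b Y :: "coords \<Rightarrow> real" and T :: "coords set" and d r :: real
  assumes T: "open T" "convex T" and b: "smooth_on T b"
    and d: "0 < d" and contY: "continuous_on (tube d r) Y"
    and YT: "\<And>q. q \<in> tube d r \<Longrightarrow> slice_graph Y q \<in> T"
    and eq: "\<And>\<theta> x u. (\<theta>, x, u) \<in> tube d r \<Longrightarrow>
      Y (\<theta>, x, u) = u - x_primitive (\<lambda>q. b (slice_graph Y q)) (\<theta>, x, u)"
begin

definition "slope v q = frechet_derivative b (at (slice_graph Y q)) v"
text \<open>Linearising the equation in \<open>u\<close> gives
  \<open>Z' = - slope (0, 0, 1) * Z\<close> with \<open>Z = 1\<close> at \<open>x = 0\<close>; hence
  the reciprocal of this function is the derivative of \<open>Y\<close> in \<open>u\<close>.\<close>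

definition "integrating_factor q = exp (x_primitive (slope (0, 0, 1)) q)"
text \<open>Variation of constants: negated and divided by \<open>integrating_factor\<close>, this
  is the derivative of \<open>Y\<close> in \<theta>.\<close>

definition "theta_variation q = x_primitive (\<lambda>q. slope (1, 0, 0) q * integrating_factor q) q"

lemma cont_graph: "continuous_on (tube d r) (slice_graph Y)"
  unfolding slice_graph_alt by (intro continuous_intros contY)

lemma solution_initial: "\<bar>u\<bar> < r \<Longrightarrow> Y (\<theta>, 0, u) = u"
  using eq[of \<theta> 0 u] d by simp

lemma solution_x_derivative:
  assumes "\<bar>x\<bar> < d" "\<bar>u\<bar> < r"
  shows "((\<lambda>x. Y (\<theta>, x, u)) has_real_derivative - b (\<theta>, x, Y (\<theta>, x, u))) (at x)"
proof -
  have "continuous_on (tube d r) (\<lambda>q. b (slice_graph Y q))"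
    by (rule continuous_on_compose2[OF smooth_on_imp_continuous_on[OF b] cont_graph]) (use YT in auto)
  from x_primitive_has_derivative[OF this assms, of \<theta>]
  have "((\<lambda>x. u - x_primitive (\<lambda>q. b (slice_graph Y q)) (\<theta>, x, u)) has_real_derivative
      0 - b (slice_graph Y (\<theta>, x, u))) (at x)"
    by (intro DERIV_diff DERIV_const)
  then show ?thesis
    by (rule has_field_derivative_transform_within_open[of _ _ _ "{-d<..<d}", THEN DERIV_cong])
      (use assms in \<open>auto simp: eq[symmetric]\<close>)
qed

text \<open>\<open>Y\<close> is only known to be continuous, so nothing can be linearised yet.
  Instead, mean slopes of \<open>b\<close> between two solutions make their difference satisfy a
  linear equation exactly, without remainder. Solving it exhibits slopes of \<open>Y\<close> that
  are continuous at \<open>q0\<close>, as Caratheodory's criterion requires.\<close>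

lemma solution_has_derivative:
  assumes q0: "q0 \<in> tube d r"
  shows "(Y has_derivative (\<lambda>v. (- theta_variation q0 / integrating_factor q0, - b (slice_graph Y q0),
    1 / integrating_factor q0) \<bullet> v)) (at q0)"
proof -
  obtain \<theta>0 x0 u0 where q0_eq: "q0 = (\<theta>0, x0, u0)" by (cases q0)
  have x0: "\<bar>x0\<bar> < d" and u0: "\<bar>u0\<bar> < r" using q0 by (auto simp: q0_eq)
  \<comment> \<open>The reference solution: the curve through the point \<open>q0\<close>,
    parametrised by \<open>x\<close>.\<close>
  define p0 where "p0 = (\<lambda>x. (\<theta>0, x, Y (\<theta>0, x, u0)))"
  have p0T: "p0 x \<in> T" if "\<bar>x\<bar> < d" for x
    using YT[of "(\<theta>0, x, u0)"] that u0 by (simp add: p0_def)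
  \<comment> \<open>Mean of the derivative of \<open>b\<close> over the segment joining the points
    of the two solutions at equal \<open>x\<close>. Convexity of \<open>T\<close> keeps this segment
    in the domain.\<close>
  define A where "A = (\<lambda>v q. integral {0..1} (\<lambda>s. frechet_derivative b
      (at (p0 (fst (snd q)) + s *\<^sub>R (slice_graph Y q - p0 (fst (snd q))))) v))"
  have segT: "p0 (fst (snd q)) + s *\<^sub>R (slice_graph Y q - p0 (fst (snd q))) \<in> T"
    if "q \<in> tube d r" "s \<in> {0..1}" for q s
  proof -
    have "(1 - s) *\<^sub>R p0 (fst (snd q)) + s *\<^sub>R slice_graph Y q \<in> T"
      using that YT p0T by (intro convexD_alt[OF T(2)]) (auto simp: tube_def)
    then show ?thesis by (simp add: algebra_simps)
  qed
  have cont_p0: "continuous_on (tube d r) (\<lambda>q. p0 (fst (snd q)))"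
  proof -
    have "continuous_on (tube d r) (\<lambda>q. Y (\<theta>0, fst (snd q), u0))"
      by (rule continuous_on_compose2[OF contY]) (use u0 in \<open>auto intro!: continuous_intros\<close>)
    then show ?thesis unfolding p0_def by (intro continuous_intros)
  qed
  have contA: "continuous_on (tube d r) (A v)" for v
  proof -
    let ?m = "\<lambda>p. p0 (fst (snd (fst p))) + snd p *\<^sub>R (slice_graph Y (fst p) - p0 (fst (snd (fst p))))"
    have 1: "continuous_on (tube d r \<times> {0..1::real}) (\<lambda>p. p0 (fst (snd (fst p))))"
      by (rule continuous_on_compose2[OF cont_p0 continuous_on_fst[OF continuous_on_id]]) auto
    have 2: "continuous_on (tube d r \<times> {0..1::real}) (\<lambda>p. slice_graph Y (fst p))"
      by (rule continuous_on_compose2[OF cont_graph continuous_on_fst[OF continuous_on_id]]) auto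
    have "continuous_on (tube d r \<times> {0..1}) ?m"
      by (intro continuous_intros 1 2)
    then have "continuous_on (tube d r \<times> {0..1}) (\<lambda>p. frechet_derivative b (at (?m p)) v)"
      by (rule continuous_on_compose2[OF smooth_on_imp_continuous_on[OF smooth_on_frechet_derivative[OF b, of v]]])
        (use segT in auto)
    from continuous_on_integral01[OF this] show ?thesis by (simp add: A_def)
  qed
  have A_diag: "A v (\<theta>0, x, u0) = slope v (\<theta>0, x, u0)" for v x
    by (simp add: A_def p0_def slope_def)
  have diff: "b (\<theta>, x, Y (\<theta>, x, u)) - b (p0 x) = (\<theta> - \<theta>0) * A (1, 0, 0) (\<theta>, x, u) +
      (Y (\<theta>, x, u) - Y (\<theta>0, x, u0)) * A (0, 0, 1) (\<theta>, x, u)"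
    if "(\<theta>, x, u) \<in> tube d r" for \<theta> x u
  proof -
    define w where "w = slice_graph Y (\<theta>, x, u) - p0 x"
    have w: "w = (\<theta> - \<theta>0, 0, Y (\<theta>, x, u) - Y (\<theta>0, x, u0))" by (simp add: w_def p0_def)
    let ?D = "\<lambda>v s. frechet_derivative b (at (p0 x + s *\<^sub>R w)) v"
    have seg: "p0 x + s *\<^sub>R w \<in> T" if "s \<in> {0..1}" for s
      using segT[OF \<open>(\<theta>, x, u) \<in> tube d r\<close> that] by (simp add: w_def)
    have bd: "(b has_derivative frechet_derivative b (at y)) (at y)" if "y \<in> T" for y
      using smooth_on_has_derivative[OF b that] .
    have int: "(?D v has_integral A v (\<theta>, x, u)) {0..1}" for v
    proof -
      have "continuous_on {0..1} (?D v)"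
        by (rule continuous_on_compose2[OF smooth_on_imp_continuous_on[OF smooth_on_frechet_derivative[OF b, of v]]])
          (use seg in \<open>auto intro!: continuous_intros\<close>)
      then have "(?D v has_integral integral {0..1} (?D v)) {0..1}"
        by (intro integrable_integral integrable_continuous_interval)
      then show ?thesis by (simp add: A_def w_def)
    qed
    have "((\<lambda>s. ?D w s) has_integral b (p0 x + w) - b (p0 x)) {0..1}"
      by (rule hadamard) (use bd seg in auto)
    moreover have "((\<lambda>s. ?D w s) has_integral (\<theta> - \<theta>0) * A (1, 0, 0) (\<theta>, x, u) +
      (Y (\<theta>, x, u) - Y (\<theta>0, x, u0)) * A (0, 0, 1) (\<theta>, x, u)) {0..1}"
    proof (rule has_integral_eq)
      show "((\<lambda>s. (\<theta> - \<theta>0) * ?D (1, 0, 0) s + (Y (\<theta>, x, u) - Y (\<theta>0, x, u0)) * ?D (0, 0, 1) s) has_integral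
        (\<theta> - \<theta>0) * A (1, 0, 0) (\<theta>, x, u) + (Y (\<theta>, x, u) - Y (\<theta>0, x, u0)) * A (0, 0, 1) (\<theta>, x, u)) {0..1}"
        by (intro has_integral_add has_integral_mult_right int)
      fix s :: real assume "s \<in> {0..1}"
      from linear_coords[OF has_derivative_linear[OF bd[OF seg[OF this]]], of "\<theta> - \<theta>0" 0 "Y (\<theta>, x, u) - Y (\<theta>0, x, u0)"]
      show "(\<theta> - \<theta>0) * ?D (1, 0, 0) s + (Y (\<theta>, x, u) - Y (\<theta>0, x, u0)) * ?D (0, 0, 1) s = ?D w s"
        by (simp add: w)
    qed
    ultimately have "b (p0 x + w) - b (p0 x) = (\<theta> - \<theta>0) * A (1, 0, 0) (\<theta>, x, u) +
      (Y (\<theta>, x, u) - Y (\<theta>0, x, u0)) * A (0, 0, 1) (\<theta>, x, u)"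
      by (rule has_integral_unique)
    then show ?thesis by (simp add: w_def)
  qed
  \<comment> \<open>\<open>E\<close> and \<open>R\<close> are \<open>integrating_factor\<close> and
    \<open>theta_variation\<close> with the mean slopes \<open>A\<close> in place of the slopes of
    \<open>b\<close>; they coincide with them along the reference curve, where the segments
    degenerate to points.\<close>
  define E where "E = (\<lambda>q. exp (x_primitive (A (0, 0, 1)) q))"
  define R where "R = x_primitive (\<lambda>q. A (1, 0, 0) q * E q)"
  have contE: "continuous_on (tube d r) E"
    unfolding E_def by (intro continuous_intros continuous_on_x_primitive contA)
  have contAE: "continuous_on (tube d r) (\<lambda>q. A (1, 0, 0) q * E q)"
    by (intro continuous_intros contE contA)
  have contR: "continuous_on (tube d r) R"
    unfolding R_def by (rule continuous_on_x_primitive[OF contAE])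
  have variation: "(Y (\<theta>, x, u) - Y (\<theta>0, x, u0)) * E (\<theta>, x, u) = (u - u0) - (\<theta> - \<theta>0) * R (\<theta>, x, u)"
    if x: "\<bar>x\<bar> < d" and u: "\<bar>u\<bar> < r" for \<theta> x u
  proof -
    \<comment> \<open>A first integral: the difference equation cancels its derivative in
      \<open>x\<close>, so it keeps its value at \<open>x = 0\<close>, where the initial values are
      known.\<close>
    let ?\<Phi> = "\<lambda>x. (Y (\<theta>, x, u) - Y (\<theta>0, x, u0)) * E (\<theta>, x, u) + (\<theta> - \<theta>0) * R (\<theta>, x, u)"
    have "?\<Phi> x = ?\<Phi> 0"
    proof (rule DERIV_isconst3[where a="-d" and b=d and f="?\<Phi>"])
      fix t assume "t \<in> {-d<..<d}"
      then have t: "\<bar>t\<bar> < d" by auto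
      have dE: "((\<lambda>x. E (\<theta>, x, u)) has_real_derivative E (\<theta>, t, u) * A (0, 0, 1) (\<theta>, t, u)) (at t)"
        unfolding E_def by (rule DERIV_fun_exp[OF x_primitive_has_derivative[OF contA t u]])
      have dR: "((\<lambda>x. R (\<theta>, x, u)) has_real_derivative A (1, 0, 0) (\<theta>, t, u) * E (\<theta>, t, u)) (at t)"
        unfolding R_def by (rule x_primitive_has_derivative[OF contAE t u])
      show "(?\<Phi> has_real_derivative 0) (at t)"
      proof (rule DERIV_cong)
        show "(?\<Phi> has_real_derivative
          (- b (\<theta>, t, Y (\<theta>, t, u)) - - b (\<theta>0, t, Y (\<theta>0, t, u0))) * E (\<theta>, t, u) +
          E (\<theta>, t, u) * A (0, 0, 1) (\<theta>, t, u) * (Y (\<theta>, t, u) - Y (\<theta>0, t, u0)) +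
          (\<theta> - \<theta>0) * (A (1, 0, 0) (\<theta>, t, u) * E (\<theta>, t, u))) (at t)"
          by (intro DERIV_add DERIV_mult' DERIV_mult DERIV_diff DERIV_cmult dE dR solution_x_derivative t u u0)
        have "b (\<theta>, t, Y (\<theta>, t, u)) = b (\<theta>0, t, Y (\<theta>0, t, u0)) + ((\<theta> - \<theta>0) * A (1, 0, 0) (\<theta>, t, u) +
          (Y (\<theta>, t, u) - Y (\<theta>0, t, u0)) * A (0, 0, 1) (\<theta>, t, u))"
          using diff[of \<theta> t u] t u by (simp add: p0_def)
        then show "(- b (\<theta>, t, Y (\<theta>, t, u)) - - b (\<theta>0, t, Y (\<theta>0, t, u0))) * E (\<theta>, t, u) +
          E (\<theta>, t, u) * A (0, 0, 1) (\<theta>, t, u) * (Y (\<theta>, t, u) - Y (\<theta>0, t, u0)) +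
          (\<theta> - \<theta>0) * (A (1, 0, 0) (\<theta>, t, u) * E (\<theta>, t, u)) = 0"
          by (simp only:) (simp add: algebra_simps)
      qed
    qed (use x d in auto)
    also have "?\<Phi> 0 = u - u0"
      using solution_initial u u0 by (simp add: E_def R_def)
    finally show ?thesis by simp
  qed
  \<comment> \<open>The passage from \<open>q0\<close> to \<open>q\<close> is split in two: first
    along the reference curve, where the ODE supplies the slope \<open>m\<close>, and then at fixed
    \<open>x\<close> to the other solution, where \<open>variation\<close> does.\<close>
  obtain m where m: "\<And>x. Y (\<theta>0, x, u0) - Y (\<theta>0, x0, u0) = m x * (x - x0)" "isCont m x0"
      "m x0 = - b (\<theta>0, x0, Y (\<theta>0, x0, u0))"
    using solution_x_derivative[OF x0 u0, of \<theta>0] unfolding CARAT_DERIV by blast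
  let ?s = "\<lambda>q. (- R q / E q, m (fst (snd q)), 1 / E q)"
  have "(Y has_derivative (\<lambda>v. ?s q0 \<bullet> v)) (at q0)"
  proof (rule has_derivative_slopeI[OF open_tube q0, where s="?s"])
    fix q assume q: "q \<in> tube d r"
    obtain \<theta> x u where q_eq: "q = (\<theta>, x, u)" by (cases q)
    have E0: "E q \<noteq> 0" by (simp add: E_def)
    have "(Y q - Y (\<theta>0, x, u0)) * E q = (u - u0) - (\<theta> - \<theta>0) * R q"
      using variation[of x u \<theta>] q by (simp add: q_eq)
    then have "Y q - Y (\<theta>0, x, u0) = ((u - u0) - (\<theta> - \<theta>0) * R q) / E q"
      using E0 by (metis nonzero_mult_div_cancel_right)
    then have "Y q - Y (\<theta>0, x, u0) = (u - u0) / E q - (\<theta> - \<theta>0) * R q / E q"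
      by (simp only: diff_divide_distrib)
    then have "Y q - Y q0 = ((u - u0) / E q - (\<theta> - \<theta>0) * R q / E q) + m x * (x - x0)"
      using m(1)[of x] by (simp add: q0_eq)
    also have "\<dots> = ?s q \<bullet> (q - q0)"
      by (simp add: q_eq q0_eq inner_prod_def algebra_simps)
    finally show "Y q - Y q0 = ?s q \<bullet> (q - q0)" .
  next
    have "isCont R q0" "isCont E q0"
      using contR contE q0 by (auto simp: continuous_on_eq_continuous_at open_tube)
    moreover have "isCont (\<lambda>q. m (fst (snd q))) q0"
      by (rule isCont_o2[where f="\<lambda>q. fst (snd q)"]) (use m(2) in \<open>auto simp: q0_eq intro!: continuous_intros\<close>)
    ultimately show "isCont ?s q0"
      by (intro continuous_intros) (auto simp: E_def)
  qed
  moreover have Eq: "E (\<theta>0, x, u0) = integrating_factor (\<theta>0, x, u0)" for x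
    unfolding E_def integrating_factor_def using A_diag by (simp cong: x_primitive_cong)
  moreover have "R q0 = theta_variation q0"
    unfolding R_def theta_variation_def q0_eq
    by (rule x_primitive_cong) (simp add: A_diag Eq)
  ultimately show ?thesis by (simp add: q0_eq m(3))
qed

lemma smooth_on_solution: "smooth_on (tube d r) Y"
proof -
  have "Ck_on k (tube d r) Y" for k
  proof (induction k)
    case 0
    show ?case using contY by simp
  next
    case (Suc k)
    have graph: "Ck_on k (tube d r) (slice_graph Y)"
      by (rule Ck_on_slice_graph[OF open_tube Suc])
    have slope: "Ck_on k (tube d r) (slope v)" for v
      unfolding slope_def[abs_def]
      by (rule Ck_on_compose[OF smooth_on_Ck[OF smooth_on_frechet_derivative[OF b, of v]] open_tube graph YT])
    have E: "Ck_on k (tube d r) integrating_factor"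
      unfolding integrating_factor_def[abs_def] by (intro Ck_intros open_tube slope)
    have R: "Ck_on k (tube d r) theta_variation"
      unfolding theta_variation_def[abs_def] by (intro Ck_intros open_tube slope E)
    have bY: "Ck_on k (tube d r) (\<lambda>q. b (slice_graph Y q))"
      by (rule Ck_on_compose[OF smooth_on_Ck[OF b] open_tube graph YT])
    show ?case
    proof (rule Ck_on_SucI[OF open_tube solution_has_derivative])
      show "Ck_on k (tube d r) (\<lambda>q. (- theta_variation q / integrating_factor q, - b (slice_graph Y q),
          1 / integrating_factor q) \<bullet> v)" for v
        by (intro Ck_intros open_tube E R bY) (simp_all add: integrating_factor_def)
    qed
  qed
  then show ?thesis by (simp add: smooth_on_def)
qed

lemma solution_derivatives:
  assumes "q \<in> tube d r"
  shows "frechet_derivative Y (at q) (0, 1, 0) = - b (slice_graph Y q)"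
    and "frechet_derivative Y (at q) (0, 0, 1) > 0"
  using frechet_derivative_at[OF solution_has_derivative[OF assms], symmetric]
  by (simp_all add: inner_prod_def integrating_factor_def)

end

section \<open>Existence of the solution by contraction\<close>

lemma periodic_int:
  fixes f :: "real \<Rightarrow> 'a"
  assumes "\<And>t. f (t + p) = f t"
  shows "f (t + of_int k * p) = f t"
proof (induction k rule: int_induct[where k=0])
  case (step1 i)
  have "f (t + of_int (i + 1) * p) = f (t + of_int i * p + p)" by (simp add: algebra_simps)
  then show ?case using step1 assms by simp
next
  case (step2 i)
  have "f (t + of_int (i - 1) * p + p) = f (t + of_int i * p)" by (simp add: algebra_simps)
  then show ?case using step2 assms by metis
qed simp

lemma shift_into_period:
  fixes t p :: real
  assumes "p > 0" obtains k :: int where "t + of_int k * p \<in> {0..<p}"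
proof
  have "of_int \<lfloor>t / p\<rfloor> * p \<le> t" "t < (of_int \<lfloor>t / p\<rfloor> + 1) * p"
    using assms floor_divide_lower[of p t] floor_divide_upper[of p t] by simp_all
  then show "t + of_int (- \<lfloor>t / p\<rfloor>) * p \<in> {0..<p}" by (simp add: algebra_simps)
qed

context
  fixes b :: "coords \<Rightarrow> real" and r :: real
  assumes r: "0 < r" and b: "smooth_on (tube r r) b"
    and periodic: "\<And>\<theta> x y. (\<theta>, x, y) \<in> tube r r \<Longrightarrow> b (\<theta> + 2 * pi, x, y) = b (\<theta>, x, y)"
begin

text \<open>The tube is unbounded in \<theta>, but periodicity carries every point into a compact
  box over one period, where \<open>b\<close> and its \<open>y\<close>-derivative are
  bounded.\<close>

lemma coefficient_bounds:
  fixes c :: real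
  assumes c: "0 < c" "c < r"
  obtains M L where "0 \<le> M" "0 \<le> L"
    "\<And>\<theta> x y. x \<in> {-c..c} \<Longrightarrow> y \<in> {-c..c} \<Longrightarrow> \<bar>b (\<theta>, x, y)\<bar> \<le> M"
    "\<And>\<theta> x y y'. x \<in> {-c..c} \<Longrightarrow> y \<in> {-c..c} \<Longrightarrow> y' \<in> {-c..c} \<Longrightarrow>
      \<bar>b (\<theta>, x, y) - b (\<theta>, x, y')\<bar> \<le> L * \<bar>y - y'\<bar>"
proof -
  define K where "K = {0..2 * pi} \<times> {-c..c} \<times> {-c..c}"
  have K: "compact K" unfolding K_def by (intro compact_Times compact_Icc)
  have sub: "K \<subseteq> tube r r" using c by (auto simp: K_def)
  have per: "b (\<theta> + of_int k * (2 * pi), x, y) = b (\<theta>, x, y)" if "x \<in> {-c..c}" "y \<in> {-c..c}" for \<theta> x y k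
  proof (rule periodic_int[of "\<lambda>\<theta>. b (\<theta>, x, y)"])
    have "\<bar>x\<bar> < r" "\<bar>y\<bar> < r" using that c by auto
    then show "b (t + 2 * pi, x, y) = b (t, x, y)" for t by (intro periodic) simp
  qed
  have "bounded (b ` K)" "bounded ((\<lambda>q. frechet_derivative b (at q) (0, 0, 1)) ` K)"
    by (intro compact_imp_bounded compact_continuous_image K continuous_on_subset[OF _ sub]
        smooth_on_imp_continuous_on smooth_on_frechet_derivative b)+
  then obtain M L where M: "M > 0" "\<And>q. q \<in> K \<Longrightarrow> \<bar>b q\<bar> \<le> M"
    and L: "L > 0" "\<And>q. q \<in> K \<Longrightarrow> \<bar>frechet_derivative b (at q) (0, 0, 1)\<bar> \<le> L"
    unfolding bounded_pos ball_simps real_norm_def by blast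
  show ?thesis
  proof (rule that[of M L])
    fix \<theta> x y assume xy: "x \<in> {-c..c}" "y \<in> {-c..c}"
    obtain k :: int where k: "\<theta> + of_int k * (2 * pi) \<in> {0..<2 * pi}"
      using shift_into_period[of "2 * pi" \<theta>] by auto
    then show "\<bar>b (\<theta>, x, y)\<bar> \<le> M"
      using M(2)[of "(\<theta> + of_int k * (2 * pi), x, y)"] per[OF xy, of \<theta> k] xy by (auto simp: K_def)
    fix y' assume y': "y' \<in> {-c..c}"
    define \<theta>' where "\<theta>' = \<theta> + of_int k * (2 * pi)"
    have "norm (b (\<theta>', x, y) - b (\<theta>', x, y')) \<le> L * norm (y - y')"
    proof (rule field_differentiable_bound[of "{-c..c}"])
      fix z assume z: "z \<in> {-c..c}"
      have q: "(\<theta>', x, z) \<in> K" using z xy k by (auto simp: K_def \<theta>'_def)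
      have "((\<lambda>z. (\<theta>', x, z)) has_derivative (\<lambda>v. (0, 0, v))) (at z within {-c..c})"
        by (auto intro!: derivative_eq_intros)
      moreover have bd: "(b has_derivative frechet_derivative b (at (\<theta>', x, z))) (at (\<theta>', x, z))"
        using smooth_on_has_derivative[OF b] q sub by blast
      ultimately have "((\<lambda>z. b (\<theta>', x, z)) has_derivative (\<lambda>v. frechet_derivative b (at (\<theta>', x, z)) (0, 0, v)))
          (at z within {-c..c})"
        by (rule has_derivative_compose)
      moreover have "frechet_derivative b (at (\<theta>', x, z)) (0, 0, v) = frechet_derivative b (at (\<theta>', x, z)) (0, 0, 1) * v" for v
        using linear_coords[OF has_derivative_linear[OF bd], of 0 0 v] by simp
      ultimately show "((\<lambda>z. b (\<theta>', x, z)) has_field_derivative frechet_derivative b (at (\<theta>', x, z)) (0, 0, 1))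
          (at z within {-c..c})"
        unfolding has_field_derivative_def by (rule has_derivative_eq_rhs[OF _ ext])
      show "norm (frechet_derivative b (at (\<theta>', x, z)) (0, 0, 1)) \<le> L" using L(2)[OF q] by simp
    qed (use xy y' in auto)
    then show "\<bar>b (\<theta>, x, y) - b (\<theta>, x, y')\<bar> \<le> L * \<bar>y - y'\<bar>"
      using per[of x y \<theta> k] per[of x y' \<theta> k] xy y' by (simp add: \<theta>'_def)
  qed (use M L in auto)
qed

text \<open>Picard's fixed point argument for all \<theta> and \<open>u\<close> at once. Bounded
  continuous functions of all three variables form the complete space, so joint continuity comes for
  free. Clamping \<open>x\<close> and \<open>y\<close> makes the operator defined everywhere, and
  the clamps are inactive on the final tube.\<close>

lemma solution_exists:
  obtains d \<rho> Y where "0 < d" "d < r" "0 < \<rho>" "continuous_on (tube d \<rho>) Y"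
    "\<And>q. q \<in> tube d \<rho> \<Longrightarrow> slice_graph Y q \<in> tube r r"
    "\<And>\<theta> x u. (\<theta>, x, u) \<in> tube d \<rho> \<Longrightarrow>
      Y (\<theta>, x, u) = u - x_primitive (\<lambda>q. b (slice_graph Y q)) (\<theta>, x, u)"
    "\<And>\<theta> x u. Y (\<theta> + 2 * pi, x, u) = Y (\<theta>, x, u)"
proof -
  define c where "c = r / 2"
  have c: "0 < c" "c < r" using r by (auto simp: c_def)
  obtain M L where M0: "0 \<le> M" and L0: "0 \<le> L"
    and M: "\<And>\<theta> x y. x \<in> {-c..c} \<Longrightarrow> y \<in> {-c..c} \<Longrightarrow> \<bar>b (\<theta>, x, y)\<bar> \<le> M"
    and L: "\<And>\<theta> x y y'. x \<in> {-c..c} \<Longrightarrow> y \<in> {-c..c} \<Longrightarrow> y' \<in> {-c..c} \<Longrightarrow>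
      \<bar>b (\<theta>, x, y) - b (\<theta>, x, y')\<bar> \<le> L * \<bar>y - y'\<bar>"
    by (rule coefficient_bounds[OF c]) (rule that; assumption)
  \<comment> \<open>The three bounds keep \<open>x\<close> in the range of the estimates, make
    \<open>d * M \<le> c / 2\<close>, so that solutions starting below \<open>c / 2\<close> stay
    below \<open>c\<close>, and make \<open>d * L \<le> 1 / 2\<close>, the contraction constant. The
    summands 1 exclude division by zero.\<close>
  define d where "d = min c (min (c / (2 * (M + 1))) (1 / (2 * (L + 1))))"
  have d0: "0 < d" "d \<le> c" using c M0 L0 by (auto simp: d_def)
  have "d * (M + 1) \<le> c / (2 * (M + 1)) * (M + 1)" "d * (L + 1) \<le> 1 / (2 * (L + 1)) * (L + 1)"
    using M0 L0 by (intro mult_right_mono; simp add: d_def)+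
  moreover have "a / (2 * m) * m = a / 2" if "m > 0" for a m :: real using that by simp
  then have "c / (2 * (M + 1)) * (M + 1) = c / 2" "1 / (2 * (L + 1)) * (L + 1) = 1 / 2"
    using M0 L0 by (simp_all only: add_nonneg_pos zero_less_one)
  moreover have "d * M \<le> d * (M + 1)" "d * L \<le> d * (L + 1)"
    using d0 by (simp_all add: mult_left_mono)
  ultimately have dM: "d * M \<le> c / 2" and dL: "d * L \<le> 1 / 2" by linarith+
  \<comment> \<open>Clamping is 1-Lipschitz, so the extended coefficient inherits both bounds
    \<open>M\<close> and \<open>L\<close>.\<close>
  define cl where "cl = (\<lambda>e t::real. max (-e) (min e t))"
  have cl_in: "cl e t \<in> {-e..e}" if "0 < e" for e t using that by (auto simp: cl_def)
  have cl_id: "cl e t = t" if "\<bar>t\<bar> \<le> e" for e t using that by (auto simp: cl_def)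
  have cl_lip: "\<bar>cl e t - cl e t'\<bar> \<le> \<bar>t - t'\<bar>" for e t t' by (auto simp: cl_def max_def min_def)
  have cl_cont [continuous_intros]: "continuous_on S (\<lambda>x. cl e (f x))" if "continuous_on S f" for S e and f :: "'x::topological_space \<Rightarrow> real"
    unfolding cl_def by (intro continuous_intros that)
  define bt where "bt = (\<lambda>(\<theta>, x, y). b (\<theta>, cl c x, cl c y))"
  have cl_r: "\<bar>cl c t\<bar> < r" for t using cl_in[OF c(1), of t] c by auto
  have bt_cont: "continuous_on UNIV bt"
    unfolding bt_def split_beta
    by (rule continuous_on_compose2[OF smooth_on_imp_continuous_on[OF b]])
      (auto intro!: continuous_intros simp: cl_r)
  have bt_bound: "\<bar>bt (\<theta>, x, y)\<bar> \<le> M" for \<theta> x y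
    using M cl_in[OF c(1)] by (simp add: bt_def)
  have bt_lip: "\<bar>bt (\<theta>, x, y) - bt (\<theta>, x, y')\<bar> \<le> L * \<bar>y - y'\<bar>" for \<theta> x y y'
    using order_trans[OF L[OF cl_in cl_in cl_in] mult_left_mono[OF cl_lip L0]] c by (simp add: bt_def)
  have bt_per: "bt (\<theta> + 2 * pi, x, y) = bt (\<theta>, x, y)" for \<theta> x y
    using periodic[of \<theta> "cl c x" "cl c y"] cl_r by (simp add: bt_def)
  \<comment> \<open>The unknown is \<open>Z = Y - u\<close>, since \<open>Y\<close> itself is
    unbounded in \<open>u\<close> and would not lie in the space of bounded functions.\<close>
  define I where "I = (\<lambda>(Z :: coords \<Rightarrow> real) q s. bt (fst q, cl d (fst (snd q)) * s,
      snd (snd q) + Z (fst q, cl d (fst (snd q)) * s, snd (snd q))))"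
  define F where "F = (\<lambda>(Z :: coords \<Rightarrow> real) q. - (cl d (fst (snd q)) * integral {0..1} (I Z q)))"
  have I_cont: "continuous_on (S \<times> {0..1}) (\<lambda>p. I Z (fst p) (snd p))" if "continuous_on UNIV Z" for Z S
  proof -
    have 1: "continuous_on (S \<times> {0..1})
      (\<lambda>p::coords \<times> real. Z (fst (fst p), cl d (fst (snd (fst p))) * snd p, snd (snd (fst p))))"
      by (rule continuous_on_compose2[OF that]) (auto intro!: continuous_intros)
    show ?thesis unfolding I_def
      by (rule continuous_on_compose2[OF bt_cont]) (auto intro!: continuous_intros 1)
  qed
  have I_int: "I Z q integrable_on {0..1}" if "continuous_on UNIV Z" for Z q
    by (rule integrable_continuous_interval, rule continuous_on_compose2[OF I_cont[OF that, of UNIV], of _ "\<lambda>s. (q, s)", simplified])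
      (auto intro!: continuous_intros)
  have F_cont: "continuous_on UNIV (F Z)" if "continuous_on UNIV Z" for Z
  proof -
    have "continuous_on UNIV (\<lambda>q. integral {0..1} (\<lambda>s. I Z q s))"
      using continuous_on_integral01[OF I_cont[OF that, of UNIV]] by simp
    then show ?thesis unfolding F_def by (intro continuous_intros) auto
  qed
  have int_le: "\<bar>integral {0..1} f\<bar> \<le> B" if "\<And>s. s \<in> {0..1} \<Longrightarrow> \<bar>f s\<bar> \<le> B" "f integrable_on {0..1}"
    for f :: "real \<Rightarrow> real" and B
  proof -
    have "B \<ge> 0" using that(1)[of 0] by simp
    then show ?thesis
      using has_integral_bound_real[of B "{}" f _ 0 1] that by (fastforce simp: has_integral_integral)
  qed
  have cl_d: "\<bar>cl d t\<bar> \<le> d" for t using cl_in[OF d0(1), of t] by (simp add: abs_le_iff)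
  have F_bound: "norm (F Z q) \<le> d * M" if "continuous_on UNIV Z" for Z q
  proof -
    have "\<bar>integral {0..1} (I Z q)\<bar> \<le> M"
      by (rule int_le[OF _ I_int[OF that]]) (simp add: I_def bt_bound)
    then show ?thesis using cl_d d0 by (simp add: F_def abs_mult mult_mono)
  qed
  define F' where "F' = (\<lambda>Z :: coords \<Rightarrow>\<^sub>C real. Bcontfun (F (apply_bcontfun Z)))"
  have contZ: "continuous_on UNIV (apply_bcontfun Z)" for Z :: "coords \<Rightarrow>\<^sub>C real"
    by (rule continuous_on_apply_bcontfun)
  have F': "apply_bcontfun (F' Z) = F (apply_bcontfun Z)" for Z
    unfolding F'_def by (rule Bcontfun_inverse, rule bcontfun_normI[OF F_cont[OF contZ] F_bound[OF contZ]])
  have "\<exists>!Z. F' Z = Z"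
  proof (rule banach_fix_type[of "1 / 2"]; (intro allI)?)
    fix Z Z' :: "coords \<Rightarrow>\<^sub>C real"
    show "dist (F' Z) (F' Z') \<le> 1 / 2 * dist Z Z'"
    proof (rule dist_bound)
      fix q
      have "\<bar>I Z q s - I Z' q s\<bar> \<le> L * dist Z Z'" for s
      proof -
        let ?p = "(fst q, cl d (fst (snd q)) * s, snd (snd q))"
        have "\<bar>I Z q s - I Z' q s\<bar> \<le> L * \<bar>Z ?p - Z' ?p\<bar>"
          unfolding I_def by (rule order_trans[OF bt_lip]) simp
        also have "\<dots> \<le> L * dist Z Z'"
          using dist_bounded[of Z ?p Z'] L0 by (intro mult_left_mono) (auto simp: dist_real_def)
        finally show ?thesis .
      qed
      then have "\<bar>integral {0..1} (\<lambda>s. I Z q s - I Z' q s)\<bar> \<le> L * dist Z Z'"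
        by (intro int_le integrable_diff I_int contZ)
      moreover have "F Z q - F Z' q = - (cl d (fst (snd q)) * integral {0..1} (\<lambda>s. I Z q s - I Z' q s))"
        by (simp add: F_def integral_diff I_int contZ algebra_simps)
      ultimately have "\<bar>F Z q - F Z' q\<bar> \<le> d * (L * dist Z Z')"
        using cl_d d0 by (auto simp: abs_mult intro!: mult_mono)
      also have "\<dots> \<le> 1 / 2 * dist Z Z'"
        using dL mult_right_mono[OF dL, of "dist Z Z'"] by simp
      finally show "dist (F' Z q) (F' Z' q) \<le> 1 / 2 * dist Z Z'"
        by (simp add: F' dist_real_def)
    qed
  qed auto
  then obtain Z where Z: "F' Z = Z" and Z_unique: "\<And>Z'. F' Z' = Z' \<Longrightarrow> Z' = Z" by blast
  have FZ: "F Z = apply_bcontfun Z" using F'[of Z] Z by simp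
  have Z_per: "Z (\<theta> + 2 * pi, x, u) = Z (\<theta>, x, u)" for \<theta> x u
  proof -
    \<comment> \<open>The translate of the fixed point by one period is again a fixed point, hence
      equal to it by uniqueness.\<close>
    define S where "S = (\<lambda>q. Z (fst q + 2 * pi, snd q))"
    have S_cont: "continuous_on UNIV S"
      unfolding S_def by (rule continuous_on_compose2[OF contZ]) (auto intro!: continuous_intros)
    have FS: "F S = S"
    proof
      fix q :: coords
      have "I S q = I Z (fst q + 2 * pi, snd q)"
        by (auto simp: I_def S_def bt_per)
      then have "F S q = F Z (fst q + 2 * pi, snd q)" by (simp add: F_def)
      then show "F S q = S q" by (simp add: FZ S_def)
    qed
    have S: "apply_bcontfun (Bcontfun S) = S"
      by (rule Bcontfun_inverse, rule bcontfun_normI[OF S_cont]) (use F_bound[OF S_cont] FS in auto)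
    have "F' (Bcontfun S) = Bcontfun S"
      unfolding F'_def S FS ..
    from Z_unique[OF this] S have "S = apply_bcontfun Z" by simp
    from fun_cong[OF this, of "(\<theta>, x, u)"] show ?thesis by (simp add: S_def)
  qed
  define Y where "Y = (\<lambda>q. snd (snd q) + Z q)"
  have Yc: "\<bar>Y (\<theta>, x, u)\<bar> < c" if "\<bar>u\<bar> < c / 2" for \<theta> x u
  proof -
    have "\<bar>Z (\<theta>, x, u)\<bar> \<le> d * M" using F_bound[OF contZ, of Z "(\<theta>, x, u)"] by (simp add: FZ)
    then show ?thesis using that dM by (simp add: Y_def)
  qed
  show ?thesis
  proof (rule that[of d "c / 2" Y])
    show "continuous_on (tube d (c / 2)) Y"
      unfolding Y_def by (intro continuous_intros continuous_on_subset[OF contZ]) auto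
    show "slice_graph Y q \<in> tube r r" if "q \<in> tube d (c / 2)" for q
    proof (cases q)
      case (fields \<theta> x u)
      then show ?thesis using that Yc[of u \<theta> x] c d0 by auto
    qed
    show "Y (\<theta>, x, u) = u - x_primitive (\<lambda>q. b (slice_graph Y q)) (\<theta>, x, u)"
      if "(\<theta>, x, u) \<in> tube d (c / 2)" for \<theta> x u
    proof -
      have xu: "\<bar>x\<bar> < d" "\<bar>u\<bar> < c / 2" using that by auto
      have "I Z (\<theta>, x, u) s = b (slice_graph Y (\<theta>, x * s, u))" if "s \<in> {0..1}" for s
      proof -
        have "\<bar>x * s\<bar> \<le> c" using abs_mult_unit_less[OF xu(1), of s] that d0 by auto
        moreover have "\<bar>Y (\<theta>, x * s, u)\<bar> \<le> c" using Yc[OF xu(2)] by (simp add: less_imp_le)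
        moreover have "cl d x = x" using xu by (simp add: cl_id)
        ultimately show ?thesis by (simp add: I_def bt_def cl_id Y_def)
      qed
      then have "integral {0..1} (I Z (\<theta>, x, u)) = integral {0..1} (\<lambda>s. b (slice_graph Y (\<theta>, x * s, u)))"
        by (rule integral_cong)
      moreover have "Z (\<theta>, x, u) = - (x * integral {0..1} (I Z (\<theta>, x, u)))"
        using fun_cong[OF FZ, of "(\<theta>, x, u)"] xu cl_id[of x d] by (simp add: F_def)
      ultimately show ?thesis by (simp add: Y_def x_primitive_def)
    qed
    show "Y (\<theta> + 2 * pi, x, u) = Y (\<theta>, x, u)" for \<theta> x u
      by (simp add: Y_def Z_per)
  qed (use c d0 in auto)
qed

end


section \<open>Diffeomorphisms near the circle\<close>

text \<open>Objects near the circle are lifted to the universal cover, where they commute with translation by \<open>period\<close>. A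
  one-form is encoded by its vector \<open>B\<close> of coefficients, as \<open>v \<mapsto> B q \<bullet> v\<close>.\<close>

definition period :: coords where "period = (2 * pi, 0, 0)"

definition core_line :: "coords set" where "core_line = range (\<lambda>\<theta>. (\<theta>, 0, 0))"

text \<open>These are the preimages under \<open>cyl\<close> of the open neighbourhoods of the
  circle.\<close>

definition axis_nbhd :: "coords set \<Rightarrow> bool" where
  "axis_nbhd S \<longleftrightarrow> open S \<and> (\<forall>q. q + period \<in> S \<longleftrightarrow> q \<in> S) \<and> core_line \<subseteq> S"

lemma axis_nbhdD:
  assumes "axis_nbhd S"
  shows "open S" "q + period \<in> S \<longleftrightarrow> q \<in> S" "(\<theta>, 0, 0) \<in> S"
proof -
  show "open S" "q + period \<in> S \<longleftrightarrow> q \<in> S" using assms unfolding axis_nbhd_def by blast+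
  show "(\<theta>, 0, 0) \<in> S" using assms unfolding axis_nbhd_def core_line_def by blast
qed

lemma axis_nbhd_Int: "axis_nbhd S \<Longrightarrow> axis_nbhd T \<Longrightarrow> axis_nbhd (S \<inter> T)"
  by (auto simp: axis_nbhd_def)

lemma axis_nbhd_tube: "0 < d \<Longrightarrow> 0 < r \<Longrightarrow> axis_nbhd (tube d r)"
  unfolding axis_nbhd_def using open_tube by (auto simp: core_line_def period_def)

text \<open>The inverse is carried along with the same properties, so the notion is symmetric and
  composes without choosing inverses; commuting with \<open>period\<close> lets both maps
  descend.\<close>

definition circle_diffeo ::
    "coords set \<Rightarrow> (coords \<Rightarrow> coords) \<Rightarrow> coords set \<Rightarrow> (coords \<Rightarrow> coords) \<Rightarrow> bool" where
  "circle_diffeo S G T H \<longleftrightarrow> axis_nbhd S \<and> axis_nbhd T \<and> smooth_on S G \<and> smooth_on T H \<and>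
     (\<forall>q\<in>S. G q \<in> T \<and> H (G q) = q \<and> G (q + period) = G q + period) \<and>
     (\<forall>q\<in>T. H q \<in> S \<and> G (H q) = q \<and> H (q + period) = H q + period) \<and>
     (\<forall>\<theta>. G (\<theta>, 0, 0) = (\<theta>, 0, 0) \<and> H (\<theta>, 0, 0) = (\<theta>, 0, 0))"

lemma circle_diffeoI:
  assumes S: "axis_nbhd S" and T: "axis_nbhd T" and smooth: "smooth_on S G" "smooth_on T H"
    and G: "\<And>q. q \<in> S \<Longrightarrow> G q \<in> T \<and> H (G q) = q" and H: "\<And>q. q \<in> T \<Longrightarrow> H q \<in> S \<and> G (H q) = q"
    and period: "\<And>q. q \<in> S \<Longrightarrow> G (q + period) = G q + period"
    and on_core_line: "\<And>\<theta>. G (\<theta>, 0, 0) = (\<theta>, 0, 0)"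
  shows "circle_diffeo S G T H"
proof -
  have "H (\<theta>, 0, 0) = (\<theta>, 0, 0)" for \<theta>
    using G[OF axis_nbhdD(3)[OF S], of \<theta>] on_core_line[of \<theta>] by simp
  moreover have "H (q + period) = H q + period" if "q \<in> T" for q
  proof -
    have "H q + period \<in> S" using H[OF that] axis_nbhdD(2)[OF S] by simp
    moreover have "G (H q + period) = q + period" using period H[OF that] by simp
    ultimately show ?thesis using G by metis
  qed
  ultimately show ?thesis using assms unfolding circle_diffeo_def by blast
qed

lemma circle_diffeo_sym: "circle_diffeo S G T H \<Longrightarrow> circle_diffeo T H S G"
  unfolding circle_diffeo_def by blast

lemma circle_diffeo_ident: "axis_nbhd S \<Longrightarrow> circle_diffeo S (\<lambda>q. q) S (\<lambda>q. q)"
  by (rule circle_diffeoI) (auto simp: smooth_on_def intro: Ck_on_ident)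

lemma circle_diffeo_restrict:
  assumes d: "circle_diffeo S G T H" and S': "axis_nbhd S'" "S' \<subseteq> S"
  shows "circle_diffeo S' G (T \<inter> H -` S') H"
proof (rule circle_diffeoI[OF S'(1)])
  have "open (T \<inter> H -` S')"
    using d S' smooth_on_imp_continuous_on
    by (intro continuous_open_preimage) (auto simp: circle_diffeo_def axis_nbhd_def)
  then show "axis_nbhd (T \<inter> H -` S')"
  proof -
    have "q + period \<in> T \<and> H (q + period) \<in> S' \<longleftrightarrow> q \<in> T \<and> H q \<in> S'" for q
      using d axis_nbhdD(2)[OF S'(1), of "H q"] axis_nbhdD(2)[of T q]
      unfolding circle_diffeo_def by metis
    then show ?thesis
      using \<open>open (T \<inter> H -` S')\<close> d S' unfolding axis_nbhd_def[of "T \<inter> H -` S'"]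
      by (auto simp: circle_diffeo_def core_line_def axis_nbhdD)
  qed
qed (use d S' in \<open>auto simp: circle_diffeo_def intro: smooth_on_subset\<close>)

lemma circle_diffeo_compose:
  assumes 1: "circle_diffeo S G T H" and 2: "circle_diffeo T G' U H'"
  shows "circle_diffeo S (\<lambda>q. G' (G q)) U (\<lambda>q. H (H' q))"
proof -
  have "smooth_on S (\<lambda>q. G' (G q))" "smooth_on U (\<lambda>q. H (H' q))"
    using 1 2 unfolding circle_diffeo_def axis_nbhd_def
    by (auto intro!: smooth_on_compose[of T G' S G] smooth_on_compose[of T H U H'])
  then show ?thesis using 1 2 unfolding circle_diffeo_def by simp
qed

lemma circle_diffeo_has_derivative:
  "circle_diffeo S G T H \<Longrightarrow> q \<in> S \<Longrightarrow> (G has_derivative frechet_derivative G (at q)) (at q)"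
  using smooth_on_has_derivative circle_diffeo_def by blast

lemma circle_diffeo_derivative_inverse:
  assumes d: "circle_diffeo S G T H" and q: "q \<in> S"
  shows "frechet_derivative H (at (G q)) (frechet_derivative G (at q) v) = v"
proof -
  have Gq: "G q \<in> T" using d q by (auto simp: circle_diffeo_def)
  have "((\<lambda>x. H (G x)) has_derivative (\<lambda>v. frechet_derivative H (at (G q)) (frechet_derivative G (at q) v))) (at q)"
    by (rule has_derivative_compose[OF circle_diffeo_has_derivative[OF d q]
          circle_diffeo_has_derivative[OF circle_diffeo_sym[OF d] Gq]])
  moreover have "((\<lambda>x. H (G x)) has_derivative (\<lambda>v. v)) (at q)"
    by (rule has_derivative_transform_within_open[OF has_derivative_ident, of S])
      (use d q in \<open>auto simp: circle_diffeo_def axis_nbhd_def\<close>)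
  ultimately show ?thesis using has_derivative_unique by (metis (lifting))
qed

text \<open>Points with equal image differ by a multiple of \<open>e\<close>, and on the segment
  between them, which lies in \<open>S\<close> by convexity, the map is strictly monotone by
  \<open>pos\<close>; this gives injectivity on all of \<open>S\<close>. Invariance of domain then
  makes the image open. Both nonlinear coordinate changes of the normal form are of this
  kind.\<close>

lemma circle_diffeo_shear:
  assumes S: "axis_nbhd S" "convex S" and s: "smooth_on S s"
    and period: "\<And>q. q \<in> S \<Longrightarrow> s (q + period) = s q" and on_core_line: "\<And>\<theta>. s (\<theta>, 0, 0) = 0"
    and pos: "\<And>q. q \<in> S \<Longrightarrow> 1 + frechet_derivative s (at q) e > 0"
  defines "G \<equiv> \<lambda>q. q + s q *\<^sub>R e"
  shows "circle_diffeo S G (G ` S) (inv_into S G)"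
proof -
  let ?s' = "\<lambda>q. frechet_derivative s (at q)"
  have "open S" using S axis_nbhdD by blast
  have sd: "(s has_derivative ?s' q) (at q)" if "q \<in> S" for q
    using smooth_on_has_derivative[OF s that] .
  have smooth: "smooth_on S G"
    unfolding G_def smooth_on_def by (intro allI Ck_intros \<open>open S\<close> smooth_on_Ck[OF s])
  have inj: "inj_on G S"
  proof (rule inj_onI)
    fix q q' assume q: "q \<in> S" and q': "q' \<in> S" and eq: "G q = G q'"
    define t where "t = s q - s q'"
    have q'_eq: "q' = q + t *\<^sub>R e" using eq by (simp add: G_def t_def algebra_simps)
    let ?\<phi> = "\<lambda>\<tau>. \<tau> * t + s (q + (\<tau> * t) *\<^sub>R e)"
    have seg: "q + (\<tau> * t) *\<^sub>R e \<in> S" if "\<tau> \<in> {0..1}" for \<tau>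
    proof -
      have "(1 - \<tau>) *\<^sub>R q + \<tau> *\<^sub>R q' \<in> S" using that q q' by (intro convexD_alt[OF S(2)]) auto
      then show ?thesis by (simp add: q'_eq algebra_simps)
    qed
    have der: "(?\<phi> has_real_derivative t * (1 + ?s' (q + (\<tau> * t) *\<^sub>R e) e)) (at \<tau>)" if "\<tau> \<in> {0..1}" for \<tau>
    proof -
      note d = sd[OF seg[OF that]]
      have "((\<lambda>\<tau>. q + (\<tau> * t) *\<^sub>R e) has_derivative (\<lambda>h. (h * t) *\<^sub>R e)) (at \<tau>)"
        by (auto intro!: derivative_eq_intros)
      from has_derivative_compose[OF this d]
      have "((\<lambda>\<tau>. s (q + (\<tau> * t) *\<^sub>R e)) has_derivative (\<lambda>h. ?s' (q + (\<tau> * t) *\<^sub>R e) ((h * t) *\<^sub>R e))) (at \<tau>)" .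
      then have "((\<lambda>\<tau>. s (q + (\<tau> * t) *\<^sub>R e)) has_real_derivative t * ?s' (q + (\<tau> * t) *\<^sub>R e) e) (at \<tau>)"
        unfolding has_field_derivative_def
        by (rule has_derivative_eq_rhs) (simp add: fun_eq_iff linear_scale[OF has_derivative_linear[OF d]])
      moreover have "((\<lambda>\<tau>. \<tau> * t) has_real_derivative t) (at \<tau>)" by (auto intro!: derivative_eq_intros)
      ultimately have "(?\<phi> has_real_derivative t + t * ?s' (q + (\<tau> * t) *\<^sub>R e) e) (at \<tau>)"
        by (intro DERIV_add)
      then show ?thesis by (simp add: distrib_left)
    qed
    obtain \<tau> where \<tau>: "0 < \<tau>" "\<tau> < 1" "?\<phi> 1 - ?\<phi> 0 = (1 - 0) * (t * (1 + ?s' (q + (\<tau> * t) *\<^sub>R e) e))"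
      using MVT2[of 0 1 ?\<phi> "\<lambda>\<tau>. t * (1 + ?s' (q + (\<tau> * t) *\<^sub>R e) e)"] der by auto
    have "?\<phi> 1 - ?\<phi> 0 = 0" by (simp add: t_def q'_eq[unfolded t_def, symmetric])
    then have "t * (1 + ?s' (q + (\<tau> * t) *\<^sub>R e) e) = 0" using \<tau>(3) by simp
    moreover have "1 + ?s' (q + (\<tau> * t) *\<^sub>R e) e > 0" using pos[OF seg] \<tau> by simp
    ultimately have "t = 0" by simp
    then show "q = q'" using q'_eq by simp
  qed
  have G_period: "G (q + period) = G q + period" if "q \<in> S" for q
    using period[OF that] by (simp add: G_def)
  have openT: "open (G ` S)"
    by (rule invariance_of_domain[OF smooth_on_imp_continuous_on[OF smooth] \<open>open S\<close> inj])
  have T: "axis_nbhd (G ` S)"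
    unfolding axis_nbhd_def
  proof (intro conjI allI openT)
    show "core_line \<subseteq> G ` S"
    proof
      fix q assume "q \<in> core_line"
      then obtain \<theta> where "q = (\<theta>, 0, 0)" by (auto simp: core_line_def)
      then have "q = G q" "q \<in> S" using on_core_line[of \<theta>] axis_nbhdD(3)[OF S(1), of \<theta>] by (simp_all add: G_def)
      then show "q \<in> G ` S" by blast
    qed
    fix y show "y + period \<in> G ` S \<longleftrightarrow> y \<in> G ` S"
    proof
      assume "y \<in> G ` S"
      then obtain q where "q \<in> S" "y = G q" by blast
      then show "y + period \<in> G ` S"
        using G_period[of q] axis_nbhdD(2)[OF S(1), of q] by (metis image_eqI)
    next
      assume "y + period \<in> G ` S"
      then obtain q where q: "q \<in> S" "y + period = G q" by blast
      have "q - period \<in> S" using axis_nbhdD(2)[OF S(1), of "q - period"] q(1) by simp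
      moreover from this have "G (q - period) = y" using G_period[of "q - period"] q(2) by simp
      ultimately show "y \<in> G ` S" by blast
    qed
  qed
  have dG: "(G has_derivative (\<lambda>v. v + ?s' q v *\<^sub>R e)) (at q)" if "q \<in> S" for q
    unfolding G_def by (auto intro!: derivative_eq_intros sd[OF that])
  have "smooth_on (G ` S) (inv_into S G)"
  proof (rule smooth_on_inverse_map[OF \<open>open S\<close> openT smooth])
    show "G q \<in> G ` S \<and> inv_into S G (G q) = q" if "q \<in> S" for q using that inj by simp
    show "inv_into S G y \<in> S \<and> G (inv_into S G y) = y" if "y \<in> G ` S" for y
      using that by (simp add: inv_into_into f_inv_into_f)
    \<comment> \<open>The derivative is the identity plus a map of rank one, which has this explicit
      inverse (Sherman-Morrison).\<close>
    show "frechet_derivative G (at q) (v - (?s' q v / (1 + ?s' q e)) *\<^sub>R e) = v" if q: "q \<in> S" for q v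
    proof -
      interpret linear "?s' q" by (rule has_derivative_linear[OF sd[OF q]])
      have "1 + ?s' q e \<noteq> 0" using pos[OF q] by simp
      then have "?s' q v - (?s' q v / (1 + ?s' q e)) * ?s' q e = ?s' q v / (1 + ?s' q e)"
        by (simp add: field_simps)
      then show ?thesis
        using frechet_derivative_at[OF dG[OF q], symmetric] by (simp add: diff scale)
    qed
    have s': "smooth_on S (\<lambda>q. ?s' q v)" for v by (rule smooth_on_frechet_derivative[OF s])
    show "smooth_on S (\<lambda>q. v - (?s' q v / (1 + ?s' q e)) *\<^sub>R e)" for v
      unfolding smooth_on_def using pos
      by (intro allI Ck_intros \<open>open S\<close> smooth_on_Ck[OF s']) fastforce
  qed
  then show ?thesis
    using S(1) T smooth G_period inj on_core_line
    by (intro circle_diffeoI) (auto simp: inv_into_into f_inv_into_f, auto simp: G_def)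
qed

section \<open>Equivalence of contact structures near the axis\<close>

text \<open>A relation between germs along the axis, hence the freely shrinking \<open>S\<close> and
  \<open>T\<close>. The factor is asked for pointwise only, because kernels do not see it.\<close>

definition contact_equivalent ::
    "coords set \<Rightarrow> (coords \<Rightarrow> coords) \<Rightarrow> coords set \<Rightarrow> (coords \<Rightarrow> coords) \<Rightarrow> bool" where
  "contact_equivalent D1 B1 D2 B2 \<longleftrightarrow> (\<exists>S G T H. circle_diffeo S G T H \<and> S \<subseteq> D1 \<and> T \<subseteq> D2 \<and>
     (\<forall>q\<in>S. \<exists>c. c \<noteq> 0 \<and> (\<forall>v. B2 (G q) \<bullet> frechet_derivative G (at q) v = c * (B1 q \<bullet> v))))"

lemma contact_equivalent_sym:
  assumes "contact_equivalent D1 B1 D2 B2" shows "contact_equivalent D2 B2 D1 B1"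
proof -
  obtain S G T H where d: "circle_diffeo S G T H" and sub: "S \<subseteq> D1" "T \<subseteq> D2"
    and eq: "\<And>q. q \<in> S \<Longrightarrow> \<exists>c. c \<noteq> 0 \<and> (\<forall>v. B2 (G q) \<bullet> frechet_derivative G (at q) v = c * (B1 q \<bullet> v))"
    using assms unfolding contact_equivalent_def by blast
  have "\<exists>c. c \<noteq> 0 \<and> (\<forall>v. B1 (H y) \<bullet> frechet_derivative H (at y) v = c * (B2 y \<bullet> v))" if y: "y \<in> T" for y
  proof -
    have Hy: "H y \<in> S" "G (H y) = y" using d y by (auto simp: circle_diffeo_def)
    obtain c where l: "c \<noteq> 0" "\<And>v. B2 (G (H y)) \<bullet> frechet_derivative G (at (H y)) v = c * (B1 (H y) \<bullet> v)"
      using eq[OF Hy(1)] by blast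
    have "B1 (H y) \<bullet> frechet_derivative H (at y) v = (1 / c) * (B2 y \<bullet> v)" for v
      using l(2)[of "frechet_derivative H (at y) v"] l(1)
        circle_diffeo_derivative_inverse[OF circle_diffeo_sym[OF d] y, of v] Hy by simp
    then show ?thesis using l(1) by (intro exI[of _ "1 / c"]) auto
  qed
  then show ?thesis
    unfolding contact_equivalent_def using circle_diffeo_sym[OF d] sub by blast
qed

text \<open>The image of the first map and the domain of the second share only a neighbourhood of
  the axis; both maps are first restricted to meet exactly in \<open>T \<inter> S'\<close>.\<close>

lemma contact_equivalent_trans:
  assumes "contact_equivalent D1 B1 D2 B2" "contact_equivalent D2 B2 D3 B3"
  shows "contact_equivalent D1 B1 D3 B3"
proof -
  obtain S G T H where d: "circle_diffeo S G T H" and sub: "S \<subseteq> D1" "T \<subseteq> D2"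
    and eq: "\<And>q. q \<in> S \<Longrightarrow> \<exists>c. c \<noteq> 0 \<and> (\<forall>v. B2 (G q) \<bullet> frechet_derivative G (at q) v = c * (B1 q \<bullet> v))"
    using assms(1) unfolding contact_equivalent_def by blast
  obtain S' G' T' H' where d': "circle_diffeo S' G' T' H'" and sub': "S' \<subseteq> D2" "T' \<subseteq> D3"
    and eq': "\<And>q. q \<in> S' \<Longrightarrow> \<exists>c. c \<noteq> 0 \<and> (\<forall>v. B3 (G' q) \<bullet> frechet_derivative G' (at q) v = c * (B2 q \<bullet> v))"
    using assms(2) unfolding contact_equivalent_def by blast
  have ST: "axis_nbhd (T \<inter> S')" using d d' by (intro axis_nbhd_Int) (auto simp: circle_diffeo_def)
  have r1: "circle_diffeo (S \<inter> G -` (T \<inter> S')) G (T \<inter> S') H"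
    using circle_diffeo_sym[OF circle_diffeo_restrict[OF circle_diffeo_sym[OF d] ST]] by simp
  have r2: "circle_diffeo (T \<inter> S') G' (T' \<inter> H' -` (T \<inter> S')) H'"
    by (rule circle_diffeo_restrict[OF d' ST]) auto
  show ?thesis
    unfolding contact_equivalent_def
  proof (rule exI, rule exI, rule exI, rule exI, intro conjI ballI)
    show "circle_diffeo (S \<inter> G -` (T \<inter> S')) (\<lambda>q. G' (G q)) (T' \<inter> H' -` (T \<inter> S')) (\<lambda>q. H (H' q))"
      by (rule circle_diffeo_compose[OF r1 r2])
    fix q assume "q \<in> S \<inter> G -` (T \<inter> S')"
    then have q: "q \<in> S" "G q \<in> S'" by auto
    obtain l where l: "l \<noteq> 0" "\<And>v. B2 (G q) \<bullet> frechet_derivative G (at q) v = l * (B1 q \<bullet> v)"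
      using eq[OF q(1)] by blast
    obtain l' where l': "l' \<noteq> 0" "\<And>v. B3 (G' (G q)) \<bullet> frechet_derivative G' (at (G q)) v = l' * (B2 (G q) \<bullet> v)"
      using eq'[OF q(2)] by blast
    have "((\<lambda>q. G' (G q)) has_derivative (\<lambda>v. frechet_derivative G' (at (G q)) (frechet_derivative G (at q) v))) (at q)"
      by (rule has_derivative_compose[OF circle_diffeo_has_derivative[OF d q(1)] circle_diffeo_has_derivative[OF d' q(2)]])
    from frechet_derivative_at[OF this, symmetric]
    show "\<exists>c. c \<noteq> 0 \<and> (\<forall>v. B3 (G' (G q)) \<bullet> frechet_derivative (\<lambda>q. G' (G q)) (at q) v = c * (B1 q \<bullet> v))"
      using l l' by (intro exI[of _ "l' * l"]) simp
  qed (use sub sub' in auto)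
qed

lemma contact_equivalent_scaleR:
  assumes "axis_nbhd S" "S \<subseteq> D1" "S \<subseteq> D2" "\<And>q. q \<in> S \<Longrightarrow> f q \<noteq> 0 \<and> B2 q = f q *\<^sub>R B1 q"
  shows "contact_equivalent D1 B1 D2 B2"
proof -
  have "frechet_derivative (\<lambda>q::coords. q) (at q) v = v" for q v
    using frechet_derivative_at[OF has_derivative_ident, of q] by metis
  then have "\<exists>c. c \<noteq> 0 \<and> (\<forall>v. B2 q \<bullet> frechet_derivative (\<lambda>q. q) (at q) v = c * (B1 q \<bullet> v))" if "q \<in> S" for q
    using assms(4)[OF that] by (intro exI[of _ "f q"]) simp
  then show ?thesis
    unfolding contact_equivalent_def using circle_diffeo_ident[OF assms(1)] assms(2,3) by blast
qed

section \<open>The contact condition in terms of coefficients\<close>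

definition contact_number :: "(coords \<Rightarrow> coords) \<Rightarrow> coords \<Rightarrow> real" where
  "contact_number B q = wedge_1_2 (\<lambda>v. B q \<bullet> v) (ext_deriv (\<lambda>q v. B q \<bullet> v) q) (1, 0, 0) (0, 1, 0) (0, 0, 1)"

lemma ext_deriv_inner:
  assumes "(B has_derivative B') (at q)"
  shows "ext_deriv (\<lambda>q v. B q \<bullet> v) q u v = B' u \<bullet> v - B' v \<bullet> u"
proof -
  have "frechet_derivative (\<lambda>q. B q \<bullet> v) (at q) = (\<lambda>u. B' u \<bullet> v)" for v
    using frechet_derivative_at[OF has_derivative_inner_left[OF assms], of v] by simp
  then show ?thesis by (simp add: ext_deriv_def)
qed

lemma contact_number_eq:
  assumes "(B has_derivative B') (at q)"
  shows "contact_number B q =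
    fst (B q) * (snd (snd (B' (0, 1, 0))) - fst (snd (B' (0, 0, 1)))) +
    fst (snd (B q)) * (fst (B' (0, 0, 1)) - snd (snd (B' (1, 0, 0)))) +
    snd (snd (B q)) * (fst (snd (B' (1, 0, 0))) - fst (B' (0, 1, 0)))"
  unfolding contact_number_def wedge_1_2_def ext_deriv_inner[OF assms] by (simp add: inner_prod_def)

text \<open>In \<open>f\<close>\<alpha> \<and> d(\<open>f\<close>\<alpha>) the term containing
  d\<open>f\<close> carries \<alpha> twice and vanishes, which leaves the square.\<close>

lemma contact_number_scaleR:
  assumes f: "(f has_derivative f') (at q)" and B: "(B has_derivative B') (at q)"
  shows "contact_number (\<lambda>q. f q *\<^sub>R B q) q = (f q)\<^sup>2 * contact_number B q"
proof -
  have fB: "((\<lambda>q. f q *\<^sub>R B q) has_derivative (\<lambda>v. f q *\<^sub>R B' v + f' v *\<^sub>R B q)) (at q)"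
    by (rule has_derivative_scaleR[OF f B])
  show ?thesis
    unfolding contact_number_eq[OF fB] contact_number_eq[OF B] by (simp add: algebra_simps power2_eq_square)
qed

text \<open>Positivity is recorded on the axis only: it is an open condition, and neighbourhoods are
  shrunk where it is needed nearby.\<close>

definition contact_along_axis :: "(real \<Rightarrow> real) \<Rightarrow> coords set \<Rightarrow> (coords \<Rightarrow> coords) \<Rightarrow> bool" where
  "contact_along_axis a S B \<longleftrightarrow> axis_nbhd S \<and> smooth_on S B \<and> (\<forall>q\<in>S. B (q + period) = B q) \<and>
     (\<forall>\<theta>. fst (B (\<theta>, 0, 0)) = a \<theta> \<and> contact_number B (\<theta>, 0, 0) > 0)"

lemma contact_along_axis_has_derivative:
  "contact_along_axis a S B \<Longrightarrow> q \<in> S \<Longrightarrow> (B has_derivative frechet_derivative B (at q)) (at q)"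
  using smooth_on_has_derivative contact_along_axis_def by blast

lemma contact_along_axis_scaleR:
  assumes B: "contact_along_axis a S B" and f: "smooth_on S f"
    and f_period: "\<And>q. q \<in> S \<Longrightarrow> f (q + period) = f q" and pos: "\<And>\<theta>. f (\<theta>, 0, 0) \<noteq> 0"
  shows "contact_along_axis (\<lambda>\<theta>. f (\<theta>, 0, 0) * a \<theta>) S (\<lambda>q. f q *\<^sub>R B q)"
proof -
  have S: "axis_nbhd S" "open S" using B by (auto simp: contact_along_axis_def axis_nbhd_def)
  have "smooth_on S (\<lambda>q. f q *\<^sub>R B q)"
    using B f S(2) unfolding smooth_on_def contact_along_axis_def by (intro allI Ck_intros) auto
  moreover have "contact_number (\<lambda>q. f q *\<^sub>R B q) (\<theta>, 0, 0) > 0" for \<theta>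
  proof -
    have q: "(\<theta>, 0, 0) \<in> S" using S(1) by (rule axis_nbhdD)
    show ?thesis
      using contact_number_scaleR[OF smooth_on_has_derivative[OF f q] contact_along_axis_has_derivative[OF B q]]
        B pos[of \<theta>] by (simp add: contact_along_axis_def)
  qed
  ultimately show ?thesis using B f_period S by (simp add: contact_along_axis_def)
qed

lemma contact_along_axis_restrict:
  assumes "contact_along_axis a S B" "axis_nbhd T" "T \<subseteq> S"
  shows "contact_along_axis a T B"
  using assms unfolding contact_along_axis_def by (blast intro: smooth_on_subset)

lemma contact_number_cong:
  assumes "open S" "q \<in> S" "\<And>r. r \<in> S \<Longrightarrow> B r = B' r" "(B has_derivative D) (at q)"
  shows "contact_number B' q = contact_number B q"
proof -
  have "(B' has_derivative D) (at q)"
    by (rule has_derivative_transform_within_open[OF assms(4,1,2,3)])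
  then show ?thesis using assms(2,3,4) by (simp add: contact_number_eq)
qed

lemma contact_along_axis_cong:
  assumes B: "contact_along_axis a S B" and eq: "\<And>q. q \<in> S \<Longrightarrow> B q = B' q"
  shows "contact_along_axis a S B'"
proof -
  have S: "axis_nbhd S" "open S" using B by (auto simp: contact_along_axis_def axis_nbhd_def)
  have "contact_number B' (\<theta>, 0, 0) = contact_number B (\<theta>, 0, 0)" for \<theta>
    by (rule contact_number_cong[OF S(2) axis_nbhdD(3)[OF S(1)] eq
        contact_along_axis_has_derivative[OF B axis_nbhdD(3)[OF S(1)]]])
  moreover have "smooth_on S B'"
    using smooth_on_cong_imp[OF S(2) eq] B by (auto simp: contact_along_axis_def)
  moreover have "B' (q + period) = B' q" if "q \<in> S" for q
    using eq[OF that] eq[of "q + period"] axis_nbhdD(2)[OF S(1), of q] that B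
    by (simp add: contact_along_axis_def)
  ultimately show ?thesis
    using B S eq axis_nbhdD(3)[OF S(1)] by (simp add: contact_along_axis_def)
qed

section \<open>Pullback of forms\<close>

definition pullback :: "(coords \<Rightarrow> coords) \<Rightarrow> (coords \<Rightarrow> coords) \<Rightarrow> coords \<Rightarrow> coords" where
  "pullback G B q = (B (G q) \<bullet> frechet_derivative G (at q) (1, 0, 0),
     B (G q) \<bullet> frechet_derivative G (at q) (0, 1, 0), B (G q) \<bullet> frechet_derivative G (at q) (0, 0, 1))"

lemma inner_pullback:
  assumes "(G has_derivative G') (at q)"
  shows "pullback G B q \<bullet> v = B (G q) \<bullet> G' v"
proof -
  have "linear (\<lambda>v. B (G q) \<bullet> G' v)"
    using has_derivative_linear[OF has_derivative_inner_right[OF assms]] .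
  from linear_coords[OF this, of "fst v" "fst (snd v)" "snd (snd v)"] show ?thesis
    using frechet_derivative_at[OF assms, symmetric]
    by (simp add: pullback_def inner_prod_def mult.commute)
qed

lemma frechet_derivative_commute_vector:
  fixes G :: "'a::euclidean_space \<Rightarrow> 'b::euclidean_space"
  assumes S: "open S" "q \<in> S" and G: "smooth_on S G"
  shows "frechet_derivative (\<lambda>y. frechet_derivative G (at y) v) (at q) u =
    frechet_derivative (\<lambda>y. frechet_derivative G (at y) u) (at q) v"
proof (rule euclidean_eqI)
  fix i :: 'b assume i: "i \<in> Basis"
  let ?g = "\<lambda>y. G y \<bullet> i"
  have g: "smooth_on S ?g"
    using G S(1) unfolding smooth_on_def by (intro allI Ck_on_inner Ck_on_const) auto
  have Dg: "frechet_derivative ?g (at y) v = frechet_derivative G (at y) v \<bullet> i" if "y \<in> S" for y v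
    using frechet_derivative_at[OF has_derivative_inner_left[OF smooth_on_has_derivative[OF G that]], of i, symmetric]
    by simp
  have DD: "frechet_derivative (\<lambda>y. frechet_derivative ?g (at y) v) (at q) u =
      frechet_derivative (\<lambda>y. frechet_derivative G (at y) v) (at q) u \<bullet> i" for u v
  proof -
    have "((\<lambda>y. frechet_derivative G (at y) v \<bullet> i) has_derivative
        (\<lambda>u. frechet_derivative (\<lambda>y. frechet_derivative G (at y) v) (at q) u \<bullet> i)) (at q)"
      by (rule has_derivative_inner_left[OF smooth_on_has_derivative[OF smooth_on_frechet_derivative[OF G] S(2)]])
    then have "((\<lambda>y. frechet_derivative ?g (at y) v) has_derivative
        (\<lambda>u. frechet_derivative (\<lambda>y. frechet_derivative G (at y) v) (at q) u \<bullet> i)) (at q)"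
      by (rule has_derivative_transform_within_open[OF _ S]) (simp add: Dg)
    from frechet_derivative_at[OF this, symmetric] show ?thesis by simp
  qed
  show "frechet_derivative (\<lambda>y. frechet_derivative G (at y) v) (at q) u \<bullet> i =
      frechet_derivative (\<lambda>y. frechet_derivative G (at y) u) (at q) v \<bullet> i"
    using frechet_derivative_commute[OF S smooth_on_Ck[OF g], of v u] by (simp only: DD)
qed

text \<open>Naturality of the exterior derivative: the terms with second derivatives of
  \<open>G\<close> cancel by their symmetry.\<close>

lemma ext_deriv_pullback:
  assumes S: "open S" "q \<in> S" and G: "smooth_on S G" and B: "(B has_derivative B') (at (G q))"
  shows "ext_deriv (\<lambda>q v. pullback G B q \<bullet> v) q u v =
    B' (frechet_derivative G (at q) u) \<bullet> frechet_derivative G (at q) v -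
    B' (frechet_derivative G (at q) v) \<bullet> frechet_derivative G (at q) u"
proof -
  let ?G' = "\<lambda>q. frechet_derivative G (at q)"
  have GD: "(G has_derivative ?G' y) (at y)" if "y \<in> S" for y
    by (rule smooth_on_has_derivative[OF G that])
  have "frechet_derivative (\<lambda>r. pullback G B r \<bullet> v) (at q) u =
      B (G q) \<bullet> frechet_derivative (\<lambda>y. ?G' y v) (at q) u + B' (?G' q u) \<bullet> ?G' q v" for u v
  proof -
    have "((\<lambda>r. B (G r) \<bullet> ?G' r v) has_derivative
       (\<lambda>u. B (G q) \<bullet> frechet_derivative (\<lambda>y. ?G' y v) (at q) u + B' (?G' q u) \<bullet> ?G' q v)) (at q)"
      by (rule has_derivative_inner[OF has_derivative_compose[OF GD[OF S(2)] B]
            smooth_on_has_derivative[OF smooth_on_frechet_derivative[OF G] S(2)]])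
    then have "((\<lambda>r. pullback G B r \<bullet> v) has_derivative
       (\<lambda>u. B (G q) \<bullet> frechet_derivative (\<lambda>y. ?G' y v) (at q) u + B' (?G' q u) \<bullet> ?G' q v)) (at q)"
      by (rule has_derivative_transform_within_open[OF _ S]) (simp add: inner_pullback[OF GD])
    from frechet_derivative_at[OF this, symmetric] show ?thesis by simp
  qed
  then show ?thesis
    unfolding ext_deriv_def using frechet_derivative_commute_vector[OF S G, of u v] by simp
qed

lemma smooth_on_pullback:
  assumes "open S" "smooth_on S G" "smooth_on T B" "\<And>q. q \<in> S \<Longrightarrow> G q \<in> T"
  shows "smooth_on S (pullback G B)"
proof -
  have "smooth_on S (\<lambda>q. B (G q))" using assms smooth_on_compose by blast
  then show ?thesis
    using smooth_on_frechet_derivative[OF assms(2)] assms(1)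
    unfolding smooth_on_def pullback_def[abs_def] by (intro allI Ck_intros) auto
qed

text \<open>The constant \<open>c\<close> covers both periodic functions, with \<open>c = 0\<close>,
  and maps commuting with the translation, with \<open>c = period\<close>.\<close>

lemma frechet_derivative_period:
  assumes S: "axis_nbhd S" and f: "smooth_on S f"
    and period: "\<And>q. q \<in> S \<Longrightarrow> f (q + period) = f q + c" and q: "q \<in> S"
  shows "frechet_derivative f (at (q + period)) = frechet_derivative f (at q)"
proof -
  have qp: "q + period \<in> S" using q axis_nbhdD(2)[OF S] by blast
  have "((\<lambda>y. f (y + period)) has_derivative frechet_derivative f (at (q + period))) (at q)"
    by (rule has_derivative_compose[of "\<lambda>y. y + period" "\<lambda>v. v", OF _ smooth_on_has_derivative[OF f qp]])
      (auto intro!: derivative_eq_intros)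
  then have "((\<lambda>y. f y + c) has_derivative frechet_derivative f (at (q + period))) (at q)"
    by (rule has_derivative_transform_within_open[OF _ axis_nbhdD(1)[OF S] q]) (simp add: period)
  moreover have "((\<lambda>y. f y + c) has_derivative frechet_derivative f (at q)) (at q)"
    using has_derivative_add_const[OF smooth_on_has_derivative[OF f q]] .
  ultimately show ?thesis by (rule has_derivative_unique)
qed

text \<open>For \<open>G\<close> fixing \<open>core_line\<close>, the derivative there maps \<open>(1, 0, 0)\<close> to itself, so this minor is its determinant.\<close>

definition axis_orientation :: "(coords \<Rightarrow> coords) \<Rightarrow> bool" where
  "axis_orientation G' \<longleftrightarrow>
     fst (snd (G' (0, 1, 0))) * snd (snd (G' (0, 0, 1))) - snd (snd (G' (0, 1, 0))) * fst (snd (G' (0, 0, 1))) > 0"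

text \<open>\<open>G\<close> fixes the axis pointwise, so its derivative fixes the direction of
  \<theta> there. This preserves the coefficient \<open>a\<close>, and \<alpha> \<and> d\<alpha> is
  multiplied by the determinant, which reduces to the minor in
  \<open>axis_orientation\<close>.\<close>

lemma contact_along_axis_pullback:
  assumes d: "circle_diffeo S G T H" and B: "contact_along_axis a D B" and sub: "T \<subseteq> D"
    and orient: "\<And>\<theta>. axis_orientation (frechet_derivative G (at (\<theta>, 0, 0)))"
  shows "contact_along_axis a S (pullback G B)" and "contact_equivalent S (pullback G B) D B"
proof -
  have S: "axis_nbhd S" "open S" and G: "smooth_on S G"
    using d by (auto simp: circle_diffeo_def axis_nbhd_def)
  have GT: "G q \<in> D" if "q \<in> S" for q using d sub that by (auto simp: circle_diffeo_def)
  have Bs: "smooth_on D B" using B by (simp add: contact_along_axis_def)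
  have GD: "(G has_derivative frechet_derivative G (at y)) (at y)" if "y \<in> S" for y
    by (rule smooth_on_has_derivative[OF G that])
  have G_axis: "G (\<theta>, 0, 0) = (\<theta>, 0, 0)" for \<theta> using d by (simp add: circle_diffeo_def)
  have G_period: "G (q + period) = G q + period" if "q \<in> S" for q
    using d that by (simp add: circle_diffeo_def)
  have q: "(\<theta>, 0, 0) \<in> S" for \<theta> using axis_nbhdD(3)[OF S(1)] .
  have G1: "frechet_derivative G (at (\<theta>, 0, 0)) (1, 0, 0) = (1, 0, 0)" for \<theta>
  proof -
    have inj: "((\<lambda>t. (t, 0, 0)) has_derivative (\<lambda>t. (t, 0, 0)::coords)) (at \<theta>)"
      by (auto intro!: derivative_eq_intros simp: zero_prod_def)
    from has_derivative_compose[OF inj GD[OF q]]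
    have "((\<lambda>t. (t, 0, 0)) has_derivative (\<lambda>t. frechet_derivative G (at (\<theta>, 0, 0)) (t, 0, 0))) (at \<theta>)"
      by (simp add: G_axis)
    from fun_cong[OF has_derivative_unique[OF this inj], of 1] show ?thesis .
  qed
  have "contact_number (pullback G B) (\<theta>, 0, 0) > 0" for \<theta>
  proof -
    let ?q = "(\<theta>, 0, 0) :: coords"
    have "(B has_derivative frechet_derivative B (at (G ?q))) (at (G ?q))"
      by (rule smooth_on_has_derivative[OF Bs GT[OF q]])
    then obtain B' where B': "(B has_derivative B') (at (G ?q))" by blast
    note ext = ext_deriv_pullback[OF S(2) q G B']
    obtain k1 k2 k3 where K: "frechet_derivative G (at ?q) (0, 1, 0) = (k1, k2, k3)" by (metis prod_cases3)
    obtain l1 l2 l3 where L: "frechet_derivative G (at ?q) (0, 0, 1) = (l1, l2, l3)" by (metis prod_cases3)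
    have pos: "k2 * l3 - k3 * l2 > 0" using orient[of \<theta>] by (simp add: axis_orientation_def K L)
    have lin: "B' (x, y, z) = x *\<^sub>R B' (1, 0, 0) + y *\<^sub>R B' (0, 1, 0) + z *\<^sub>R B' (0, 0, 1)" for x y z
    proof -
      interpret linear B' by (rule has_derivative_linear[OF B'])
      have "B' (x, y, z) = B' (x *\<^sub>R (1, 0, 0) + y *\<^sub>R (0, 1, 0) + z *\<^sub>R (0, 0, 1))" by simp
      then show ?thesis by (simp only: add scale)
    qed
    have "contact_number (pullback G B) ?q = (k2 * l3 - k3 * l2) * contact_number B (G ?q)"
      unfolding contact_number_eq[OF B']
      unfolding contact_number_def wedge_1_2_def ext inner_pullback[OF GD[OF q]] G1 K L
        lin[of k1 k2 k3] lin[of l1 l2 l3]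
      by (simp add: inner_prod_def algebra_simps)
    then show ?thesis using pos B by (simp add: G_axis contact_along_axis_def)
  qed
  moreover have "pullback G B (q + period) = pullback G B q" if "q \<in> S" for q
  proof -
    have "frechet_derivative G (at (q + period)) = frechet_derivative G (at q)"
      by (rule frechet_derivative_period[OF S(1) G G_period that])
    moreover have "B (G (q + period)) = B (G q)"
      using G_period[OF that] GT[OF that] B by (simp add: contact_along_axis_def)
    ultimately show ?thesis by (simp add: pullback_def)
  qed
  moreover have "fst (pullback G B (\<theta>, 0, 0)) = a \<theta>" for \<theta>
    using B G1[of \<theta>] by (simp add: pullback_def G_axis contact_along_axis_def inner_prod_def)
  ultimately show "contact_along_axis a S (pullback G B)"
    unfolding contact_along_axis_def using S smooth_on_pullback[OF S(2) G Bs GT] by blast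
  have "\<exists>c. c \<noteq> 0 \<and> (\<forall>v. B (G q) \<bullet> frechet_derivative G (at q) v = c * (pullback G B q \<bullet> v))" if "q \<in> S" for q
    by (intro exI[of _ 1]) (simp add: inner_pullback[OF GD[OF that]])
  then show "contact_equivalent S (pullback G B) D B"
    unfolding contact_equivalent_def using d sub by blast
qed


section \<open>The normal form\<close>

lemma tube_in_axis_nbhd:
  assumes S: "axis_nbhd S" obtains r where "0 < r" "tube r r \<subseteq> S"
proof -
  define K :: "coords set" where "K = {0..2 * pi} \<times> {(0, 0)}"
  have "compact K" unfolding K_def by (intro compact_Times compact_Icc) simp
  moreover have "K \<subseteq> S" using axis_nbhdD(3)[OF S] by (auto simp: K_def)
  ultimately obtain e where e: "e > 0" "(\<Union>q\<in>K. ball q e) \<subseteq> S"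
    using compact_subset_open_imp_ball_epsilon_subset[OF _ axis_nbhdD(1)[OF S]] by metis
  \<comment> \<open>Half the radius, because the norm of \<open>(x, y)\<close> is estimated by
    \<open>\<bar>x\<bar> + \<bar>y\<bar>\<close>.\<close>
  have "tube (e / 2) (e / 2) \<subseteq> S"
  proof
    fix q assume "q \<in> tube (e / 2) (e / 2)"
    then obtain \<theta> x y where q: "q = (\<theta>, x, y)" "\<bar>x\<bar> < e / 2" "\<bar>y\<bar> < e / 2" by (cases q) auto
    obtain k :: int where k: "\<theta> + of_int k * (2 * pi) \<in> {0..<2 * pi}"
      using shift_into_period[of "2 * pi" \<theta>] by auto
    let ?p = "(\<theta> + of_int k * (2 * pi), 0, 0) :: coords"
    have "dist ?p (\<theta> + of_int k * (2 * pi), x, y) < e"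
      using norm_Pair_le[of "- x" "- y"] q by (simp add: dist_Pair_Pair dist_norm)
    moreover have "?p \<in> K" using k by (auto simp: K_def)
    ultimately have "(\<theta> + of_int k * (2 * pi), x, y) \<in> S" using e(2) by (auto simp: subset_iff)
    moreover have "((t + 2 * pi, x, y) \<in> S) = ((t, x, y) \<in> S)" for t
      using axis_nbhdD(2)[OF S, of "(t, x, y)"] by (simp add: period_def)
    ultimately show "q \<in> S" using periodic_int[of "\<lambda>t. (t, x, y) \<in> S" "2 * pi" \<theta> k] q by simp
  qed
  then show thesis using that[of "e / 2"] e by simp
qed

text \<open>Reads off one directional derivative of a map that is affine along a short segment,
  without computing the derivative as a whole.\<close>

lemma derivative_along_line:
  assumes "(G has_derivative G') (at q)" "e > 0" "\<And>t::real. \<bar>t\<bar> < e \<Longrightarrow> G (q + t *\<^sub>R v) = G q + t *\<^sub>R k"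
  shows "G' v = k"
proof -
  have "((\<lambda>t. q + t *\<^sub>R v) has_derivative (\<lambda>t. t *\<^sub>R v)) (at 0)"
    by (auto intro!: derivative_eq_intros)
  moreover have "(G has_derivative G') (at (q + 0 *\<^sub>R v))" using assms(1) by simp
  ultimately have "((\<lambda>t. G (q + t *\<^sub>R v)) has_derivative (\<lambda>t. G' (t *\<^sub>R v))) (at 0)"
    by (rule has_derivative_compose)
  then have "((\<lambda>t. G q + t *\<^sub>R k) has_derivative (\<lambda>t. G' (t *\<^sub>R v))) (at 0)"
    by (rule has_derivative_transform_within_open[of _ _ _ _ "ball 0 e"]) (use assms in auto)
  moreover have "((\<lambda>t. G q + t *\<^sub>R k) has_derivative (\<lambda>t. t *\<^sub>R k)) (at 0)"
    by (auto intro!: derivative_eq_intros)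
  ultimately have "(\<lambda>t. G' (t *\<^sub>R v)) = (\<lambda>t. t *\<^sub>R k)" by (rule has_derivative_unique)
  from fun_cong[OF this, of 1] show ?thesis by simp
qed

lemma contact_along_axis_nonzero:
  assumes B: "contact_along_axis a S B" shows "B (\<theta>, 0, 0) \<noteq> 0"
proof
  assume "B (\<theta>, 0, 0) = 0"
  moreover have "(\<theta>, 0, 0) \<in> S" using B axis_nbhdD(3) by (auto simp: contact_along_axis_def)
  ultimately have "contact_number B (\<theta>, 0, 0) = 0"
    using contact_number_eq[OF contact_along_axis_has_derivative[OF B]] by simp
  then show False using B by (auto simp: contact_along_axis_def dest: spec[of _ \<theta>])
qed

lemma smooth_on_along_axis:
  assumes "contact_along_axis a S B" shows "smooth_on UNIV (\<lambda>\<theta>. B (\<theta>, 0, 0))"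
proof (rule smooth_on_compose[of S B])
  show "smooth_on UNIV (\<lambda>\<theta>::real. (\<theta>, 0, 0) :: coords)"
    unfolding smooth_on_def by (intro allI Ck_intros) auto
qed (use assms axis_nbhdD(3) in \<open>auto simp: contact_along_axis_def\<close>)

text \<open>Adding a multiple of \<open>a\<close> to \<open>(b, c)\<close> fails to make it nonzero only for \<open>(w\<^sub>1, w\<^sub>2)\<close> on the smooth
  curve \<open>- (b, c) / a\<close>, and curves in the plane have measure zero.\<close>

lemma exists_constant_shear:
  fixes a b c :: "real \<Rightarrow> real"
  assumes diff: "a differentiable_on UNIV" "b differentiable_on UNIV" "c differentiable_on UNIV"
    and nz: "\<And>\<theta>. (a \<theta>, b \<theta>, c \<theta>) \<noteq> 0"
  obtains w1 w2 where "\<And>\<theta>. (b \<theta> + w1 * a \<theta>)\<^sup>2 + (c \<theta> + w2 * a \<theta>)\<^sup>2 > 0"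
proof -
  let ?f = "\<lambda>\<theta>. (- (b \<theta> / a \<theta>), - (c \<theta> / a \<theta>))"
  have "?f differentiable (at \<theta> within {\<theta>. a \<theta> \<noteq> 0})" if "a \<theta> \<noteq> 0" for \<theta>
  proof -
    obtain a' b' c' where "(a has_derivative a') (at \<theta>)" "(b has_derivative b') (at \<theta>)" "(c has_derivative c') (at \<theta>)"
      using diff unfolding differentiable_on_def differentiable_def by simp blast
    note d = this[THEN has_derivative_at_withinI]
    have "(?f has_derivative (\<lambda>h. (- ((b' h * a \<theta> - b \<theta> * a' h) / (a \<theta> * a \<theta>)), - ((c' h * a \<theta> - c \<theta> * a' h) / (a \<theta> * a \<theta>)))))
        (at \<theta> within {\<theta>. a \<theta> \<noteq> 0})"
      by (intro has_derivative_Pair has_derivative_minus has_derivative_divide' d that)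
    then show ?thesis by (auto simp: differentiable_def)
  qed
  then have "negligible (?f ` {\<theta>. a \<theta> \<noteq> 0})"
    by (intro negligible_differentiable_image_lowdim) (auto simp: differentiable_on_def)
  then have "?f ` {\<theta>. a \<theta> \<noteq> 0} \<noteq> UNIV" by auto
  then obtain w1 w2 where w: "(w1, w2) \<notin> ?f ` {\<theta>. a \<theta> \<noteq> 0}" by auto
  have "(b \<theta> + w1 * a \<theta>)\<^sup>2 + (c \<theta> + w2 * a \<theta>)\<^sup>2 > 0" for \<theta>
  proof (cases "a \<theta> = 0")
    case True
    then show ?thesis using nz[of \<theta>] by (simp add: sum_power2_gt_zero_iff zero_prod_def)
  next
    case False
    then have "w1 \<noteq> - (b \<theta> / a \<theta>) \<or> w2 \<noteq> - (c \<theta> / a \<theta>)" using w by auto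
    then have "b \<theta> + w1 * a \<theta> \<noteq> 0 \<or> c \<theta> + w2 * a \<theta> \<noteq> 0"
      using False by (auto simp: field_simps)
    then show ?thesis by (simp add: sum_power2_gt_zero_iff)
  qed
  then show thesis using that by blast
qed

text \<open>The constant shear makes the normal covector \<open>(\<beta>, \<gamma>)\<close> nonzero
  everywhere on the axis. In the plane, the vector \<open>(\<gamma>, - \<beta>)\<close> spans its
  kernel and \<open>(\<beta>', \<gamma>')\<close>, which is \<open>(\<beta>, \<gamma>)\<close>
  divided by its squared norm, has value 1 on it. Using them as new basis vectors gives coefficients
  0 and 1, with determinant 1 on the axis.\<close>

lemma align_along_axis:
  assumes B: "contact_along_axis a S B"
  obtains S' B' where "contact_along_axis a S' B'" "contact_equivalent S' B' S B"
    "\<And>\<theta>. B' (\<theta>, 0, 0) = (a \<theta>, 0, 1)"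
proof -
  have S: "axis_nbhd S" using B by (simp add: contact_along_axis_def)
  define b0 where "b0 = (\<lambda>\<theta>. fst (snd (B (\<theta>, 0, 0))))"
  define c0 where "c0 = (\<lambda>\<theta>. snd (snd (B (\<theta>, 0, 0))))"
  have B_axis: "B (\<theta>, 0, 0) = (a \<theta>, b0 \<theta>, c0 \<theta>)" for \<theta>
    using B by (simp add: contact_along_axis_def b0_def c0_def prod_eq_iff)
  have smooth: "Ck_on k UNIV a" "Ck_on k UNIV b0" "Ck_on k UNIV c0" for k
  proof -
    have s: "Ck_on k UNIV (\<lambda>\<theta>. B (\<theta>, 0, 0))" by (rule smooth_on_Ck[OF smooth_on_along_axis[OF B]])
    show "Ck_on k UNIV b0" "Ck_on k UNIV c0" unfolding b0_def c0_def by (intro Ck_intros s open_UNIV)+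
    have "Ck_on k UNIV (\<lambda>\<theta>. fst (B (\<theta>, 0, 0)))" by (intro Ck_intros s open_UNIV)
    then show "Ck_on k UNIV a" by (simp add: B_axis)
  qed
  have periodic: "a (\<theta> + 2 * pi) = a \<theta>" "b0 (\<theta> + 2 * pi) = b0 \<theta>" "c0 (\<theta> + 2 * pi) = c0 \<theta>" for \<theta>
  proof -
    have "B ((\<theta>, 0, 0) + period) = B (\<theta>, 0, 0)"
      using B axis_nbhdD(3)[OF S, of \<theta>] unfolding contact_along_axis_def by blast
    then show "a (\<theta> + 2 * pi) = a \<theta>" "b0 (\<theta> + 2 * pi) = b0 \<theta>" "c0 (\<theta> + 2 * pi) = c0 \<theta>"
      by (simp_all add: period_def B_axis)
  qed
  have diff: "a differentiable_on UNIV" "b0 differentiable_on UNIV" "c0 differentiable_on UNIV"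
    using smooth[of "Suc 0"] by (auto simp: differentiable_on_def)
  have "(a \<theta>, b0 \<theta>, c0 \<theta>) \<noteq> 0" for \<theta>
    using contact_along_axis_nonzero[OF B, of \<theta>] by (simp add: B_axis)
  from exists_constant_shear[OF diff this]
  obtain w1 w2 where w: "\<And>\<theta>. (b0 \<theta> + w1 * a \<theta>)\<^sup>2 + (c0 \<theta> + w2 * a \<theta>)\<^sup>2 > 0"
    by blast
  define \<beta> where "\<beta> = (\<lambda>\<theta>. b0 \<theta> + w1 * a \<theta>)"
  define \<gamma> where "\<gamma> = (\<lambda>\<theta>. c0 \<theta> + w2 * a \<theta>)"
  define n where "n = (\<lambda>\<theta>. (\<beta> \<theta>)\<^sup>2 + (\<gamma> \<theta>)\<^sup>2)"
  have n: "n \<theta> > 0" for \<theta> using w by (simp add: n_def \<beta>_def \<gamma>_def)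
  have n_eq: "n \<theta> = \<beta> \<theta> * \<beta> \<theta> + \<gamma> \<theta> * \<gamma> \<theta>" for \<theta> by (simp add: n_def power2_eq_square)
  define \<beta>' where "\<beta>' = (\<lambda>\<theta>. \<beta> \<theta> / n \<theta>)"
  define \<gamma>' where "\<gamma>' = (\<lambda>\<theta>. \<gamma> \<theta> / n \<theta>)"
  have norm: "\<beta> \<theta> * \<beta>' \<theta> + \<gamma> \<theta> * \<gamma>' \<theta> = 1" "\<gamma> \<theta> * \<beta>' \<theta> = \<beta> \<theta> * \<gamma>' \<theta>" for \<theta>
  proof -
    have "\<beta> \<theta> * \<beta>' \<theta> + \<gamma> \<theta> * \<gamma>' \<theta> = n \<theta> / n \<theta>"
      unfolding \<beta>'_def \<gamma>'_def times_divide_eq_right add_divide_distrib[symmetric] n_eq ..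
    then show "\<beta> \<theta> * \<beta>' \<theta> + \<gamma> \<theta> * \<gamma>' \<theta> = 1" using n[of \<theta>] by simp
    show "\<gamma> \<theta> * \<beta>' \<theta> = \<beta> \<theta> * \<gamma>' \<theta>" by (simp add: \<beta>'_def \<gamma>'_def)
  qed
  have smooth': "Ck_on k UNIV \<beta>" "Ck_on k UNIV \<gamma>" "Ck_on k UNIV \<beta>'" "Ck_on k UNIV \<gamma>'" for k
  proof -
    show 1: "Ck_on k UNIV \<beta>" "Ck_on k UNIV \<gamma>"
      unfolding \<beta>_def \<gamma>_def by (intro Ck_intros smooth open_UNIV)+
    have 2: "n = (\<lambda>\<theta>. \<beta> \<theta> * \<beta> \<theta> + \<gamma> \<theta> * \<gamma> \<theta>)" using n_eq by auto
    have 3: "Ck_on k UNIV n" unfolding 2 by (intro Ck_intros 1 open_UNIV)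
    show "Ck_on k UNIV \<beta>'" "Ck_on k UNIV \<gamma>'"
      unfolding \<beta>'_def \<gamma>'_def by (intro Ck_intros 1 3 open_UNIV; use n in \<open>simp add: less_imp_neq[symmetric]\<close>)+
  qed
  have periodic': "\<beta> (\<theta> + 2 * pi) = \<beta> \<theta>" "\<gamma> (\<theta> + 2 * pi) = \<gamma> \<theta>"
    "\<beta>' (\<theta> + 2 * pi) = \<beta>' \<theta>" "\<gamma>' (\<theta> + 2 * pi) = \<gamma>' \<theta>" for \<theta>
    by (simp_all add: \<beta>'_def \<gamma>'_def n_def \<beta>_def \<gamma>_def periodic)
  define X where "X = (\<lambda>q::coords. \<gamma> (fst q) * fst (snd q) + \<beta>' (fst q) * snd (snd q))"
  define Y where "Y = (\<lambda>q::coords. \<gamma>' (fst q) * snd (snd q) - \<beta> (fst q) * fst (snd q))"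
  define L where "L = (\<lambda>q. (fst q + w1 * X q + w2 * Y q, X q, Y q))"
  \<comment> \<open>Undoes the shear and recovers the original angle, at which the inverse matrix in
    \<open>K\<close> has to be evaluated.\<close>
  define t where "t = (\<lambda>p::coords. fst p - w1 * fst (snd p) - w2 * snd (snd p))"
  define K where "K = (\<lambda>p. (t p, \<gamma>' (t p) * fst (snd p) - \<beta>' (t p) * snd (snd p),
      \<beta> (t p) * fst (snd p) + \<gamma> (t p) * snd (snd p)))"
  have "circle_diffeo UNIV L UNIV K"
  proof (rule circle_diffeoI)
    have fst: "Ck_on k UNIV (\<lambda>q. g (fst q))" if "\<And>k. Ck_on k UNIV g" for k and g :: "real \<Rightarrow> real"
      by (rule Ck_on_compose[OF that open_UNIV]) (auto intro: Ck_intros)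
    show "smooth_on UNIV L"
      unfolding smooth_on_def L_def X_def Y_def by (intro allI Ck_intros open_UNIV fst smooth')
    have t: "Ck_on k UNIV t" for k unfolding t_def by (intro Ck_intros open_UNIV)
    have gt: "Ck_on k UNIV (\<lambda>q. g (t q))" if "\<And>k. Ck_on k UNIV g" for k and g :: "real \<Rightarrow> real"
      by (rule Ck_on_compose[OF that open_UNIV t]) auto
    show "smooth_on UNIV K"
      unfolding smooth_on_def K_def by (intro allI Ck_intros open_UNIV gt t smooth')
    have inv: "\<gamma>' \<theta> * (\<gamma> \<theta> * x + \<beta>' \<theta> * y) - \<beta>' \<theta> * (\<gamma>' \<theta> * y - \<beta> \<theta> * x) = x"
      "\<beta> \<theta> * (\<gamma> \<theta> * x + \<beta>' \<theta> * y) + \<gamma> \<theta> * (\<gamma>' \<theta> * y - \<beta> \<theta> * x) = y" for \<theta> x y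
    proof -
      have "\<gamma>' \<theta> * (\<gamma> \<theta> * x + \<beta>' \<theta> * y) - \<beta>' \<theta> * (\<gamma>' \<theta> * y - \<beta> \<theta> * x) = (\<beta> \<theta> * \<beta>' \<theta> + \<gamma> \<theta> * \<gamma>' \<theta>) * x"
        "\<beta> \<theta> * (\<gamma> \<theta> * x + \<beta>' \<theta> * y) + \<gamma> \<theta> * (\<gamma>' \<theta> * y - \<beta> \<theta> * x) = (\<beta> \<theta> * \<beta>' \<theta> + \<gamma> \<theta> * \<gamma>' \<theta>) * y"
        by (simp_all add: algebra_simps)
      then show "\<gamma>' \<theta> * (\<gamma> \<theta> * x + \<beta>' \<theta> * y) - \<beta>' \<theta> * (\<gamma>' \<theta> * y - \<beta> \<theta> * x) = x"
        "\<beta> \<theta> * (\<gamma> \<theta> * x + \<beta>' \<theta> * y) + \<gamma> \<theta> * (\<gamma>' \<theta> * y - \<beta> \<theta> * x) = y"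
        by (simp_all add: norm)
    qed
    have inv': "\<gamma> \<theta> * (\<gamma>' \<theta> * x - \<beta>' \<theta> * y) + \<beta>' \<theta> * (\<beta> \<theta> * x + \<gamma> \<theta> * y) = x"
      "\<gamma>' \<theta> * (\<beta> \<theta> * x + \<gamma> \<theta> * y) - \<beta> \<theta> * (\<gamma>' \<theta> * x - \<beta>' \<theta> * y) = y" for \<theta> x y
    proof -
      have "\<gamma> \<theta> * (\<gamma>' \<theta> * x - \<beta>' \<theta> * y) + \<beta>' \<theta> * (\<beta> \<theta> * x + \<gamma> \<theta> * y) = (\<beta> \<theta> * \<beta>' \<theta> + \<gamma> \<theta> * \<gamma>' \<theta>) * x"
        "\<gamma>' \<theta> * (\<beta> \<theta> * x + \<gamma> \<theta> * y) - \<beta> \<theta> * (\<gamma>' \<theta> * x - \<beta>' \<theta> * y) = (\<beta> \<theta> * \<beta>' \<theta> + \<gamma> \<theta> * \<gamma>' \<theta>) * y"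
        by (simp_all add: algebra_simps)
      then show "\<gamma> \<theta> * (\<gamma>' \<theta> * x - \<beta>' \<theta> * y) + \<beta>' \<theta> * (\<beta> \<theta> * x + \<gamma> \<theta> * y) = x"
        "\<gamma>' \<theta> * (\<beta> \<theta> * x + \<gamma> \<theta> * y) - \<beta> \<theta> * (\<gamma>' \<theta> * x - \<beta>' \<theta> * y) = y"
        by (simp_all add: norm)
    qed
    show "L q \<in> UNIV \<and> K (L q) = q" for q
    proof -
      have "t (L q) = fst q" by (simp add: t_def L_def)
      then show ?thesis by (simp add: K_def L_def X_def Y_def inv)
    qed
    show "K p \<in> UNIV \<and> L (K p) = p" for p
      by (simp add: L_def X_def Y_def K_def inv') (simp add: t_def)
    show "L (q + period) = L q + period" for q
      by (simp add: L_def X_def Y_def period_def periodic' prod_eq_iff)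
    show "L (\<theta>, 0, 0) = (\<theta>, 0, 0)" for \<theta> by (simp add: L_def X_def Y_def)
  qed (auto simp: axis_nbhd_def)
  from circle_diffeo_sym[OF circle_diffeo_restrict[OF circle_diffeo_sym[OF this] S]]
  have d: "circle_diffeo (L -` S) L S K" by simp
  define D where "D = (\<lambda>\<theta>. frechet_derivative L (at (\<theta>, 0, 0)))"
  have D_eq: "frechet_derivative L (at (\<theta>, 0, 0)) = D \<theta>" for \<theta> by (simp add: D_def)
  have LD: "(L has_derivative D \<theta>) (at (\<theta>, 0, 0))" for \<theta>
    unfolding D_def by (rule circle_diffeo_has_derivative[OF \<open>circle_diffeo UNIV L UNIV K\<close>]) simp
  have D2: "D \<theta> (0, 1, 0) = (w1 * \<gamma> \<theta> - w2 * \<beta> \<theta>, \<gamma> \<theta>, - \<beta> \<theta>)" for \<theta>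
    by (rule derivative_along_line[OF LD zero_less_one]) (simp add: L_def X_def Y_def algebra_simps)
  have D3: "D \<theta> (0, 0, 1) = (w1 * \<beta>' \<theta> + w2 * \<gamma>' \<theta>, \<beta>' \<theta>, \<gamma>' \<theta>)" for \<theta>
    by (rule derivative_along_line[OF LD zero_less_one]) (simp add: L_def X_def Y_def algebra_simps)
  have orient: "axis_orientation (D \<theta>)" for \<theta>
    using norm(1)[of \<theta>] by (simp add: axis_orientation_def D2 D3 algebra_simps)
  note pb = contact_along_axis_pullback[OF d B subset_refl orient[unfolded D_def]]
  have "pullback L B (\<theta>, 0, 0) = (a \<theta>, 0, 1)" for \<theta>
  proof -
    have L_axis: "L (\<theta>, 0, 0) = (\<theta>, 0, 0)" by (simp add: L_def X_def Y_def)
    have "fst (pullback L B (\<theta>, 0, 0)) = a \<theta>" using pb(1) by (simp add: contact_along_axis_def)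
    moreover have "fst (snd (pullback L B (\<theta>, 0, 0))) = 0"
      by (simp add: pullback_def L_axis B_axis D_eq D2 inner_prod_def)
        (simp add: \<beta>_def \<gamma>_def algebra_simps)
    moreover have "snd (snd (pullback L B (\<theta>, 0, 0))) = \<beta> \<theta> * \<beta>' \<theta> + \<gamma> \<theta> * \<gamma>' \<theta>"
      by (simp add: pullback_def L_axis B_axis D_eq D3 inner_prod_def)
        (simp add: \<beta>_def \<gamma>_def algebra_simps)
    ultimately show ?thesis by (simp add: norm prod_eq_iff)
  qed
  with pb show thesis using that by blast
qed

text \<open>The coefficient is positive near the axis and equals 1 on it, so dividing by it leaves
  \<open>a\<close> unchanged.\<close>

lemma normalise_dy_coefficient:
  assumes B: "contact_along_axis a S B" and on_core_line: "\<And>\<theta>. snd (snd (B (\<theta>, 0, 0))) = 1"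
  obtains S' B' where "contact_along_axis a S' B'" "contact_equivalent S' B' S B"
    "\<And>q. q \<in> S' \<Longrightarrow> snd (snd (B' q)) = 1"
proof -
  have S: "axis_nbhd S" and Bs: "smooth_on S B" using B by (simp_all add: contact_along_axis_def)
  have B_period: "B (q + period) = B q" if "q \<in> S" for q
    using B that by (simp add: contact_along_axis_def)
  define S' where "S' = S \<inter> (\<lambda>q. snd (snd (B q))) -` {0<..}"
  have "open S'"
    unfolding S'_def using smooth_on_imp_continuous_on[OF Bs] axis_nbhdD(1)[OF S]
    by (intro continuous_open_preimage continuous_intros) auto
  moreover have "q + period \<in> S' \<longleftrightarrow> q \<in> S'" for q
    using axis_nbhdD(2)[OF S, of q] B_period[of q] by (auto simp: S'_def)
  ultimately have S': "axis_nbhd S'"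
    using S on_core_line by (auto simp: axis_nbhd_def core_line_def S'_def)
  have sub: "S' \<subseteq> S" by (auto simp: S'_def)
  have pos: "snd (snd (B q)) \<noteq> 0" if "q \<in> S'" for q using that by (simp add: S'_def)
  let ?f = "\<lambda>q. inverse (snd (snd (B q)))"
  have f: "smooth_on S' ?f"
    unfolding smooth_on_def using smooth_on_Ck[OF smooth_on_subset[OF Bs sub]] pos
    by (intro allI Ck_intros \<open>open S'\<close>)
  have "contact_along_axis (\<lambda>\<theta>. ?f (\<theta>, 0, 0) * a \<theta>) S' (\<lambda>q. ?f q *\<^sub>R B q)"
    by (rule contact_along_axis_scaleR[OF contact_along_axis_restrict[OF B S' sub] f])
      (use B_period sub on_core_line in auto)
  then have "contact_along_axis a S' (\<lambda>q. ?f q *\<^sub>R B q)" by (simp add: on_core_line)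
  moreover have "contact_equivalent S' (\<lambda>q. ?f q *\<^sub>R B q) S B"
    by (rule contact_equivalent_scaleR[OF S' subset_refl sub, of "\<lambda>q. snd (snd (B q))"]) (simp add: pos)
  ultimately show thesis using that pos by simp
qed

text \<open>Along the graph of \<open>Y\<close> the \<open>dx\<close>-coefficient becomes
  \<open>b + \<partial>Y/\<partial>x\<close>, which the ODE makes zero. Division by
  \<open>\<partial>Y/\<partial>u\<close> then normalises the last coefficient; this factor is 1 on
  the axis because \<open>Y (\<theta>, 0, u) = u\<close>, so \<open>a\<close> survives.\<close>

lemma straighten_legendrian_foliation:
  assumes B: "contact_along_axis a S B" and c: "\<And>q. q \<in> S \<Longrightarrow> snd (snd (B q)) = 1"
  obtains d r P where "0 < d" "0 < r" "contact_along_axis a (tube d r) (\<lambda>q. (P q, 0, 1))"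
    "contact_equivalent (tube d r) (\<lambda>q. (P q, 0, 1)) S B"
proof -
  have S: "axis_nbhd S" and Bs: "smooth_on S B" using B by (simp_all add: contact_along_axis_def)
  obtain r where r: "0 < r" "tube r r \<subseteq> S" using tube_in_axis_nbhd[OF S] .
  define b where "b = (\<lambda>q. fst (snd (B q)))"
  have b: "smooth_on (tube r r) b"
    unfolding b_def smooth_on_def using smooth_on_Ck[OF smooth_on_subset[OF Bs r(2)]]
    by (intro allI Ck_intros open_tube)
  have b_period: "b (\<theta> + 2 * pi, x, y) = b (\<theta>, x, y)" if "(\<theta>, x, y) \<in> tube r r" for \<theta> x y
  proof -
    have "B ((\<theta>, x, y) + period) = B (\<theta>, x, y)"
      using B that r(2) unfolding contact_along_axis_def by blast
    then show ?thesis by (simp add: b_def period_def)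
  qed
  obtain d \<rho> Y where d: "0 < d" "0 < \<rho>" and Y_cont: "continuous_on (tube d \<rho>) Y"
    and Y_in: "\<And>q. q \<in> tube d \<rho> \<Longrightarrow> slice_graph Y q \<in> tube r r"
    and Y_eq: "\<And>\<theta> x u. (\<theta>, x, u) \<in> tube d \<rho> \<Longrightarrow>
      Y (\<theta>, x, u) = u - x_primitive (\<lambda>q. b (slice_graph Y q)) (\<theta>, x, u)"
    and Y_period: "\<And>\<theta> x u. Y (\<theta> + 2 * pi, x, u) = Y (\<theta>, x, u)"
    by (rule solution_exists[OF r(1) b b_period]) (assumption, (rule that; assumption))
  note ode = open_tube convex_tube b d(1) Y_cont Y_in Y_eq
  let ?W = "tube d \<rho>"
  have Y: "smooth_on ?W Y" by (rule smooth_on_solution[OF ode])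
  define Y' where "Y' = (\<lambda>q. frechet_derivative Y (at q))"
  have YD: "(Y has_derivative Y' q) (at q)" if "q \<in> ?W" for q
    unfolding Y'_def by (rule smooth_on_has_derivative[OF Y that])
  have Y2: "Y' q (0, 1, 0) = - b (slice_graph Y q)" and Y3: "Y' q (0, 0, 1) > 0" if "q \<in> ?W" for q
    unfolding Y'_def using solution_derivatives[OF ode that] by simp_all
  have Y0: "Y (\<theta>, 0, u) = u" if "\<bar>u\<bar> < \<rho>" for \<theta> u by (rule solution_initial[OF ode that])
  have W: "axis_nbhd ?W" by (rule axis_nbhd_tube[OF d])
  define s where "s = (\<lambda>q. Y q - snd (snd q))"
  have sD: "(s has_derivative (\<lambda>v. Y' q v - snd (snd v))) (at q)" if "q \<in> ?W" for q
    unfolding s_def by (auto intro!: derivative_eq_intros YD[OF that])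
  have s': "frechet_derivative s (at q) v = Y' q v - snd (snd v)" if "q \<in> ?W" for q v
    using frechet_derivative_at[OF sD[OF that], symmetric] by simp
  have G_eq: "(\<lambda>q. q + s q *\<^sub>R (0, 0, 1)) = slice_graph Y"
    by (auto simp: s_def fun_eq_iff)
  have diffeo: "circle_diffeo ?W (slice_graph Y) (slice_graph Y ` ?W) (inv_into ?W (slice_graph Y))"
    unfolding G_eq[symmetric]
  proof (rule circle_diffeo_shear[OF W convex_tube])
    show "smooth_on ?W s"
      unfolding smooth_on_def s_def using smooth_on_Ck[OF Y] by (intro allI Ck_intros open_tube)
    show "s (q + period) = s q" for q by (cases q) (simp add: s_def period_def Y_period)
    show "s (\<theta>, 0, 0) = 0" for \<theta> using Y0 d by (simp add: s_def)
    show "1 + frechet_derivative s (at q) (0, 0, 1) > 0" if "q \<in> ?W" for q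
      using Y3[OF that] by (simp add: s'[OF that])
  qed
  have GD: "(slice_graph Y has_derivative (\<lambda>v. (fst v, fst (snd v), Y' q v))) (at q)" if "q \<in> ?W" for q
    unfolding slice_graph_alt by (auto intro!: derivative_eq_intros YD[OF that])
  have G': "frechet_derivative (slice_graph Y) (at q) v = (fst v, fst (snd v), Y' q v)" if "q \<in> ?W" for q v
    using frechet_derivative_at[OF GD[OF that], symmetric] by simp
  have axis_W: "(\<theta>, 0, 0) \<in> ?W" for \<theta> using d by simp
  have "slice_graph Y ` ?W \<subseteq> S" using Y_in r(2) by blast
  note pb = contact_along_axis_pullback[OF diffeo B this]
  have orient: "axis_orientation (frechet_derivative (slice_graph Y) (at (\<theta>, 0, 0)))" for \<theta>
    using Y3[OF axis_W[of \<theta>]] by (simp add: axis_orientation_def G'[OF axis_W])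
  let ?f = "\<lambda>q. inverse (Y' q (0, 0, 1))"
  have Y'_axis: "Y' (\<theta>, 0, 0) (0, 0, 1) = 1" for \<theta>
    by (rule derivative_along_line[OF YD[OF axis_W] d(2)]) (use Y0 d in simp)
  have Y'_smooth: "smooth_on ?W (\<lambda>q. Y' q (0, 0, 1))"
    unfolding Y'_def by (rule smooth_on_frechet_derivative[OF Y])
  have Y'_nz: "Y' q (0, 0, 1) \<noteq> 0" if "q \<in> ?W" for q using Y3[OF that] by simp
  have f: "smooth_on ?W ?f"
    unfolding smooth_on_def using smooth_on_Ck[OF Y'_smooth] Y'_nz by (intro allI Ck_intros open_tube)
  have f_period: "?f (q + period) = ?f q" if "q \<in> ?W" for q
  proof -
    have "Y (q + period) = Y q + 0" for q by (cases q) (simp add: period_def Y_period)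
    from frechet_derivative_period[OF W Y this that] show ?thesis by (simp add: Y'_def)
  qed
  define P where "P = (\<lambda>q. ?f q * (fst (B (slice_graph Y q)) + Y' q (1, 0, 0)))"
  have scaled: "?f q *\<^sub>R pullback (slice_graph Y) B q = (P q, 0, 1)" if "q \<in> ?W" for q
  proof -
    have "snd (snd (B (slice_graph Y q))) = 1" using c Y_in[OF that] r(2) by blast
    moreover have "b (slice_graph Y q) = fst (snd (B (slice_graph Y q)))" by (simp add: b_def)
    ultimately show ?thesis
      using Y2[OF that] Y'_nz[OF that] by (simp add: P_def pullback_def G'[OF that] inner_prod_def)
  qed
  have "contact_along_axis (\<lambda>\<theta>. ?f (\<theta>, 0, 0) * a \<theta>) ?W (\<lambda>q. ?f q *\<^sub>R pullback (slice_graph Y) B q)"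
    by (rule contact_along_axis_scaleR[OF pb(1)[OF orient] f f_period]) (simp_all add: Y'_axis)
  then have "contact_along_axis a ?W (\<lambda>q. ?f q *\<^sub>R pullback (slice_graph Y) B q)" by (simp add: Y'_axis)
  from contact_along_axis_cong[OF this scaled] have "contact_along_axis a ?W (\<lambda>q. (P q, 0, 1))" .
  moreover have "contact_equivalent ?W (\<lambda>q. (P q, 0, 1)) ?W (pullback (slice_graph Y) B)"
  proof (rule contact_equivalent_sym, rule contact_equivalent_scaleR[OF W subset_refl subset_refl, of ?f])
    show "?f q \<noteq> 0 \<and> (P q, 0, 1) = ?f q *\<^sub>R pullback (slice_graph Y) B q" if "q \<in> ?W" for q
      using scaled[OF that] Y'_nz[OF that] by simp
  qed
  ultimately show thesis
    using that[OF d] contact_equivalent_trans[OF _ pb(2)[OF orient]] by blast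
qed

section \<open>The model and the proof of the normal form\<close>

definition model_form :: "(real \<Rightarrow> real) \<Rightarrow> coords \<Rightarrow> coords" where
  "model_form a q = (a (fst q) - fst (snd q), 0, 1)"

lemma equivalent_to_model:
  assumes B: "contact_along_axis a S (\<lambda>q. (P q, 0, 1))"
  shows "contact_equivalent S (\<lambda>q. (P q, 0, 1)) UNIV (model_form a)"
proof -
  let ?B = "\<lambda>q. (P q, 0, 1) :: coords"
  have S: "axis_nbhd S" and Bs: "smooth_on S ?B" using B by (simp_all add: contact_along_axis_def)
  have P: "smooth_on S P"
  proof -
    have "smooth_on S (\<lambda>q. fst (?B q))"
      using Bs unfolding smooth_on_def by (intro allI Ck_on_fst axis_nbhdD(1)[OF S]) blast
    then show ?thesis by simp
  qed
  have P_period: "P (q + period) = P q" if "q \<in> S" for q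
    using B that by (simp add: contact_along_axis_def)
  have P_axis: "P (\<theta>, 0, 0) = a \<theta>" for \<theta> using B by (simp add: contact_along_axis_def)
  define P' where "P' = (\<lambda>q. frechet_derivative P (at q))"
  have PD: "(P has_derivative P' q) (at q)" if "q \<in> S" for q
    unfolding P'_def by (rule smooth_on_has_derivative[OF P that])
  have axis_S: "(\<theta>, 0, 0) \<in> S" for \<theta> by (rule axis_nbhdD(3)[OF S])
  have P2_axis: "P' (\<theta>, 0, 0) (0, 1, 0) < 0" for \<theta>
  proof -
    \<comment> \<open>For coefficients \<open>(P, 0, 1)\<close> the only surviving term of \<alpha>
      \<and> d\<alpha> is \<open>- \<partial>P/\<partial>x\<close>.\<close>
    have "(?B has_derivative (\<lambda>v. (P' (\<theta>, 0, 0) v, 0, 0))) (at (\<theta>, 0, 0))"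
      by (auto intro!: derivative_eq_intros PD[OF axis_S] simp: zero_prod_def)
    from contact_number_eq[OF this] have "contact_number ?B (\<theta>, 0, 0) = - P' (\<theta>, 0, 0) (0, 1, 0)" by simp
    moreover have "contact_number ?B (\<theta>, 0, 0) > 0" using B by (simp add: contact_along_axis_def)
    ultimately show ?thesis by simp
  qed
  define S' where "S' = S \<inter> (\<lambda>q. P' q (0, 1, 0)) -` {..<0}"
  have "open S'"
    unfolding S'_def P'_def
    using smooth_on_imp_continuous_on[OF smooth_on_frechet_derivative[OF P]] axis_nbhdD(1)[OF S]
    by (intro continuous_open_preimage) auto
  moreover have "q + period \<in> S' \<longleftrightarrow> q \<in> S'" for q
  proof (cases "q \<in> S")
    case True
    have "P' (q + period) = P' q"
      unfolding P'_def by (rule frechet_derivative_period[OF S P, of 0]) (use P_period True in auto)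
    then show ?thesis using axis_nbhdD(2)[OF S, of q] by (simp add: S'_def)
  next
    case False
    then show ?thesis using axis_nbhdD(2)[OF S, of q] by (simp add: S'_def)
  qed
  ultimately have "axis_nbhd S'"
    using S P2_axis by (auto simp: axis_nbhd_def core_line_def S'_def)
  then obtain e where e: "0 < e" "tube e e \<subseteq> S'" using tube_in_axis_nbhd by blast
  let ?W = "tube e e"
  have W: "axis_nbhd ?W" by (rule axis_nbhd_tube[OF e(1) e(1)])
  have WS: "q \<in> S" "P' q (0, 1, 0) < 0" if "q \<in> ?W" for q using e(2) that by (auto simp: S'_def)
  have a_smooth: "smooth_on UNIV a"
  proof -
    have "smooth_on UNIV (\<lambda>\<theta>. P (\<theta>, 0, 0))"
    proof (rule smooth_on_compose[OF P])
      show "smooth_on UNIV (\<lambda>\<theta>::real. (\<theta>, 0, 0) :: coords)"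
        unfolding smooth_on_def by (intro allI Ck_intros) auto
    qed (use axis_S in auto)
    then show ?thesis by (simp add: P_axis)
  qed
  have a_period: "a (\<theta> + 2 * pi) = a \<theta>" for \<theta>
    using P_period[OF axis_S[of \<theta>]] by (simp add: period_def P_axis)
  \<comment> \<open>Adding \<open>s\<close> to \<open>x\<close> yields the coordinate
    \<open>a - P\<close>, in which \<open>P\<close> reads \<open>a\<close> minus that coordinate.
    The shear is monotone because \<open>1 + \<partial>s/\<partial>x\<close> equals
    \<open>- \<partial>P/\<partial>x\<close>.\<close>
  define s where "s = (\<lambda>q. a (fst q) - P q - fst (snd q))"
  have aD: "((\<lambda>q::coords. a (fst q)) has_derivative (\<lambda>v. frechet_derivative a (at (fst q)) (fst v))) (at q)" for q
    by (rule has_derivative_compose[OF has_derivative_fst[OF has_derivative_ident] smooth_on_has_derivative[OF a_smooth]]) simp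
  have sD: "(s has_derivative (\<lambda>v. frechet_derivative a (at (fst q)) (fst v) - P' q v - fst (snd v))) (at q)"
    if "q \<in> ?W" for q
    unfolding s_def by (intro has_derivative_diff aD PD WS(1)[OF that] derivative_intros)
  have s: "smooth_on ?W s"
  proof -
    have "Ck_on k ?W (\<lambda>q::coords. a (fst q))" for k
      by (rule Ck_on_compose[OF smooth_on_Ck[OF a_smooth] open_tube]) (auto intro: Ck_intros open_tube)
    moreover have "smooth_on ?W P" using smooth_on_subset[OF P] WS(1) by blast
    ultimately show ?thesis
      unfolding smooth_on_def s_def by (intro allI Ck_intros open_tube) auto
  qed
  let ?e = "(0, 1, 0) :: coords"
  let ?G = "\<lambda>q. q + s q *\<^sub>R ?e"
  have diffeo: "circle_diffeo ?W ?G (?G ` ?W) (inv_into ?W ?G)"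
  proof (rule circle_diffeo_shear[OF W convex_tube s])
    show "s (q + period) = s q" if "q \<in> ?W" for q
      using P_period[OF WS(1)[OF that]] a_period by (simp add: s_def period_def)
    show "s (\<theta>, 0, 0) = 0" for \<theta> by (simp add: s_def P_axis)
    show "1 + frechet_derivative s (at q) ?e > 0" if "q \<in> ?W" for q
    proof -
      have "frechet_derivative a (at (fst q)) 0 = 0"
        by (rule linear_0[OF has_derivative_linear[OF smooth_on_has_derivative[OF a_smooth]]]) simp
      then show ?thesis
        using frechet_derivative_at[OF sD[OF that], symmetric] WS(2)[OF that] by simp
    qed
  qed
  have "\<exists>c. c \<noteq> 0 \<and> (\<forall>v. model_form a (?G q) \<bullet> frechet_derivative ?G (at q) v = c * (?B q \<bullet> v))"
    if "q \<in> ?W" for q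
  proof -
    have "(?G has_derivative (\<lambda>v. v + frechet_derivative s (at q) v *\<^sub>R ?e)) (at q)"
      by (auto intro!: derivative_eq_intros smooth_on_has_derivative[OF s that])
    from frechet_derivative_at[OF this, symmetric]
    have "frechet_derivative ?G (at q) v = v + frechet_derivative s (at q) v *\<^sub>R ?e" for v by simp
    moreover have "model_form a (?G q) = ?B q" by (simp add: model_form_def s_def)
    ultimately show ?thesis by (intro exI[of _ 1]) (simp add: inner_prod_def)
  qed
  then show ?thesis
    unfolding contact_equivalent_def using diffeo WS(1) by blast
qed

lemma contact_normal_form:
  assumes "contact_along_axis a S B"
  shows "contact_equivalent S B UNIV (model_form a)"
proof -
  obtain S1 B1 where 1: "contact_along_axis a S1 B1" "contact_equivalent S1 B1 S B"
    "\<And>\<theta>. B1 (\<theta>, 0, 0) = (a \<theta>, 0, 1)"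
    using align_along_axis[OF assms] by blast
  then have "snd (snd (B1 (\<theta>, 0, 0))) = 1" for \<theta> by simp
  from normalise_dy_coefficient[OF 1(1) this]
  obtain S2 B2 where 2: "contact_along_axis a S2 B2" "contact_equivalent S2 B2 S1 B1"
    "\<And>q. q \<in> S2 \<Longrightarrow> snd (snd (B2 q)) = 1" by blast
  obtain d r P where 3: "contact_along_axis a (tube d r) (\<lambda>q. (P q, 0, 1))"
    "contact_equivalent (tube d r) (\<lambda>q. (P q, 0, 1)) S2 B2"
    using straighten_legendrian_foliation[OF 2(1,3)] by blast
  show ?thesis
    using contact_equivalent_trans[OF contact_equivalent_sym[OF contact_equivalent_trans[OF contact_equivalent_trans[OF 3(2) 2(2)] 1(2)]]
        equivalent_to_model[OF 3(1)]] .
qed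


section \<open>Descent to \<open>S\<^sup>1 \<times> \<real>\<^sup>2\<close>\<close>

lemma cyl_eq: "cyl = (\<lambda>q. (cis (fst q), snd q))"
  by (auto simp: cyl_def)

lemma cyl_in_S1R2 [simp]: "cyl q \<in> S1R2"
  by (simp add: cyl_eq S1R2_def)

lemma smooth_on_cyl: "smooth_on S cyl"
proof -
  have "smooth_on UNIV cyl"
    unfolding cyl_eq smooth_on_def by (intro allI Ck_intros open_UNIV)
  then show ?thesis by (rule smooth_on_subset) simp
qed

lemma cyl_plus_period [simp]: "cyl (q + period) = cyl q"
  by (simp add: cyl_eq period_def cis_mult[symmetric] zero_prod_def[symmetric])

lemma cyl_eq_cylD:
  assumes "cyl q = cyl q'" obtains k :: int where "q' = q + of_int k *\<^sub>R period"
proof -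
  have "cis (fst q) = cis (fst q')" and snd: "snd q = snd q'" using assms by (auto simp: cyl_eq)
  then have "sin (fst q') = sin (fst q) \<and> cos (fst q') = cos (fst q)"
    by (simp add: complex_eq_iff)
  then obtain k :: int where "fst q' = fst q + 2 * pi * k" using sin_cos_eq_iff by blast
  then show thesis using that[of k] snd by (simp add: period_def prod_eq_iff)
qed

lemma axis_nbhd_plus_int:
  assumes "axis_nbhd S" shows "q + of_int k *\<^sub>R period \<in> S \<longleftrightarrow> q \<in> S"
proof (cases q)
  case (fields \<theta> x y)
  have "((t + 2 * pi, x, y) \<in> S) = ((t, x, y) \<in> S)" for t
    using axis_nbhdD(2)[OF assms, of "(t, x, y)"] by (simp add: period_def)
  then show ?thesis
    using periodic_int[of "\<lambda>t. (t, x, y) \<in> S" "2 * pi" \<theta> k] by (simp add: fields period_def)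
qed

lemma circle_diffeo_plus_int:
  assumes d: "circle_diffeo S G T H" and q: "q \<in> S"
  shows "G (q + of_int k *\<^sub>R period) = G q + of_int k *\<^sub>R period"
proof (cases q)
  case (fields \<theta> x y)
  have S: "axis_nbhd S" using d by (simp add: circle_diffeo_def)
  \<comment> \<open>The displacement of \<open>G\<close> is periodic in the angle, but only on
    \<open>S\<close>. The value 0 elsewhere extends it to a periodic function on the whole
    line.\<close>
  let ?f = "\<lambda>t. if (t, x, y) \<in> S then G (t, x, y) - (t, 0, 0) else 0"
  have "?f (t + 2 * pi) = ?f t" for t
  proof -
    have "(t, x, y) \<in> S \<Longrightarrow> G ((t, x, y) + period) = G (t, x, y) + period"
      using d by (simp add: circle_diffeo_def)
    then show ?thesis
      using axis_nbhdD(2)[OF S, of "(t, x, y)"] by (auto simp: period_def prod_eq_iff)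
  qed
  from periodic_int[of ?f "2 * pi" \<theta> k, OF this]
  have "G (q + of_int k *\<^sub>R period) - (\<theta> + of_int k * (2 * pi), 0, 0) = G q - (\<theta>, 0, 0)"
    using q axis_nbhd_plus_int[OF S, of q k] by (simp add: fields period_def)
  then show ?thesis by (simp add: period_def prod_eq_iff)
qed

lemma vimage_cyl_image: "axis_nbhd S \<Longrightarrow> cyl -` (cyl ` S) = S"
  using axis_nbhd_plus_int by (auto elim!: cyl_eq_cylD)

text \<open>Near each point a continuous local section of \<open>cyl\<close> exists, and
  \<open>S\<close> is pulled back along it.\<close>

lemma openin_cyl_image:
  assumes S: "axis_nbhd S" shows "openin (top_of_set S1R2) (cyl ` S)"
proof (subst openin_subopen, intro ballI)
  fix p assume "p \<in> cyl ` S"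
  then obtain q where q: "q \<in> S" "p = cyl q" by blast
  \<comment> \<open>The rotation by \<open>cis (- fst q)\<close> carries the base point to 1, away
    from the branch cut of \<open>Arg\<close>; adding \<open>fst q\<close> selects the sheet
    containing \<open>q\<close>.\<close>
  define l where "l = (\<lambda>p::point. (fst q + Arg (fst p * cis (- fst q)), snd p))"
  have "isCont l p"
  proof -
    have "isCont (\<lambda>p. Arg (fst p * cis (- fst q))) p"
    proof (rule isCont_o2[of p "\<lambda>p. fst p * cis (- fst q)" Arg])
      have "fst p * cis (- fst q) = 1" by (simp add: q cyl_eq cis_mult)
      then show "isCont Arg (fst p * cis (- fst q))" by (intro continuous_at_Arg) simp
    qed (intro continuous_intros)
    then show ?thesis unfolding l_def by (intro continuous_intros)
  qed
  moreover have "l p = q" by (simp add: l_def q cyl_eq cis_mult)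
  ultimately obtain W where W: "open W" "p \<in> W" "\<forall>p'\<in>W. l p' \<in> S"
    using axis_nbhdD(1)[OF S] q(1) unfolding continuous_at_open by blast
  have cyl_l: "cyl (l p') = p'" if "p' \<in> S1R2" for p'
  proof -
    have n: "norm (fst p' * cis (- fst q)) = 1" using that by (auto simp: S1R2_def norm_mult)
    then have "fst p' * cis (- fst q) \<noteq> 0" by auto
    from cis_Arg[OF this] n have "cis (Arg (fst p' * cis (- fst q))) = fst p' * cis (- fst q)"
      by (simp add: sgn_div_norm)
    then have "cis (fst q + Arg (fst p' * cis (- fst q))) = cis (fst q) * (fst p' * cis (- fst q))"
      by (simp add: cis_mult[symmetric])
    also have "\<dots> = fst p' * (cis (fst q) * cis (- fst q))" by (simp only: mult_ac)
    also have "\<dots> = fst p'" by (simp add: cis_mult)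
    finally show ?thesis by (simp add: l_def cyl_eq)
  qed
  have "S1R2 \<inter> W \<subseteq> cyl ` S"
  proof
    fix p' assume p': "p' \<in> S1R2 \<inter> W"
    then have "p' = cyl (l p')" "l p' \<in> S" using W(3) cyl_l[of p'] by simp_all
    then show "p' \<in> cyl ` S" by (rule image_eqI)
  qed
  moreover have "openin (top_of_set S1R2) (S1R2 \<inter> W)" using W(1) by (rule openin_open_Int)
  ultimately show "\<exists>T. openin (top_of_set S1R2) T \<and> p \<in> T \<and> T \<subseteq> cyl ` S"
    using W(2) q by (intro exI[of _ "S1R2 \<inter> W"]) auto
qed

text \<open>\<open>Arg\<close> selects one lift of the point; for \<open>G\<close> commuting with
  \<open>period\<close> any other lift gives the same image.\<close>

definition descend :: "(coords \<Rightarrow> coords) \<Rightarrow> point \<Rightarrow> point" where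
  "descend G p = cyl (G (Arg (fst p), snd p))"

lemma descend_cyl:
  assumes d: "circle_diffeo S G T H" and q: "q \<in> S"
  shows "descend G (cyl q) = cyl (G q)"
proof -
  have "cyl (Arg (fst (cyl q)), snd (cyl q)) = cyl q"
    using cis_Arg[of "cis (fst q)"] by (simp add: cyl_eq sgn_div_norm)
  from this[symmetric] obtain k :: int where k: "(Arg (fst (cyl q)), snd (cyl q)) = q + of_int k *\<^sub>R period"
    by (rule cyl_eq_cylD)
  have "cyl (y + of_int k *\<^sub>R period) = cyl y" for y
    using periodic_int[of "\<lambda>t. cyl (t, snd y)" "2 * pi" "fst y" k]
    by (cases y) (simp add: period_def cyl_eq cis_mult[symmetric])
  then show ?thesis
    unfolding descend_def k circle_diffeo_plus_int[OF d q] by simp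
qed

lemma diffeo_onto_image_descend:
  assumes d: "circle_diffeo S G T H"
  shows "descend G ` cyl ` S = cyl ` T" and "diffeo_onto_image (cyl ` S) (descend G)"
proof -
  note d' = circle_diffeo_sym[OF d]
  have S: "axis_nbhd S" and T: "axis_nbhd T" using d by (auto simp: circle_diffeo_def)
  have GH: "\<And>q. q \<in> S \<Longrightarrow> G q \<in> T \<and> H (G q) = q" "\<And>q. q \<in> T \<Longrightarrow> H q \<in> S \<and> G (H q) = q"
    using d by (auto simp: circle_diffeo_def)
  show image: "descend G ` cyl ` S = cyl ` T"
  proof
    show "descend G ` cyl ` S \<subseteq> cyl ` T" using descend_cyl[OF d] GH(1) by auto
    show "cyl ` T \<subseteq> descend G ` cyl ` S"
    proof
      fix p assume "p \<in> cyl ` T"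
      then obtain y where y: "y \<in> T" "p = cyl y" by blast
      then have "p = descend G (cyl (H y))" using descend_cyl[OF d] GH(2) by simp
      then show "p \<in> descend G ` cyl ` S" using y GH(2) by blast
    qed
  qed
  have left_inv: "descend H (descend G p) = p" if "p \<in> cyl ` S" for p
    using that GH(1) by (auto simp: descend_cyl[OF d] descend_cyl[OF d'])
  have inj: "inj_on (descend G) (cyl ` S)" by (rule inj_on_inverseI[where g="descend H"]) (rule left_inv)
  \<comment> \<open>Stated for an arbitrary pair of diffeomorphisms, since it is applied to
    \<open>G\<close> and again to \<open>H\<close>.\<close>
  have smooth: "smooth_map_on (cyl ` S) (descend G)" if d: "circle_diffeo S G T H" for S G T H
  proof -
    have S: "axis_nbhd S" and G: "smooth_on S G" using d by (auto simp: circle_diffeo_def)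
    have "smooth_on S (\<lambda>q. cyl (G q))"
      by (rule smooth_on_compose[OF smooth_on_cyl[of UNIV] axis_nbhdD(1)[OF S] G]) simp
    then have "smooth_on S (descend G \<circ> cyl)"
      by (rule smooth_on_cong_imp[OF axis_nbhdD(1)[OF S], rotated]) (simp add: descend_cyl[OF d])
    then show ?thesis
      unfolding smooth_map_on_def vimage_cyl_image[OF S] by (auto simp: descend_def)
  qed
  have "smooth_map_on (cyl ` T) (inv_into (cyl ` S) (descend G))"
  proof -
    \<comment> \<open>On the image the chosen inverse must be \<open>descend H\<close>, so its
      smoothness is that of the map induced by \<open>H\<close>.\<close>
    have inv: "inv_into (cyl ` S) (descend G) p = descend H p" if "p \<in> cyl ` T" for p
      using that unfolding image[symmetric] by (auto simp: inv_into_f_f[OF inj] left_inv)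
    have "(inv_into (cyl ` S) (descend G)) ` cyl ` T = descend H ` cyl ` T"
      by (rule image_cong[OF refl inv])
    moreover have "smooth_on T (inv_into (cyl ` S) (descend G) \<circ> cyl)"
      by (rule smooth_on_cong_imp[OF axis_nbhdD(1)[OF T], of "descend H \<circ> cyl"])
        (use inv smooth[OF d'] in \<open>auto simp: smooth_map_on_def vimage_cyl_image[OF T]\<close>)
    ultimately show ?thesis
      using smooth[OF d'] unfolding smooth_map_on_def vimage_cyl_image[OF T] by simp
  qed
  then show "diffeo_onto_image (cyl ` S) (descend G)"
    unfolding diffeo_onto_image_def image
    using openin_cyl_image[OF S] openin_cyl_image[OF T] inj smooth[OF d] by blast
qed

section \<open>From one-forms on the manifold to coefficient vectors\<close>

definition form_coeffs :: "one_form \<Rightarrow> coords \<Rightarrow> coords" where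
  "form_coeffs \<alpha> q = (pullback_cyl \<alpha> q (1, 0, 0), pullback_cyl \<alpha> q (0, 1, 0), pullback_cyl \<alpha> q (0, 0, 1))"

lemma inner_form_coeffs:
  assumes "one_form_on V \<alpha>" "cyl q \<in> V"
  shows "form_coeffs \<alpha> q \<bullet> v = pullback_cyl \<alpha> q v"
proof -
  have "linear (pullback_cyl \<alpha> q)"
    using assms by (simp add: one_form_on_def pullback_cyl_def[abs_def])
  from linear_coords[OF this, of "fst v" "fst (snd v)" "snd (snd v)"] show ?thesis
    by (simp add: form_coeffs_def inner_prod_def mult.commute)
qed

lemma axis_nbhd_vimage_cyl:
  assumes "openin (top_of_set S1R2) V" "core_circle \<subseteq> V"
  shows "axis_nbhd (cyl -` V)"
proof -
  obtain W where W: "open W" "V = S1R2 \<inter> W" using assms(1) by (auto simp: openin_open)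
  have "cyl -` V = cyl -` W" unfolding W(2) using cyl_in_S1R2 by blast
  moreover have "open (cyl -` W)"
    using W(1) smooth_on_imp_continuous_on[OF smooth_on_cyl[of UNIV]] by (rule open_vimage)
  moreover have "cyl (\<theta>, 0, 0) \<in> core_circle" for \<theta>
    by (simp add: core_circle_def cyl_def)
  then have "core_line \<subseteq> cyl -` V" using assms(2) unfolding core_line_def by blast
  ultimately show ?thesis unfolding axis_nbhd_def vimage_def mem_Collect_eq cyl_plus_period by metis
qed

lemma contact_along_axis_form_coeffs:
  assumes V: "openin (top_of_set S1R2) V" "core_circle \<subseteq> V" and \<alpha>: "positive_contact_form_on V \<alpha>"
  shows "contact_along_axis (\<lambda>\<theta>. \<alpha> (cyl (\<theta>, 0, 0)) (d_theta (cyl (\<theta>, 0, 0)))) (cyl -` V) (form_coeffs \<alpha>)"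
proof -
  let ?S = "cyl -` V"
  have form: "one_form_on V \<alpha>" using \<alpha> by (simp add: positive_contact_form_on_def)
  have S: "axis_nbhd ?S" by (rule axis_nbhd_vimage_cyl[OF V])
  have smooth: "smooth_on ?S (\<lambda>q. pullback_cyl \<alpha> q v)" for v
    using form unfolding one_form_on_def by blast
  have B: "smooth_on ?S (form_coeffs \<alpha>)"
    unfolding smooth_on_def form_coeffs_def[abs_def] using smooth_on_Ck[OF smooth]
    by (intro allI Ck_intros axis_nbhdD(1)[OF S])
  have "contact_number (form_coeffs \<alpha>) q > 0" if q: "q \<in> ?S" for q
  proof -
    \<comment> \<open>Linearity of the form is known only over \<open>V\<close>, so both sides agree
      only on the preimage of \<open>V\<close>; it is open, so the derivatives agree as
      well.\<close>
    have "frechet_derivative (\<lambda>r. form_coeffs \<alpha> r \<bullet> v) (at q) = frechet_derivative (\<lambda>r. pullback_cyl \<alpha> r v) (at q)" for v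
    proof -
      have "((\<lambda>r. form_coeffs \<alpha> r \<bullet> v) has_derivative frechet_derivative (\<lambda>r. pullback_cyl \<alpha> r v) (at q)) (at q)"
        by (rule has_derivative_transform_within_open[OF smooth_on_has_derivative[OF smooth q] axis_nbhdD(1)[OF S] q])
          (use inner_form_coeffs[OF form] in simp)
      from frechet_derivative_at[OF this] show ?thesis by simp
    qed
    then have "ext_deriv (\<lambda>q v. form_coeffs \<alpha> q \<bullet> v) q = ext_deriv (pullback_cyl \<alpha>) q"
      by (simp add: ext_deriv_def[abs_def])
    moreover have "(\<lambda>v. form_coeffs \<alpha> q \<bullet> v) = pullback_cyl \<alpha> q"
      using inner_form_coeffs[OF form] q by auto
    moreover have "wedge_1_2 (pullback_cyl \<alpha> q) (ext_deriv (pullback_cyl \<alpha>) q) (1, 0, 0) (0, 1, 0) (0, 0, 1) > 0"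
      using \<alpha> q unfolding positive_contact_form_on_def by blast
    ultimately show ?thesis by (simp only: contact_number_def)
  qed
  then have "contact_number (form_coeffs \<alpha>) (\<theta>, 0, 0) > 0" for \<theta> using axis_nbhdD(3)[OF S] by blast
  moreover have "form_coeffs \<alpha> (q + period) = form_coeffs \<alpha> q" for q
    by (simp add: form_coeffs_def pullback_cyl_def)
  ultimately show ?thesis
    unfolding contact_along_axis_def using S B by (simp add: form_coeffs_def pullback_cyl_def)
qed

text \<open>Proportionality with a nonzero factor makes the kernels correspond, and invertibility of
  the derivative of \<open>G\<close> turns the inclusion into an equality.\<close>

lemma contactomorphism_descend:
  assumes d: "circle_diffeo S G T H" and sub: "S \<subseteq> cyl -` V1" "T \<subseteq> cyl -` V2"
    and form: "one_form_on V1 \<alpha>1" "one_form_on V2 \<alpha>2"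
    and eq: "\<And>q. q \<in> S \<Longrightarrow> \<exists>c. c \<noteq> 0 \<and>
      (\<forall>v. form_coeffs \<alpha>2 (G q) \<bullet> frechet_derivative G (at q) v = c * (form_coeffs \<alpha>1 q \<bullet> v))"
  shows "contactomorphism (cyl ` S) (ker_form \<alpha>1) (ker_form \<alpha>2) (descend G)"
  unfolding contactomorphism_def
proof (intro conjI ballI diffeo_onto_image_descend(2)[OF d])
  fix q assume "q \<in> cyl -` cyl ` S"
  have S: "axis_nbhd S" using d by (simp add: circle_diffeo_def)
  have q: "q \<in> S" using \<open>q \<in> cyl -` cyl ` S\<close> by (simp only: vimage_cyl_image[OF S])
  have Gq: "G q \<in> T" using d q by (auto simp: circle_diffeo_def)
  let ?G' = "frechet_derivative G (at q)"
  obtain c where c: "c \<noteq> 0" "\<And>v. form_coeffs \<alpha>2 (G q) \<bullet> ?G' v = c * (form_coeffs \<alpha>1 q \<bullet> v)"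
    using eq[OF q] by blast
  have "((\<lambda>q. cyl (G q)) has_derivative (\<lambda>v. frame (cyl (G q)) (?G' v))) (at q)"
    by (rule has_derivative_compose[OF circle_diffeo_has_derivative[OF d q] cyl_has_derivative])
  then have "(descend G \<circ> cyl has_derivative (\<lambda>v. frame (cyl (G q)) (?G' v))) (at q)"
    by (rule has_derivative_transform_within_open[OF _ axis_nbhdD(1)[OF S] q]) (simp add: descend_cyl[OF d])
  from frechet_derivative_at[OF this, symmetric]
  have D: "frechet_derivative (descend G \<circ> cyl) (at q) = (\<lambda>v. frame (cyl (G q)) (?G' v))" .
  have ker1: "frame (cyl q) v \<in> ker_form \<alpha>1 (cyl q) \<longleftrightarrow> form_coeffs \<alpha>1 q \<bullet> v = 0" for v
    using inner_form_coeffs[OF form(1), of q v] q sub(1) by (auto simp: ker_form_def tangent_def pullback_cyl_def)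
  have ker2: "ker_form \<alpha>2 (cyl (G q)) = frame (cyl (G q)) ` {w. form_coeffs \<alpha>2 (G q) \<bullet> w = 0}"
    using inner_form_coeffs[OF form(2), of "G q"] Gq sub(2) by (auto simp: ker_form_def tangent_def pullback_cyl_def)
  have surj: "?G' (frechet_derivative H (at (G q)) w) = w" for w
    using circle_diffeo_derivative_inverse[OF circle_diffeo_sym[OF d] Gq, of w] d q
    by (simp add: circle_diffeo_def)
  have "?G' ` {v. form_coeffs \<alpha>1 q \<bullet> v = 0} = {w. form_coeffs \<alpha>2 (G q) \<bullet> w = 0}"
  proof
    show "?G' ` {v. form_coeffs \<alpha>1 q \<bullet> v = 0} \<subseteq> {w. form_coeffs \<alpha>2 (G q) \<bullet> w = 0}" using c by auto
    show "{w. form_coeffs \<alpha>2 (G q) \<bullet> w = 0} \<subseteq> ?G' ` {v. form_coeffs \<alpha>1 q \<bullet> v = 0}"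
    proof
      fix w assume "w \<in> {w. form_coeffs \<alpha>2 (G q) \<bullet> w = 0}"
      then have "form_coeffs \<alpha>1 q \<bullet> frechet_derivative H (at (G q)) w = 0"
        using c(1) c(2)[of "frechet_derivative H (at (G q)) w"] surj[of w] by simp
      then show "w \<in> ?G' ` {v. form_coeffs \<alpha>1 q \<bullet> v = 0}" using surj[of w] by (intro image_eqI[of w ?G']) auto
    qed
  qed
  then have "frame (cyl (G q)) ` ?G' ` {v. form_coeffs \<alpha>1 q \<bullet> v = 0} = frame (cyl (G q)) ` {w. form_coeffs \<alpha>2 (G q) \<bullet> w = 0}"
    by (rule arg_cong)
  then show "frechet_derivative (descend G \<circ> cyl) (at q) ` {v. frame (cyl q) v \<in> ker_form \<alpha>1 (cyl q)} =
      ker_form \<alpha>2 (descend G (cyl q))"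
    unfolding descend_cyl[OF d q] ker1 ker2 D by (simp only: image_image)
qed

theorem proposition3:
  fixes \<alpha>1 \<alpha>2 :: one_form and V1 V2 :: "point set" and \<mu> :: "complex \<Rightarrow> real"
  assumes "openin (top_of_set S1R2) V1" and "core_circle \<subseteq> V1"
    and "openin (top_of_set S1R2) V2" and "core_circle \<subseteq> V2"
    and "positive_contact_form_on V1 \<alpha>1" and "positive_contact_form_on V2 \<alpha>2"
    and "smooth_on UNIV (\<lambda>\<theta>. \<mu> (cis \<theta>))" and "\<forall>z\<in>sphere 0 1. \<mu> z > 0"
    and "\<forall>p\<in>core_circle. \<alpha>1 p (d_theta p) = \<mu> (fst p) * \<alpha>2 p (d_theta p)"
  shows "\<exists>U f. openin (top_of_set S1R2) U \<and> core_circle \<subseteq> U \<and> U \<subseteq> V1 \<and> f ` U \<subseteq> V2 \<and>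
      contactomorphism U (ker_form \<alpha>1) (ker_form \<alpha>2) f \<and> (\<forall>p\<in>core_circle. f p = p)"
proof -
  define a1 where "a1 = (\<lambda>\<theta>. \<alpha>1 (cyl (\<theta>, 0, 0)) (d_theta (cyl (\<theta>, 0, 0))))"
  define a2 where "a2 = (\<lambda>\<theta>. \<alpha>2 (cyl (\<theta>, 0, 0)) (d_theta (cyl (\<theta>, 0, 0))))"
  define f where "f = (\<lambda>q::coords. \<mu> (cis (fst q)))"
  have core: "core_circle = range (\<lambda>\<theta>. cyl (\<theta>, 0, 0))"
  proof
    show "core_circle \<subseteq> range (\<lambda>\<theta>. cyl (\<theta>, 0, 0))"
    proof
      fix p assume "p \<in> core_circle"
      then obtain z where z: "norm z = 1" "p = (z, 0, 0)" by (auto simp: core_circle_def)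
      then have "z \<noteq> 0" by auto
      then have "p = cyl (Arg z, 0, 0)" using z cis_Arg[of z] by (simp add: cyl_def sgn_div_norm)
      then show "p \<in> range (\<lambda>\<theta>. cyl (\<theta>, 0, 0))" by blast
    qed
  qed (auto simp: core_circle_def cyl_def)
  note 1 = contact_along_axis_form_coeffs[OF assms(1,2,5), folded a1_def]
  note 2 = contact_along_axis_form_coeffs[OF assms(3,4,6), folded a2_def]
  have S2: "axis_nbhd (cyl -` V2)" using 2 by (simp add: contact_along_axis_def)
  have f: "smooth_on (cyl -` V2) f"
    unfolding f_def
    by (rule smooth_on_compose[OF assms(7) axis_nbhdD(1)[OF S2]])
      (auto simp: smooth_on_def intro: Ck_on_fst[OF axis_nbhdD(1)[OF S2] Ck_on_ident])
  have f_nz: "f q \<noteq> 0" for q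
  proof -
    have "\<mu> (cis (fst q)) > 0" using assms(8) by simp
    then show ?thesis by (simp add: f_def)
  qed
  have f_period: "f (q + period) = f q" for q
    using cyl_plus_period[of q] unfolding f_def cyl_eq by simp
  have a1_eq: "a1 = (\<lambda>\<theta>. f (\<theta>, 0, 0) * a2 \<theta>)"
  proof
    fix \<theta>
    have "cyl (\<theta>, 0, 0) \<in> core_circle" by (simp add: core)
    then show "a1 \<theta> = f (\<theta>, 0, 0) * a2 \<theta>"
      using assms(9) by (auto simp: a1_def a2_def f_def cyl_eq)
  qed
  have "contact_along_axis a1 (cyl -` V2) (\<lambda>q. f q *\<^sub>R form_coeffs \<alpha>2 q)"
    unfolding a1_eq by (rule contact_along_axis_scaleR[OF 2 f f_period f_nz])
  then have "contact_equivalent (cyl -` V1) (form_coeffs \<alpha>1) (cyl -` V2) (\<lambda>q. f q *\<^sub>R form_coeffs \<alpha>2 q)"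
    by (intro contact_equivalent_trans[OF contact_normal_form[OF 1] contact_equivalent_sym] contact_normal_form)
  \<comment> \<open>Rescaling does not change the kernel, so the comparison with the multiple of
    \<open>\<alpha>2\<close> transfers to \<open>\<alpha>2\<close> itself.\<close>
  moreover have "contact_equivalent (cyl -` V2) (form_coeffs \<alpha>2) (cyl -` V2) (\<lambda>q. f q *\<^sub>R form_coeffs \<alpha>2 q)"
    by (rule contact_equivalent_scaleR[OF S2 subset_refl subset_refl, of f]) (simp add: f_nz)
  ultimately have "contact_equivalent (cyl -` V1) (form_coeffs \<alpha>1) (cyl -` V2) (form_coeffs \<alpha>2)"
    using contact_equivalent_trans contact_equivalent_sym by blast
  then obtain S G T H where d: "circle_diffeo S G T H" and sub: "S \<subseteq> cyl -` V1" "T \<subseteq> cyl -` V2"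
    and eq: "\<And>q. q \<in> S \<Longrightarrow> \<exists>c. c \<noteq> 0 \<and>
      (\<forall>v. form_coeffs \<alpha>2 (G q) \<bullet> frechet_derivative G (at q) v = c * (form_coeffs \<alpha>1 q \<bullet> v))"
    unfolding contact_equivalent_def by blast
  have S: "axis_nbhd S" using d by (simp add: circle_diffeo_def)
  have fixed: "descend G p = p" if "p \<in> core_circle" for p
  proof -
    from that obtain \<theta> where "p = cyl (\<theta>, 0, 0)" unfolding core by (rule rangeE)
    then show ?thesis using descend_cyl[OF d axis_nbhdD(3)[OF S]] d by (simp add: circle_diffeo_def)
  qed
  show ?thesis
  proof (rule exI[of _ "cyl ` S"], rule exI[of _ "descend G"], intro conjI ballI)
    show "openin (top_of_set S1R2) (cyl ` S)" by (rule openin_cyl_image[OF S])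
    show "core_circle \<subseteq> cyl ` S" using axis_nbhdD(3)[OF S] by (auto simp: core)
    show "cyl ` S \<subseteq> V1" using sub(1) by (simp only: image_subset_iff_subset_vimage)
    show "descend G ` cyl ` S \<subseteq> V2"
      unfolding diffeo_onto_image_descend(1)[OF d] using sub(2) by (simp only: image_subset_iff_subset_vimage)
    show "contactomorphism (cyl ` S) (ker_form \<alpha>1) (ker_form \<alpha>2) (descend G)"
      using assms(5,6) by (intro contactomorphism_descend[OF d sub _ _ eq]) (auto simp: positive_contact_form_on_def)
  qed (rule fixed)
qed

end
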